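(* Let $n\ge 1$, $\pi \in \mathcal{S}_n$ and $\beta > 1$. Define the eventually periodic sequence \[ a = \begin{cases}z_{[m,n)}\, \overline{z_{[\ell,n)}} & \mbox{if $n-m$ is even, $\pi(n) \ne 1$, and $\pi$ is not collapsed}, \\ \overline{z_{[m,n)} 0} & \mbox{if $n-m$ is even and}\ \pi(n) = 1, \\ \min_{0\le i<|r-\ell|} z^{(i)}_{[m,n)}\, \overline{z^{(i)}_{[\ell,n)}} & \mbox{if $n-m$ is even and $\pi$ is collapsed}, \\ z_{[m,n)}\, \overline{z_{[r,n)}} & \mbox{if $n-m$ is odd and $\pi$ is not collapsed}, \\ \min_{0\le i<|r-\ell|} z^{(i)}_{[m,n)}\, \overline{z^{(i)}_{[r,n)}} & \mbox{if $n-m$ is odd and $\pi$ is collapsed},\end{cases} \] where the minima are taken with respect to the alternating lexicographical order. Then $\pi \in \mathcal{A}(T_{-\beta})$ if and only if $\beta > b(a)$. In particular $B_-(\pi) = b(a)$, and $B_-(\pi)$ is either $1$ or an Yrrap number.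
   Context: $\mathcal{S}_n$ is the symmetric group on $\{1,\dots,n\}$; $\mathbb{N}=\{0,1,2,\dots\}$. For an ordered set $X$, a map $f:X\to X$, $x\in X$ with $f^i(x)\ne f^j(x)$ for $0\le i<j<n$, and $\pi\in\mathcal{S}_n$, write $\mathrm{Pat}(x,f,n)=\pi$ if $\pi(i)<\pi(j)$ exactly when $f^{i-1}(x)<f^{j-1}(x)$ ($1\le i,j\le n$). $\mathcal{A}(f)=\{\mathrm{Pat}(x,f,n): x\in X, n\ge1\}$. For $\beta>1$, $T_{-\beta}:(0,1]\to(0,1]$, $x\mapsto\lfloor\beta x\rfloor+1-\beta x$, and $B_-(\pi)=\inf\{\beta>1:\pi\in\mathcal{A}(T_{-\beta})\}$. Alternating lexicographical order on sequences (and on finite words of equal length): $v_1v_2\cdots<w_1w_2\cdots$ if for some $k\ge1$, $v_1\cdots v_{k-1}=w_1\cdots w_{k-1}$ and $v_k<w_k$ when $k$ is odd, $w_k<v_k$ when $k$ is even. Notation: $w_{[i,j)}=w_i\cdots w_{j-1}$ (empty if $i=j$), $w_{[i,\infty)}=w_iw_{i+1}\cdots$, $\overline{v}$ is the purely periodic sequence $vvv\cdots$. The $(-\beta)$-expansion of $x\in(0,1]$ is $d_{-\beta}(x)=d_{-\beta,1}(x)d_{-\beta,2}(x)\cdots$ with $d_{-\beta,k}(x)=\lfloor\beta T_{-\beta}^{k-1}(x)\rfloor$. A number $\beta>1$ is an Yrrap number if $d_{-\beta}(1)$ is eventually periodic. For a bounded $w\in\mathbb{N}^\infty$, $\widehat{w}=\sup_{k\ge1}w_{[k,\infty)}$.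 Let $\varphi$ be the substitution $0\mapsto1$, $1\mapsto100$, with fixed point $u=100111001001001110011\cdots$. For $w$ with $\widehat w=w$: if $w>u$, $b(w)$ is the largest positive solution $x>1$ (which exists) of $1+\sum_{k\ge1}\frac{w_k+1}{(-x)^k}=0$; if $w\le u$, $b(w)=1$. For $\pi\in\mathcal{S}_n$: $m=\pi^{-1}(n)$; $\ell=\pi^{-1}(\pi(n)-1)$ if $\pi(n)\ne1$; $r=\pi^{-1}(\pi(n)+1)$ if $\pi(n)\ne n$. For $1\le j<n$, $z_j=\#\{1\le i<\pi(j):\ (i\ne\pi(n)\ne i+1$ and $\pi(\pi^{-1}(i)+1)<\pi(\pi^{-1}(i+1)+1))$ or $(i+1=\pi(n)\ne n$ and $\pi(\ell+1)<\pi(r+1))\}$. $\pi$ is collapsed if $\pi(n)\notin\{1,n\}$ and (as finite words) $z_{[\ell,n)}=z_{[r,n)}z_{[r,n)}$ or $z_{[r,n)}=z_{[\ell,n)}z_{[\ell,n)}$. In that case, for $0\le i<|r-\ell|$ and $1\le j<n$, $z^{(i)}_j=z_j+1$ if ($\pi(j)\ge\pi(r+i)$ and $i$ is even) or ($\pi(j)\ge\pi(\ell+i)$ and $i$ is odd), and $z^{(i)}_j=z_j$ otherwise. *)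

theory Defs
  imports "HOL-Analysis.Analysis" "HOL-Combinatorics.Permutations" "HOL-Library.Stream"
begin

section \<open>Patterns of iterated maps\<close>

definition is_Pat :: "'a::linorder \<Rightarrow> ('a \<Rightarrow> 'a) \<Rightarrow> nat \<Rightarrow> (nat \<Rightarrow> nat) \<Rightarrow> bool" where
  "is_Pat x f n \<pi> \<longleftrightarrow>
     \<pi> permutes {1..n} \<and>
     (\<forall>i j. i < j \<and> j < n \<longrightarrow> (f ^^ i) x \<noteq> (f ^^ j) x) \<and>
     (\<forall>i\<in>{1..n}. \<forall>j\<in>{1..n}. \<pi> i < \<pi> j \<longleftrightarrow> (f ^^ (i - 1)) x < (f ^^ (j - 1)) x)"

text \<open>Elements of different symmetric groups can be represented by the same function
  (extended by the identity), so a pattern is recorded together with its length.\<close>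

definition patterns :: "'a::linorder set \<Rightarrow> ('a \<Rightarrow> 'a) \<Rightarrow> (nat \<times> (nat \<Rightarrow> nat)) set" where
  "patterns X f = {(n, \<pi>). n \<ge> 1 \<and> (\<exists>x\<in>X. is_Pat x f n \<pi>)}"

definition T_neg :: "real \<Rightarrow> real \<Rightarrow> real" where
  "T_neg \<beta> x = of_int \<lfloor>\<beta> * x\<rfloor> + 1 - \<beta> * x"

definition B_minus :: "nat \<Rightarrow> (nat \<Rightarrow> nat) \<Rightarrow> real" where
  "B_minus n \<pi> = Inf {\<beta>. \<beta> > 1 \<and> (n, \<pi>) \<in> patterns {0<..1} (T_neg \<beta>)}"


section \<open>Sequences and expansions\<close>

text \<open>Stream positions start at 0, so the \<open>k\<close>-th letter of a sequence (\<open>k \<ge> 1\<close>) sits at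
  position \<open>k - 1\<close>; the parity in the alternating order is shifted accordingly.\<close>

definition alt_less :: "nat stream \<Rightarrow> nat stream \<Rightarrow> bool" where
  "alt_less v w \<longleftrightarrow>
     (\<exists>k. (\<forall>i<k. v !! i = w !! i) \<and>
          (if even k then v !! k < w !! k else w !! k < v !! k))"

definition alt_le :: "nat stream \<Rightarrow> nat stream \<Rightarrow> bool" where
  "alt_le v w \<longleftrightarrow> alt_less v w \<or> v = w"

definition alt_Min :: "nat stream set \<Rightarrow> nat stream" where
  "alt_Min S = (THE s. s \<in> S \<and> (\<forall>t\<in>S. alt_le s t))"

definition alt_Sup :: "nat stream set \<Rightarrow> nat stream" where
  "alt_Sup S = (THE s. (\<forall>t\<in>S. alt_le t s) \<and> (\<forall>s'. (\<forall>t\<in>S. alt_le t s') \<longrightarrow> alt_le s s'))"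

definition hat :: "nat stream \<Rightarrow> nat stream" where
  "hat w = alt_Sup {sdrop k w | k. True}"

definition expansion :: "real \<Rightarrow> real \<Rightarrow> nat stream" where
  "expansion \<beta> x = smap (\<lambda>k. nat \<lfloor>\<beta> * (T_neg \<beta> ^^ k) x\<rfloor>) nats"

definition eventually_periodic :: "'a stream \<Rightarrow> bool" where
  "eventually_periodic w \<longleftrightarrow> (\<exists>p q. q \<noteq> [] \<and> w = p @- cycle q)"

definition yrrap :: "real \<Rightarrow> bool" where
  "yrrap \<beta> \<longleftrightarrow> \<beta> > 1 \<and> eventually_periodic (expansion \<beta> 1)"


section \<open>The substitution and its fixed point\<close>

text \<open>Only the letters 0 and 1 matter; other letters are treated like 1.\<close>

definition phi :: "nat \<Rightarrow> nat list" where
  "phi c = (if c = 0 then [1] else [1, 0, 0])"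

definition phi_word :: "nat list \<Rightarrow> nat list" where
  "phi_word w = concat (map phi w)"

text \<open>Every \<open>(phi_word ^^ k) [1]\<close> is a prefix of the next one and has length greater than \<open>k\<close>,
  so the fixed point can be read off diagonally.\<close>

definition u_seq :: "nat stream" where
  "u_seq = smap (\<lambda>k. (phi_word ^^ k) [1] ! k) nats"

lemma phi_word_append: "phi_word (v @ w) = phi_word v @ phi_word w"
  by (simp add: phi_word_def)

lemma phi_word_power_append:
  "(phi_word ^^ k) (v @ w) = (phi_word ^^ k) v @ (phi_word ^^ k) w"
  by (induction k) (simp_all add: phi_word_append)

lemma length_phi_word: "length w \<le> length (phi_word w)"
  by (induction w) (auto simp: phi_word_def phi_def)

lemma phi_word_power_Suc:
  "(phi_word ^^ Suc k) [1] = (phi_word ^^ k) [1] @ (phi_word ^^ k) [0, 0]"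
proof -
  have "(phi_word ^^ Suc k) [1] = (phi_word ^^ k) ([1] @ [0, 0])"
    by (simp only: funpow_Suc_right o_apply) (simp add: phi_word_def phi_def)
  then show ?thesis
    by (simp only: phi_word_power_append)
qed

lemma length_phi_word_power: "k < length ((phi_word ^^ k) [1])"
proof (induction k)
  case (Suc k)
  have "length w \<le> length ((phi_word ^^ k) w)" for w
    by (induction k) (auto intro: order_trans length_phi_word)
  from this[of "[0, 0]"] have "2 \<le> length ((phi_word ^^ k) [0, 0])"
    by simp
  with Suc show ?case
    unfolding phi_word_power_Suc by simp
qed simp

lemma phi_word_power_nth:
  assumes "i < length ((phi_word ^^ k) [1])" "k \<le> l"
  shows "i < length ((phi_word ^^ l) [1]) \<and> (phi_word ^^ l) [1] ! i = (phi_word ^^ k) [1] ! i"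
  using assms(2)
proof (induction l rule: dec_induct)
  case base
  show ?case using assms(1) by simp
next
  case (step l)
  then show ?case
    unfolding phi_word_power_Suc by (simp add: nth_append)
qed

lemma stake_u_seq: "stake (length ((phi_word ^^ k) [1])) u_seq = (phi_word ^^ k) [1]"
proof (rule nth_equalityI)
  fix i assume "i < length (stake (length ((phi_word ^^ k) [1])) u_seq)"
  then have i: "i < length ((phi_word ^^ k) [1])" by simp
  have "(phi_word ^^ i) [1] ! i = (phi_word ^^ k) [1] ! i"
  proof (cases "i \<le> k")
    case True
    then show ?thesis
      using phi_word_power_nth[OF length_phi_word_power True] by simp
  next
    case False
    then show ?thesis
      using phi_word_power_nth[OF i, of i] by simp
  qed
  then show "stake (length ((phi_word ^^ k) [1])) u_seq ! i = (phi_word ^^ k) [1] ! i"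
    using i by (simp add: u_seq_def)
qed simp

lemma u_seq_fixed_point: "u_seq = phi_word (stake k u_seq) @- sdrop (length (phi_word (stake k u_seq))) u_seq"
proof -
  let ?v = "(phi_word ^^ k) [1]" and ?w = "phi_word (stake k u_seq)"
  have "?v = stake k u_seq @ drop k ?v"
    using length_phi_word_power[of k] stake_u_seq[of k]
    by (metis append_take_drop_id less_imp_le min.absorb1 take_stake)
  then have "phi_word ?v = ?w @ phi_word (drop k ?v)"
    by (metis phi_word_append)
  then have *: "(phi_word ^^ Suc k) [1] = ?w @ phi_word (drop k ?v)"
    by simp
  then have "stake (length ?w) u_seq = ?w"
    using stake_u_seq[of "Suc k"]
    by (metis append_eq_conv_conj length_append le_add1 min.absorb1 take_stake)
  then show ?thesis
    by (metis stake_sdrop)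
qed


section \<open>The number attached to a sequence\<close>

text \<open>\<open>b_num w\<close> is left unspecified unless \<open>hat w = w\<close>. That condition forces \<open>w\<close> to be
  bounded, by its first letter.\<close>

definition b_num :: "nat stream \<Rightarrow> real" where
  "b_num w =
     (if hat w = w then
        if alt_less u_seq w then
          (GREATEST x. x > 1 \<and> 1 + (\<Sum>k. (real (w !! k) + 1) / (- x) ^ Suc k) = 0)
        else 1
      else undefined)"


section \<open>Sequences attached to a permutation\<close>

context
  fixes n :: nat and \<pi> :: "nat \<Rightarrow> nat"
begin

definition m_pos :: nat where "m_pos = inv \<pi> n"

text \<open>\<open>l_pos\<close> is meaningful only for \<open>\<pi> n \<noteq> 1\<close>, and \<open>r_pos\<close> only for \<open>\<pi> n \<noteq> n\<close>.\<close>

definition l_pos :: nat where "l_pos = inv \<pi> (\<pi> n - 1)"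

definition r_pos :: nat where "r_pos = inv \<pi> (\<pi> n + 1)"

definition z_digit :: "nat \<Rightarrow> nat" where
  "z_digit j = card {i. 1 \<le> i \<and> i < \<pi> j \<and>
     ((i \<noteq> \<pi> n \<and> \<pi> n \<noteq> i + 1 \<and> \<pi> (inv \<pi> i + 1) < \<pi> (inv \<pi> (i + 1) + 1)) \<or>
      (i + 1 = \<pi> n \<and> \<pi> n \<noteq> n \<and> \<pi> (l_pos + 1) < \<pi> (r_pos + 1)))}"

definition z_shift :: "nat \<Rightarrow> nat \<Rightarrow> nat" where
  "z_shift i j =
     (if (\<pi> j \<ge> \<pi> (r_pos + i) \<and> even i) \<or> (\<pi> j \<ge> \<pi> (l_pos + i) \<and> odd i)
      then z_digit j + 1 else z_digit j)"

end

definition subword :: "(nat \<Rightarrow> nat) \<Rightarrow> nat \<Rightarrow> nat \<Rightarrow> nat list" where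
  "subword w i j = map w [i..<j]"

definition collapsed :: "nat \<Rightarrow> (nat \<Rightarrow> nat) \<Rightarrow> bool" where
  "collapsed n \<pi> \<longleftrightarrow>
     \<pi> n \<notin> {1, n} \<and>
     (let zl = subword (z_digit n \<pi>) (l_pos n \<pi>) n; zr = subword (z_digit n \<pi>) (r_pos n \<pi>) n
      in zl = zr @ zr \<or> zr = zl @ zl)"

definition a_seq :: "nat \<Rightarrow> (nat \<Rightarrow> nat) \<Rightarrow> nat stream" where
  "a_seq n \<pi> =
    (let m = m_pos n \<pi>; l = l_pos n \<pi>; r = r_pos n \<pi>;
         zw = (\<lambda>k. subword (z_digit n \<pi>) k n);
         zs = (\<lambda>i k. subword (z_shift n \<pi> i) k n);
         I = {i. int i < \<bar>int r - int l\<bar>}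
     in if even (n - m) then
          if \<pi> n = 1 then cycle (zw m @ [0])
          else if \<not> collapsed n \<pi> then zw m @- cycle (zw l)
          else alt_Min {zs i m @- cycle (zs i l) | i. i \<in> I}
        else
          if \<not> collapsed n \<pi> then zw m @- cycle (zw r)
          else alt_Min {zs i m @- cycle (zs i r) | i. i \<in> I})"

end

theory Submission
  imports Defs
begin

text \<open>Write \<open>d \<beta>\<close> for the expansion of \<open>1\<close> and \<open>val \<beta> w\<close> for the number with digit sequence \<open>w\<close>,
  so that \<open>b_num w\<close> is the largest solution \<open>x\<close> of \<open>val x w = 1\<close>. Two facts carry the analytic part.
  First, \<open>val \<beta>\<close> is weakly monotone on the sequences all of whose shifts are at most \<open>d \<beta>\<close>. Second,
  \<open>val x (d \<beta>) \<noteq> 1\<close> for \<open>x > \<beta>\<close>. A continuity argument in \<open>\<beta>\<close> then shows that \<open>d\<close> is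
  strictly increasing with limit \<open>u_seq\<close> at \<open>1\<close>, and that, for a sequence \<open>a\<close> bounding all its shifts,
  \<open>b_num a < \<beta>\<close> holds iff \<open>a < d \<beta>\<close> and \<open>val \<beta> a < 1\<close>.

  The digits \<open>z_digit\<close> are the smallest ones compatible with \<open>\<pi>\<close>, and the words \<open>z\<^sub>j \<dots> z\<^sub>n\<^sub>-\<^sub>1\<close> followed
  by the tail of \<open>a\<close> are weakly ordered by \<open>\<pi>\<close>. Unless \<open>\<pi>\<close> is collapsed, the \<open>n\<close>-th point is tied
  only with points on one side of it, so moving it a little realizes \<open>\<pi>\<close> as soon as
  \<open>val \<beta> a < 1\<close>. Conversely the digits of a point with pattern \<open>\<pi>\<close> exceed \<open>z_digit\<close>
  monotonically along \<open>\<pi>\<close>, whence \<open>a\<close> is at most the expansion of some point of its orbit; in the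
  collapsed case some digits must be strictly larger, and the cheapest choices are the \<open>z_shift\<close>.\<close>

section \<open>The alternating order\<close>

text \<open>The delicate value is 1. One number may be the value of several sequences: in base 2
  both 1010... and the expansion 222... of 1 have value 1, because a shift of 1010... has the value
  0, which lies outside \<open>(0,1]\<close>. Hence \<open>val\<close> cannot be strictly monotone,
  and \<open>val \<beta> a < 1\<close> does not follow from \<open>a < d \<beta>\<close>. Strictness
  returns once all shifts have values below 1. Nor is \<open>val x a\<close> monotone in the base
  \<open>x\<close>. Solutions are therefore produced by the intermediate value theorem and excluded
  by continuity, and the exclusion of solutions for \<open>d \<beta>\<close> to the right of
  \<open>\<beta>\<close> cannot be had by differentiating; it needs an invariant argument about the
  map itself. The value 1 is also an obstacle for orbits. A point at 1 cannot be moved upwards, so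
  ties are only broken among values below 1; conversely, an orbit that passes through 1 has to be
  pushed off it, keeping its pattern, before strict bounds can be read from it.\<close>

lemma alt_less_Stream:
  "alt_less (x ## v) (y ## w) \<longleftrightarrow> x < y \<or> x = y \<and> alt_less w v"
proof
  assume "alt_less (x ## v) (y ## w)"
  then obtain k where k: "\<forall>i<k. (x ## v) !! i = (y ## w) !! i"
    "if even k then (x ## v) !! k < (y ## w) !! k else (y ## w) !! k < (x ## v) !! k"
    unfolding alt_less_def by blast
  show "x < y \<or> x = y \<and> alt_less w v"
  proof (cases k)
    case 0
    with k show ?thesis by simp
  next
    case (Suc l)
    have "x = y" using k(1) Suc by (metis snth.simps(1) stream.sel(1) zero_less_Suc)
    moreover have "\<forall>i<l. w !! i = v !! i" using k(1) Suc
      by (metis Suc_less_eq snth.simps(2) stream.sel(2))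
    ultimately show ?thesis using k(2) Suc unfolding alt_less_def by auto
  qed
next
  assume *: "x < y \<or> x = y \<and> alt_less w v"
  show "alt_less (x ## v) (y ## w)"
  proof (cases "x < y")
    case True
    then show ?thesis unfolding alt_less_def by (intro exI[of _ 0]) simp
  next
    case False
    with * obtain l where l: "\<forall>i<l. w !! i = v !! i"
      "if even l then w !! l < v !! l else v !! l < w !! l" "x = y"
      unfolding alt_less_def by auto
    have "(x ## v) !! i = (y ## w) !! i" if "i < Suc l" for i
      using that l by (cases i) auto
    with l show ?thesis unfolding alt_less_def by (intro exI[of _ "Suc l"]) auto
  qed
qed

lemma stream_eqI: "(\<And>k. v !! k = w !! k) \<Longrightarrow> v = w"
  using smap_alt[of id v w] by (simp add: stream.map_id)

lemma alt_less_irrefl [simp]: "\<not> alt_less v v"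
  unfolding alt_less_def by auto

lemma alt_less_total:
  assumes "v \<noteq> w" shows "alt_less v w \<or> alt_less w v"
proof -
  define k where "k = (LEAST k. v !! k \<noteq> w !! k)"
  obtain j where "v !! j \<noteq> w !! j"
    using assms stream_eqI by blast
  then have "v !! k \<noteq> w !! k" unfolding k_def by (rule LeastI)
  moreover have "v !! i = w !! i" if "i < k" for i
    using that not_less_Least unfolding k_def by blast
  ultimately show ?thesis unfolding alt_less_def by (metis nat_neq_iff)
qed

lemma alt_less_trans:
  assumes "alt_less u v" "alt_less v w" shows "alt_less u w"
proof -
  obtain k where k: "\<forall>i<k. u !! i = v !! i"
    "if even k then u !! k < v !! k else v !! k < u !! k"
    using assms(1) unfolding alt_less_def by blast
  obtain l where l: "\<forall>i<l. v !! i = w !! i"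
    "if even l then v !! l < w !! l else w !! l < v !! l"
    using assms(2) unfolding alt_less_def by blast
  have *: "\<forall>i<min k l. u !! i = w !! i" using k l by simp
  have "if even (min k l) then u !! min k l < w !! min k l else w !! min k l < u !! min k l"
  proof (cases k l rule: linorder_cases)
    case less then show ?thesis using k l by (auto simp: min_def)
  next
    case equal then show ?thesis using k l by (auto simp: min_def split: if_splits)
  next
    case greater then show ?thesis using k l by (auto simp: min_def split: if_splits)
  qed
  with * show ?thesis unfolding alt_less_def by blast
qed

lemma alt_less_asym: "alt_less v w \<Longrightarrow> \<not> alt_less w v"
  using alt_less_trans[of v w v] by auto

lemma alt_le_refl [simp]: "alt_le v v"
  by (simp add: alt_le_def)

lemma alt_le_trans: "alt_le u v \<Longrightarrow> alt_le v w \<Longrightarrow> alt_le u w"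
  using alt_less_trans[of u v w] by (auto simp: alt_le_def)

lemma alt_le_less_trans: "alt_le u v \<Longrightarrow> alt_less v w \<Longrightarrow> alt_less u w"
  using alt_less_trans[of u v w] by (auto simp: alt_le_def)

lemma alt_less_le_trans: "alt_less u v \<Longrightarrow> alt_le v w \<Longrightarrow> alt_less u w"
  using alt_less_trans[of u v w] by (auto simp: alt_le_def)

lemma not_alt_less: "\<not> alt_less v w \<longleftrightarrow> alt_le w v"
  using alt_less_total[of v w] alt_less_asym[of w v] by (auto simp: alt_le_def)

lemma not_alt_le: "\<not> alt_le v w \<longleftrightarrow> alt_less w v"
  using not_alt_less[of w v] by blast

lemma alt_le_antisym: "alt_le v w \<Longrightarrow> alt_le w v \<Longrightarrow> v = w"
  using alt_less_asym[of v w] by (auto simp: alt_le_def)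

lemma alt_less_imp_le: "alt_less v w \<Longrightarrow> alt_le v w"
  by (simp add: alt_le_def)

lemma alt_le_Stream:
  "alt_le (x ## v) (y ## w) \<longleftrightarrow> x < y \<or> x = y \<and> alt_le w v"
  unfolding alt_le_def alt_less_Stream by auto

lemma alt_le_shd: "alt_le v w \<Longrightarrow> shd v \<le> shd w"
  by (cases v; cases w) (auto simp: alt_le_Stream)

lemma alt_less_shift:
  "alt_less (p @- v) (p @- w) \<longleftrightarrow> (if even (length p) then alt_less v w else alt_less w v)"
  by (induction p arbitrary: v w) (auto simp: alt_less_Stream)

lemma alt_le_shift:
  "alt_le (p @- v) (p @- w) \<longleftrightarrow> (if even (length p) then alt_le v w else alt_le w v)"
  by (induction p arbitrary: v w) (auto simp: alt_le_Stream)

lemma alt_less_same_prefix: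
  assumes "length p = length q" "p \<noteq> q" "alt_less (p @- v) (q @- w)"
  shows "alt_less (p @- v') (q @- w')"
  using assms
proof (induction p arbitrary: q v w v' w')
  case (Cons x p)
  then obtain y q' where q: "q = y # q'" by (cases q) auto
  show ?case
  proof (cases "x = y")
    case True
    have "alt_less (q' @- w) (p @- v)" using Cons.prems q True by (simp add: alt_less_Stream)
    moreover have "\<not> alt_less (p @- v') (q' @- w')"
    proof
      assume "alt_less (p @- v') (q' @- w')"
      from Cons.IH[OF _ _ this, of v w] Cons.prems q True
      have "alt_less (p @- v) (q' @- w)" by simp
      with \<open>alt_less (q' @- w) (p @- v)\<close> show False using alt_less_asym by blast
    qed
    moreover have "p @- v' \<noteq> q' @- w'"
    proof
      assume "p @- v' = q' @- w'"
      then have "stake (length p) (p @- v') = stake (length q') (q' @- w')"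
        using Cons.prems q by simp
      with Cons.prems q True show False by (simp add: stake_shift)
    qed
    ultimately have "alt_less (q' @- w') (p @- v')" using alt_less_total by blast
    then show ?thesis using q True by (simp add: alt_less_Stream)
  next
    case False
    with Cons.prems q show ?thesis by (simp add: alt_less_Stream)
  qed
qed simp

lemma alt_less_at_prefix:
  assumes "alt_less v w"
  shows "\<exists>k. \<forall>v' w'. stake k v' = stake k v \<longrightarrow> stake k w' = stake k w \<longrightarrow> alt_less v' w'"
proof -
  obtain k where k: "\<forall>i<k. v !! i = w !! i"
    "if even k then v !! k < w !! k else w !! k < v !! k"
    using assms unfolding alt_less_def by blast
  show ?thesis
  proof (intro exI[of _ "Suc k"] allI impI)
    fix v' w' assume *: "stake (Suc k) v' = stake (Suc k) v" "stake (Suc k) w' = stake (Suc k) w"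
    have "v' !! i = v !! i" "w' !! i = w !! i" if "i < Suc k" for i
      using * that by (metis stake_nth)+
    with k show "alt_less v' w'" unfolding alt_less_def by (intro exI[of _ k]) auto
  qed
qed

section \<open>Periodic sequences and prepending a word\<close>

lemma cycle_eq_shift: "p \<noteq> [] \<Longrightarrow> p @- cycle p = cycle p"
  using cycle_decomp by metis

lemma stake_shift_same:
  "length p = length q \<Longrightarrow> p @- v = q @- w \<Longrightarrow> p = q \<and> v = w"
proof (induction p arbitrary: q)
  case (Cons x p) then show ?case by (cases q) auto
qed simp

lemma shift_eq_imp_cycle:
  assumes "p \<noteq> []" "p @- s = s" shows "s = cycle p"
proof -
  have "s !! k = cycle p !! k" for k
  proof (induction k rule: less_induct)
    case (less k)
    show ?case
    proof (cases "k < length p")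
      case True
      then show ?thesis using assms cycle_eq_shift[OF assms(1)]
        by (metis shift_snth_less)
    next
      case False
      then have "s !! k = s !! (k - length p)" "cycle p !! k = cycle p !! (k - length p)"
        using assms cycle_eq_shift[OF assms(1)] by (metis not_less shift_snth_ge)+
      then show ?thesis using less[of "k - length p"] False assms(1)
        by (metis diff_less length_greater_0_conv not_less order_less_le_trans)
    qed
  qed
  then show ?thesis by (rule stream_eqI)
qed

text \<open>If \<open>s < cycle p\<close>, look at the first difference. Inside the first block it
  contradicts \<open>p @- s \<le> s\<close> directly. Otherwise \<open>s = p @- s'\<close>: for even
  \<open>length p\<close> the tail \<open>s'\<close> satisfies the same hypothesis with an earlier
  difference, and for odd length the order reverses, giving the absurd chain
  \<open>cycle p < s' \<le> s\<close>.\<close>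

lemma cycle_le_of_shift_le:
  assumes "p \<noteq> []" "alt_le (p @- s) s" shows "alt_le (cycle p) s"
proof (rule ccontr)
  assume "\<not> ?thesis"
  then have "alt_less s (cycle p)" by (simp add: not_alt_le)
  then obtain k where k: "\<forall>i<k. s !! i = cycle p !! i"
    "if even k then s !! k < cycle p !! k else cycle p !! k < s !! k"
    unfolding alt_less_def by blast
  then show False using assms
  proof (induction k arbitrary: s rule: less_induct)
    case (less k)
    have c: "cycle p = p @- cycle p" using cycle_eq_shift[OF less.prems(3)] by simp
    have sl: "alt_less s (cycle p)" unfolding alt_less_def using less.prems(1,2) by blast
    show False
    proof (cases "length p \<le> k")
      case False
      have "stake (length p) s \<noteq> p"
      proof
        assume "stake (length p) s = p"
        then have "s !! k = p ! k" using False by (metis not_less stake_nth)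
        then have "s !! k = cycle p !! k" using False c by (metis not_less shift_snth_less)
        then show False using less.prems(2) by (simp split: if_splits)
      qed
      then have "alt_less s (p @- s)"
        using alt_less_same_prefix[of "stake (length p) s" p "sdrop (length p) s" "cycle p"
          "sdrop (length p) s" s] sl c by (simp add: stake_sdrop)
      with less.prems(4) show False using not_alt_less by blast
    next
      case True
      define s' where "s' = sdrop (length p) s"
      have "stake (length p) s = p"
      proof (rule nth_equalityI)
        fix i assume "i < length (stake (length p) s)"
        then have "i < length p" by simp
        then show "stake (length p) s ! i = p ! i"
          using less.prems(1) True c by (metis order_less_le_trans shift_snth_less stake_nth)
      qed simp
      then have s: "s = p @- s'" unfolding s'_def by (metis stake_sdrop)
      have le: "alt_le (p @- s) (p @- s')" using less.prems(4) s by simp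
      show False
      proof (cases "even (length p)")
        case True
        have le': "alt_le (p @- s') s'" using le True s by (simp add: alt_le_shift)
        have sn: "s' !! i = s !! (length p + i)" for i
          by (subst s) simp
        have cn: "cycle p !! i = cycle p !! (length p + i)" for i
          by (subst (2) c) simp
        have "\<forall>i<k - length p. s' !! i = cycle p !! i"
          using less.prems(1) sn cn by (metis less_diff_conv add.commute)
        moreover have "if even (k - length p) then s' !! (k - length p) < cycle p !! (k - length p)
          else cycle p !! (k - length p) < s' !! (k - length p)"
          using less.prems(2) sn[of "k - length p"] cn[of "k - length p"] \<open>length p \<le> k\<close> True by simp
        moreover have "k - length p < k" using \<open>length p \<le> k\<close> less.prems(3)
          by (metis diff_less length_greater_0_conv order_less_le_trans)
        ultimately show False using less.IH[of "k - length p" s'] less.prems(3) le' by blast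
      next
        case False
        then have "alt_le s' s" using le by (simp add: alt_le_shift)
        moreover have "alt_less (cycle p) s'"
          using sl c s False alt_less_shift[of p s' "cycle p"] by simp
        ultimately show False using sl alt_less_le_trans alt_less_asym by blast
      qed
    qed
  qed
qed

text \<open>Prepending a word of odd length reverses the order and leads back to
  \<open>cycle_le_of_shift_le\<close>. If \<open>p\<close> is odd, \<open>p\<close> itself serves.
  If \<open>p = x # q\<close> is even, \<open>q\<close> serves, at the price of replacing
  \<open>p\<close> by its rotation \<open>q @ [x]\<close>.\<close>

lemma le_cycle_of_le_shift:
  assumes "p \<noteq> []" "alt_le s (p @- s)" shows "alt_le s (cycle p)"
proof (cases "even (length p)")
  case False
  then have "alt_le (p @- p @- s) (p @- s)" using assms(2) alt_le_shift by auto
  from cycle_le_of_shift_le[OF assms(1) this] have "alt_le (p @- cycle p) (p @- s)"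
    using cycle_eq_shift[OF assms(1)] by simp
  then show ?thesis using False by (simp add: alt_le_shift)
next
  case True
  obtain x q where p: "p = x # q" using assms(1) by (cases p) auto
  with True have "odd (length q)" by simp
  then have "alt_le ((q @ [x]) @- q @- s) (q @- s)"
    using assms(2) alt_le_shift[of q "p @- s" s] p by simp
  from cycle_le_of_shift_le[OF _ this] have "alt_le (p @- s) (cycle p)"
    by (simp add: p cycle_Cons alt_le_Stream)
  with assms(2) show ?thesis by (rule alt_le_trans)
qed

section \<open>Expansions and their values\<close>

definition bounded_by :: "nat \<Rightarrow> nat stream \<Rightarrow> bool" where
  "bounded_by N w \<longleftrightarrow> (\<forall>k. w !! k \<le> N)"

text \<open>Solving \<open>T_neg x y = d + 1 - x * y\<close> for \<open>y\<close> and iterating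
  gives this alternating series.\<close>

definition val :: "real \<Rightarrow> nat stream \<Rightarrow> real" where
  "val x w = - (\<Sum>k. (real (w !! k) + 1) / (- x) ^ Suc k)"

text \<open>\<open>adm a a\<close> is the form in which the condition \<open>hat a = a\<close> is
  handled, without computing a supremum.\<close>

definition adm :: "nat stream \<Rightarrow> nat stream \<Rightarrow> bool" where
  "adm a w \<longleftrightarrow> (\<forall>k. alt_le (sdrop k w) a)"

lemma adm_bounded: "adm a w \<Longrightarrow> bounded_by (shd a) w"
  unfolding adm_def bounded_by_def using alt_le_shd by (metis sdrop_simps(1))

lemma adm_mono: "alt_le a b \<Longrightarrow> adm a w \<Longrightarrow> adm b w"
  unfolding adm_def using alt_le_trans by blast

lemma adm_le: "adm a w \<Longrightarrow> alt_le w a"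
  unfolding adm_def by (metis sdrop.simps(1))

lemma adm_sdrop: "adm a w \<Longrightarrow> adm a (sdrop k w)"
  unfolding adm_def by (simp add: sdrop_add)

lemma adm_stl: "adm a (c ## w) \<Longrightarrow> adm a w"
  using adm_sdrop[of a "c ## w" 1] by simp

lemma bounded_by_Stream [simp]: "bounded_by N (c ## w) \<longleftrightarrow> c \<le> N \<and> bounded_by N w"
  unfolding bounded_by_def
proof safe
  fix k assume "\<forall>k. (c ## w) !! k \<le> N"
  then show "w !! k \<le> N" by (metis snth.simps(2) stream.sel(2))
next
  assume "\<forall>k. (c ## w) !! k \<le> N"
  then show "c \<le> N" by (metis snth.simps(1) stream.sel(1))
next
  fix k assume "c \<le> N" "\<forall>k. w !! k \<le> N"
  then show "(c ## w) !! k \<le> N" by (cases k) auto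
qed

section \<open>The value as a function of the base\<close>

lemma sums_inverse_powers:
  fixes x :: real assumes "x > 1"
  shows "(\<lambda>k. 1 / x ^ Suc k) sums (1 / (x - 1))"
proof -
  have "(\<lambda>k. (1/x) ^ k * (1/x)) sums (1 / (1 - 1/x) * (1/x))"
    by (intro sums_mult2 geometric_sums) (use assms in auto)
  moreover have "1 / (1 - 1/x) * (1/x) = 1 / (x - 1)" using assms by (simp add: field_simps)
  ultimately show ?thesis by (simp add: power_divide mult.commute)
qed

lemma val_term_bound:
  assumes "x > 1" "bounded_by N w"
  shows "\<bar>(real (w !! k) + 1) / (- x) ^ Suc k\<bar> \<le> (real N + 1) * (1 / x ^ Suc k)"
proof -
  have "\<bar>(real (w !! k) + 1) / (- x) ^ Suc k\<bar> = (real (w !! k) + 1) / x ^ Suc k"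
    using assms(1) by (simp add: abs_divide power_abs abs_mult)
  also have "\<dots> \<le> (real N + 1) / x ^ Suc k"
    using assms unfolding bounded_by_def by (intro divide_right_mono) auto
  finally show ?thesis by simp
qed

lemma val_summable:
  assumes "x > 1" "bounded_by N w"
  shows "summable (\<lambda>k. (real (w !! k) + 1) / (- x) ^ Suc k)"
proof (rule summable_comparison_test'[where N = 0])
  show "summable (\<lambda>k. (real N + 1) * (1 / x ^ Suc k))"
    using sums_inverse_powers[OF assms(1)] by (intro summable_mult) (rule sums_summable)
qed (use val_term_bound[OF assms] in auto)

lemma val_Stream:
  assumes "x > 1" "bounded_by N w"
  shows "val x (c ## w) = (real c + 1 - val x w) / x"
proof -
  let ?f = "\<lambda>k. (real ((c ## w) !! k) + 1) / (- x) ^ Suc k"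
  have b: "bounded_by (max c N) (c ## w)" using assms(2)
    unfolding bounded_by_Stream unfolding bounded_by_def by (simp add: le_max_iff_disj)
  have "(\<Sum>k. ?f (Suc k)) = suminf ?f - ?f 0"
    using suminf_split_head[OF val_summable[OF assms(1) b]] by simp
  moreover have "(\<lambda>k. ?f (Suc k)) = (\<lambda>k. ((real (w !! k) + 1) / (- x) ^ Suc k) * (- (1 / x)))"
    by (auto simp: fun_eq_iff field_simps)
  moreover have "(\<Sum>k. ((real (w !! k) + 1) / (- x) ^ Suc k) * (- (1 / x))) = - val x w * (- (1 / x))"
    unfolding val_def minus_minus by (intro suminf_mult2[symmetric] val_summable[OF assms])
  ultimately show ?thesis unfolding val_def using assms(1) by (simp add: field_simps)
qed

text \<open>The recursion contracts by \<open>1 / x\<close>, so boundedness makes the remainder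
  \<open>f k / (- x) ^ k\<close> vanish. This identifies quantities not given by a series, such as
  the orbit of a point or the function \<open>cut\<close> below, with \<open>val\<close>.\<close>

lemma val_unique:
  assumes x: "x > 1" and C: "\<And>k. \<bar>f k\<bar> \<le> C"
    and rec: "\<And>k. f k = (real (w !! k) + 1 - f (Suc k)) / x"
  shows "val x w = f 0"
proof -
  let ?g = "\<lambda>k. f k / (- x) ^ k"
  have "?g \<longlonglongrightarrow> 0"
  proof (rule Lim_null_comparison)
    show "\<forall>\<^sub>F k in sequentially. norm (?g k) \<le> C * (1/x) ^ k"
    proof (intro always_eventually allI)
      fix k
      have "norm (?g k) = \<bar>f k\<bar> * (1/x)^k" using x by (simp add: power_abs power_divide)
      also have "\<dots> \<le> C * (1/x)^k" using C x by (intro mult_right_mono) auto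
      finally show "norm (?g k) \<le> C * (1/x)^k" .
    qed
    show "(\<lambda>k. C * (1/x) ^ k) \<longlonglongrightarrow> 0"
      using x by (intro tendsto_mult_right_zero LIMSEQ_realpow_zero) auto
  qed
  from telescope_sums'[OF this] have "(\<lambda>k. ?g k - ?g (Suc k)) sums (f 0)" by simp
  moreover have "?g k - ?g (Suc k) = - ((real (w !! k) + 1) / (- x) ^ Suc k)" for k
    using x by (subst rec) (simp add: field_simps)
  ultimately have "(\<lambda>k. - ((real (w !! k) + 1) / (- x) ^ Suc k)) sums (f 0)" by simp
  from sums_minus[OF this] show ?thesis unfolding val_def by (simp add: sums_iff)
qed

lemma abs_val_le:
  assumes "x > 1" "bounded_by N w"
  shows "\<bar>val x w\<bar> \<le> (real N + 1) / (x - 1)"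
proof -
  have s: "(\<lambda>k. (real N + 1) * (1 / x ^ Suc k)) sums ((real N + 1) * (1 / (x - 1)))"
    by (intro sums_mult sums_inverse_powers assms)
  have "\<bar>\<Sum>k. (real (w !! k) + 1) / (- x) ^ Suc k\<bar> \<le> (\<Sum>k. (real N + 1) * (1 / x ^ Suc k))"
    unfolding real_norm_def[symmetric]
    by (rule norm_suminf_le) (use val_term_bound[OF assms] s in \<open>auto simp: sums_iff\<close>)
  then show ?thesis unfolding val_def using s by (simp add: sums_iff)
qed

text \<open>The bound depends on \<open>w\<close> only through \<open>N\<close>. This uniformity
  matters in \<open>solution_of_kneading_le\<close>, where the base and the sequence vary
  together.\<close>

lemma val_diff:
  assumes "x > 1" "y > 1" "bounded_by N w"
  shows "\<bar>val x w - val y w\<bar> \<le> (real N + 1) * \<bar>1 / (x - 1) - 1 / (y - 1)\<bar>"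
  using assms
proof (induction x y rule: linorder_wlog)
  case (le x y)
  let ?f = "\<lambda>k. (real (w !! k) + 1) / (- x) ^ Suc k - (real (w !! k) + 1) / (- y) ^ Suc k"
  let ?g = "\<lambda>k. (real N + 1) * (1 / x ^ Suc k - 1 / y ^ Suc k)"
  have g: "?g sums ((real N + 1) * (1 / (x - 1) - 1 / (y - 1)))"
    by (intro sums_mult sums_diff sums_inverse_powers le)
  have f: "?f sums (- val x w - - val y w)"
    unfolding val_def minus_minus using le by (intro sums_diff summable_sums val_summable)
  have "norm (?f k) \<le> ?g k" for k
  proof -
    have p: "1 / y ^ Suc k \<le> 1 / x ^ Suc k"
      using le by (intro divide_left_mono power_mono) auto
    have "?f k = (real (w !! k) + 1) * (-1) ^ Suc k * (1 / x ^ Suc k - 1 / y ^ Suc k)"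
      unfolding power_minus[of x] power_minus[of y]
      by (cases "even k") (simp_all add: add_divide_distrib algebra_simps del: power_Suc)
    then have "norm (?f k) = (real (w !! k) + 1) * (1 / x ^ Suc k - 1 / y ^ Suc k)"
      using p by (simp only: real_norm_def abs_mult) (simp add: power_abs abs_mult)
    also have "\<dots> \<le> ?g k" using le(4) p unfolding bounded_by_def
      by (intro mult_right_mono) auto
    finally show ?thesis .
  qed
  then have "norm (suminf ?f) \<le> suminf ?g"
    using g by (intro norm_suminf_le) (auto simp: sums_iff)
  then have "\<bar>- val x w - - val y w\<bar> \<le> (real N + 1) * (1 / (x - 1) - 1 / (y - 1))"
    using f g by (simp add: sums_iff)
  moreover have "1 / (y - 1) \<le> 1 / (x - 1)" using le by (intro divide_left_mono) auto
  ultimately show ?case by (simp add: abs_minus_commute)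
next
  case (sym x y)
  then show ?case by (simp add: abs_minus_commute)
qed

lemma continuous_on_val:
  assumes "bounded_by N w"
  shows "continuous_on {1<..} (\<lambda>x. val x w)"
  unfolding continuous_on_def
proof
  fix y :: real assume y: "y \<in> {1<..}"
  show "((\<lambda>x. val x w) \<longlongrightarrow> val y w) (at y within {1<..})"
  proof (rule LIM_zero_cancel, rule Lim_null_comparison)
    show "\<forall>\<^sub>F x in at y within {1<..}. norm (val x w - val y w)
        \<le> (real N + 1) * \<bar>1 / (x - 1) - 1 / (y - 1)\<bar>"
      using val_diff[OF _ _ assms] y by (auto simp: eventually_at_filter)
    have "((\<lambda>x. (real N + 1) * \<bar>1 / (x - 1) - 1 / (y - 1)\<bar>) \<longlongrightarrow>
      (real N + 1) * \<bar>1 / (y - 1) - 1 / (y - 1)\<bar>) (at y within {1<..})"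
      using y by (intro tendsto_intros) auto
    then show "((\<lambda>x. (real N + 1) * \<bar>1 / (x - 1) - 1 / (y - 1)\<bar>) \<longlongrightarrow> 0) (at y within {1<..})"
      by simp
  qed
qed

section \<open>Orbits, their digits and their order\<close>

lemma T_neg_pos: "0 < T_neg \<beta> x" and T_neg_le_1: "T_neg \<beta> x \<le> 1"
  unfolding T_neg_def by linarith+

lemma T_neg_power_range:
  "0 < x \<Longrightarrow> x \<le> 1 \<Longrightarrow> 0 < (T_neg \<beta> ^^ k) x \<and> (T_neg \<beta> ^^ k) x \<le> 1"
  by (induction k) (auto simp: T_neg_pos T_neg_le_1)

lemma expansion_snth [simp]: "expansion \<beta> x !! k = nat \<lfloor>\<beta> * (T_neg \<beta> ^^ k) x\<rfloor>"
  unfolding expansion_def by simp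

lemma sdrop_expansion: "sdrop k (expansion \<beta> x) = expansion \<beta> ((T_neg \<beta> ^^ k) x)"
  by (rule stream_eqI) (simp add: sdrop_snth funpow_add add.commute)

lemma expansion_Stream: "expansion \<beta> x = nat \<lfloor>\<beta> * x\<rfloor> ## expansion \<beta> (T_neg \<beta> x)"
proof (rule stream_eqI)
  fix k show "expansion \<beta> x !! k = (nat \<lfloor>\<beta> * x\<rfloor> ## expansion \<beta> (T_neg \<beta> x)) !! k"
    by (cases k) (simp_all add: funpow_swap1 del: expansion_snth, simp_all add: funpow_swap1 expansion_def)
qed

lemma expansion_less_unfold:
  "alt_less (expansion \<beta> x) (expansion \<beta> y) \<longleftrightarrow> nat \<lfloor>\<beta> * x\<rfloor> < nat \<lfloor>\<beta> * y\<rfloor> \<or>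
    nat \<lfloor>\<beta> * x\<rfloor> = nat \<lfloor>\<beta> * y\<rfloor> \<and> alt_less (expansion \<beta> (T_neg \<beta> y)) (expansion \<beta> (T_neg \<beta> x))"
  using expansion_Stream alt_less_Stream by metis

lemma digit_eq:
  assumes "\<beta> > 1" "0 < x"
  shows "real (nat \<lfloor>\<beta> * x\<rfloor>) = \<beta> * x - 1 + T_neg \<beta> x"
  using assms unfolding T_neg_def by (simp add: of_nat_nat)

lemma expansion_bounded:
  assumes "\<beta> > 1" "0 < x" "x \<le> 1"
  shows "bounded_by (nat \<lfloor>\<beta>\<rfloor>) (expansion \<beta> x)"
  unfolding bounded_by_def
proof
  fix k
  have "\<beta> * (T_neg \<beta> ^^ k) x \<le> \<beta> * 1"
    using T_neg_power_range[OF assms(2,3)] assms(1) by (intro mult_left_mono) auto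
  then show "expansion \<beta> x !! k \<le> nat \<lfloor>\<beta>\<rfloor>" by (simp add: floor_mono nat_mono)
qed

lemma val_expansion:
  assumes "\<beta> > 1" "0 < x" "x \<le> 1"
  shows "val \<beta> (expansion \<beta> x) = x"
proof -
  have "val \<beta> (expansion \<beta> x) = (T_neg \<beta> ^^ 0) x"
  proof (rule val_unique[where C = 1])
    fix k
    show "\<bar>(T_neg \<beta> ^^ k) x\<bar> \<le> 1" using T_neg_power_range[OF assms(2,3), of k \<beta>] by auto
    show "(T_neg \<beta> ^^ k) x = (real (expansion \<beta> x !! k) + 1 - (T_neg \<beta> ^^ Suc k) x) / \<beta>"
      using digit_eq[OF assms(1), of "(T_neg \<beta> ^^ k) x"] T_neg_power_range[OF assms(2,3), of k \<beta>] assms(1)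
      by (simp add: field_simps)
  qed (rule assms)
  then show ?thesis by simp
qed

text \<open>Every branch of \<open>T_neg\<close> is decreasing, so two points with the same digit
  swap their order, exactly as the alternating order does after one letter. The induction runs over
  a position where the expansions differ; there is one because \<open>val\<close> recovers the
  point.\<close>

lemma expansion_strict_mono:
  assumes "\<beta> > 1" "0 < x" "x < y" "y \<le> 1"
  shows "alt_less (expansion \<beta> x) (expansion \<beta> y)"
proof -
  have "expansion \<beta> x \<noteq> expansion \<beta> y"
    using val_expansion[of \<beta> x] val_expansion[of \<beta> y] assms by force
  then obtain k where "expansion \<beta> x !! k \<noteq> expansion \<beta> y !! k"
    using stream_eqI by blast
  then show ?thesis using assms(2-4)
  proof (induction k arbitrary: x y rule: less_induct)
    case (less k)
    have le: "nat \<lfloor>\<beta> * x\<rfloor> \<le> nat \<lfloor>\<beta> * y\<rfloor>"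
      using less.prems assms(1) by (intro nat_mono floor_mono mult_left_mono) auto
    show ?case
    proof (cases "nat \<lfloor>\<beta> * x\<rfloor> = nat \<lfloor>\<beta> * y\<rfloor>")
      case False
      with le show ?thesis
        by (subst expansion_less_unfold, linarith)
    next
      case True
      have "k \<noteq> 0"
      proof
        assume "k = 0"
        with less.prems(1) True show False by (simp only: expansion_snth funpow.simps id_apply)
      qed
      then obtain l where l: "k = Suc l" by (cases k) auto
      have "\<beta> * y - 1 + T_neg \<beta> y = \<beta> * x - 1 + T_neg \<beta> x"
        using True digit_eq[OF assms(1)] less.prems by (metis less_trans)
      moreover have "\<beta> * x < \<beta> * y" using less.prems assms(1) by simp
      ultimately have "T_neg \<beta> y < T_neg \<beta> x" by linarith
      moreover have "expansion \<beta> (T_neg \<beta> y) !! l \<noteq> expansion \<beta> (T_neg \<beta> x) !! l"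
        using less.prems(1) l expansion_Stream by (metis snth.simps(2) stream.sel(2))
      ultimately have "alt_less (expansion \<beta> (T_neg \<beta> y)) (expansion \<beta> (T_neg \<beta> x))"
        using less.IH[of l "T_neg \<beta> y" "T_neg \<beta> x"] l T_neg_pos T_neg_le_1 by auto
      then show ?thesis using True by (subst expansion_less_unfold, blast)
    qed
  qed
qed

lemma expansion_less_iff:
  assumes "\<beta> > 1" "0 < x" "x \<le> 1" "0 < y" "y \<le> 1"
  shows "alt_less (expansion \<beta> x) (expansion \<beta> y) \<longleftrightarrow> x < y"
  using assms expansion_strict_mono[of \<beta> x y] expansion_strict_mono[of \<beta> y x]
    alt_less_asym[of "expansion \<beta> x" "expansion \<beta> y"]
  by (cases x y rule: linorder_cases) auto

lemma expansion_le_iff: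
  assumes "\<beta> > 1" "0 < x" "x \<le> 1" "0 < y" "y \<le> 1"
  shows "alt_le (expansion \<beta> x) (expansion \<beta> y) \<longleftrightarrow> x \<le> y"
  using expansion_less_iff[OF assms(1,4,5,2,3)] not_alt_less[of "expansion \<beta> y" "expansion \<beta> x"]
  by auto

abbreviation kneading :: "real \<Rightarrow> nat stream" where
  "kneading \<beta> \<equiv> expansion \<beta> 1"

lemma adm_expansion:
  assumes "\<beta> > 1" "0 < x" "x \<le> 1"
  shows "adm (kneading \<beta>) (expansion \<beta> x)"
  unfolding adm_def sdrop_expansion
  using T_neg_power_range[OF assms(2,3)] expansion_le_iff[OF assms(1)] by auto

section \<open>Values of admissible sequences\<close>

text \<open>A generalized inverse of the expansion: the place where the expansions pass
  \<open>v\<close>, whether or not \<open>v\<close> is itself an expansion. The extra 0 covers the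
  case that every expansion exceeds \<open>v\<close>.\<close>

definition cut :: "real \<Rightarrow> nat stream \<Rightarrow> real" where
  "cut \<beta> v = Sup (insert 0 {y. 0 < y \<and> y \<le> 1 \<and> alt_le (expansion \<beta> y) v})"

lemma cut_bdd: "bdd_above (insert 0 {y. 0 < y \<and> y \<le> (1::real) \<and> P y})"
  by (rule bdd_aboveI[of _ 1]) auto

lemma cut_range: "0 \<le> cut \<beta> v \<and> cut \<beta> v \<le> 1"
  unfolding cut_def by (auto intro!: cSup_upper cut_bdd cSup_least)

lemma le_cut: "0 < y \<Longrightarrow> y \<le> 1 \<Longrightarrow> alt_le (expansion \<beta> y) v \<Longrightarrow> y \<le> cut \<beta> v"
  unfolding cut_def by (auto intro!: cSup_upper cut_bdd)

lemma cut_le: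
  assumes "\<beta> > 1" "0 < y" "y \<le> 1" "alt_le v (expansion \<beta> y)" shows "cut \<beta> v \<le> y"
  unfolding cut_def
proof (rule cSup_least)
  fix z assume "z \<in> insert 0 {y. 0 < y \<and> y \<le> 1 \<and> alt_le (expansion \<beta> y) v}"
  with assms show "z \<le> y" using alt_le_trans expansion_le_iff[of \<beta> z y] by auto
qed simp

lemma cut_mono:
  assumes "alt_le v w" shows "cut \<beta> v \<le> cut \<beta> w"
  unfolding cut_def
  by (rule cSup_subset_mono) (use assms alt_le_trans cut_bdd in auto)

text \<open>This is the recursion required by \<open>val_unique\<close>. So \<open>cut\<close> and
  \<open>val\<close> agree on admissible sequences, and monotonicity, immediate for
  \<open>cut\<close>, passes to \<open>val\<close>.\<close>

lemma cut_Stream: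
  assumes \<beta>: "\<beta> > 1" and "adm (kneading \<beta>) (c ## v)"
  shows "cut \<beta> (c ## v) = (real c + 1 - cut \<beta> v) / \<beta>"
proof -
  have cv: "alt_le (c ## v) (kneading \<beta>)" using assms(2) by (rule adm_le)
  have v: "alt_le v (kneading \<beta>)" using adm_le[OF adm_stl[OF assms(2)]] .
  have c: "real c \<le> \<beta>"
  proof -
    have "c \<le> nat \<lfloor>\<beta>\<rfloor>" using alt_le_shd[OF cv] by (subst (asm) expansion_Stream) simp
    then show ?thesis using \<beta> by linarith
  qed
  \<comment> \<open>The points of the branch of digit \<open>c\<close> are the \<open>(c + 1 - s) / \<beta>\<close>; the condition
    \<open>c ## v \<le> kneading \<beta>\<close> keeps those with \<open>v \<le> expansion \<beta> s\<close> in the unit interval.\<close>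
  have branch: "0 < y \<and> y \<le> 1 \<and> \<beta> * y = real c + 1 - s \<and> expansion \<beta> y = c ## expansion \<beta> s"
    if s: "0 < s" "s \<le> 1" "real c + 1 - s \<le> \<beta>" "s < 1 \<or> c > 0" "y = (real c + 1 - s) / \<beta>" for s y
  proof -
    have y: "\<beta> * y = real c + 1 - s" using s \<beta> by simp
    have "0 < real c + 1 - s" using s by linarith
    then have "0 < y" "y \<le> 1" using s(3) \<beta> unfolding s(5) by simp_all
    moreover have "\<lfloor>\<beta> * y\<rfloor> = int c" unfolding y using s by linarith
    moreover then have "T_neg \<beta> y = s" unfolding T_neg_def using y by simp
    ultimately show ?thesis using y by (subst expansion_Stream) auto
  qed
  have near: "real c + 1 - s \<le> \<beta>" if s: "0 < s" "s \<le> 1" "alt_le v (expansion \<beta> s)" for s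
  proof (cases "c < nat \<lfloor>\<beta>\<rfloor>")
    case True
    then have "real c + 1 \<le> \<beta>" by linarith
    then show ?thesis using s by simp
  next
    case False
    have "c \<le> nat \<lfloor>\<beta>\<rfloor>" using c by linarith
    with False have cc: "c = nat \<lfloor>\<beta>\<rfloor>" by simp
    have "alt_le (expansion \<beta> (T_neg \<beta> 1)) v"
      using cv cc by (subst (asm) expansion_Stream) (simp add: alt_le_Stream)
    then have "alt_le (expansion \<beta> (T_neg \<beta> 1)) (expansion \<beta> s)" using s(3) alt_le_trans by blast
    then have "T_neg \<beta> 1 \<le> s" using expansion_le_iff[OF \<beta>] T_neg_pos T_neg_le_1 s by blast
    then show ?thesis using cc \<beta> unfolding T_neg_def by simp
  qed
  let ?r = "(real c + 1 - cut \<beta> v) / \<beta>"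
  have r: "0 \<le> ?r" using cut_range[of \<beta> v] \<beta> by simp
  show ?thesis
  proof (rule antisym)
    show "cut \<beta> (c ## v) \<le> ?r"
    proof (subst cut_def, rule cSup_least)
      fix y assume "y \<in> insert 0 {y. 0 < y \<and> y \<le> 1 \<and> alt_le (expansion \<beta> y) (c ## v)}"
      then consider "y = 0" | "0 < y" "y \<le> 1" "alt_le (expansion \<beta> y) (c ## v)" by auto
      then show "y \<le> ?r"
      proof cases
        case 1 then show ?thesis using r by simp
      next
        case 2
        then have d: "nat \<lfloor>\<beta> * y\<rfloor> < c \<or> nat \<lfloor>\<beta> * y\<rfloor> = c \<and> alt_le v (expansion \<beta> (T_neg \<beta> y))"
          by (subst (asm) expansion_Stream) (simp add: alt_le_Stream)
        have e: "\<beta> * y = real (nat \<lfloor>\<beta> * y\<rfloor>) + 1 - T_neg \<beta> y"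
          using digit_eq[OF \<beta> 2(1)] by simp
        from d have "\<beta> * y \<le> real c + 1 - cut \<beta> v"
        proof
          assume "nat \<lfloor>\<beta> * y\<rfloor> < c"
          then have "\<beta> * y < real c" by linarith
          then show ?thesis using cut_range[of \<beta> v] by linarith
        next
          assume *: "nat \<lfloor>\<beta> * y\<rfloor> = c \<and> alt_le v (expansion \<beta> (T_neg \<beta> y))"
          then have "cut \<beta> v \<le> T_neg \<beta> y"
            by (intro cut_le[OF \<beta>]) (auto simp: T_neg_pos T_neg_le_1)
          then show ?thesis using e * by simp
        qed
        then show ?thesis using \<beta> by (simp add: field_simps)
      qed
    qed simp
  next
    show "?r \<le> cut \<beta> (c ## v)"
    proof (rule ccontr)
      assume "\<not> ?r \<le> cut \<beta> (c ## v)"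
      then have "\<beta> * cut \<beta> (c ## v) < real c + 1 - cut \<beta> v" using \<beta> by (simp add: field_simps)
      then have "cut \<beta> v < real c + 1 - \<beta> * cut \<beta> (c ## v)" by simp
      moreover have "cut \<beta> v \<le> 1" using cut_range by blast
      ultimately have "cut \<beta> v = 1 \<or> cut \<beta> v < min 1 (real c + 1 - \<beta> * cut \<beta> (c ## v))"
        by auto
      then show False
      proof
        assume "cut \<beta> v < min 1 (real c + 1 - \<beta> * cut \<beta> (c ## v))"
        then obtain s where s: "cut \<beta> v < s" "s < min 1 (real c + 1 - \<beta> * cut \<beta> (c ## v))"
          using dense by blast
        have s0: "0 < s" using s cut_range[of \<beta> v] by linarith
        have "\<not> alt_le (expansion \<beta> s) v" using le_cut[of s \<beta> v] s s0 by auto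
        then have "alt_le v (expansion \<beta> s)" by (simp add: not_alt_le alt_less_imp_le)
        moreover from this have "real c + 1 - s \<le> \<beta>" using near s s0 by auto
        ultimately have b: "0 < (real c + 1 - s) / \<beta>" "(real c + 1 - s) / \<beta> \<le> 1"
            "expansion \<beta> ((real c + 1 - s) / \<beta>) = c ## expansion \<beta> s"
            "alt_le v (expansion \<beta> s)"
          using branch[of s "(real c + 1 - s) / \<beta>"] s s0 by auto
        then have "(real c + 1 - s) / \<beta> \<le> cut \<beta> (c ## v)"
          by (intro le_cut) (auto simp: alt_le_Stream)
        then have "real c + 1 - s \<le> \<beta> * cut \<beta> (c ## v)" using \<beta> by (simp add: field_simps)
        then show False using s by simp
      next
        \<comment> \<open>No \<open>s\<close> above the cut is available, so \<open>s = 1\<close>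
          itself is used. Its point \<open>c / \<beta>\<close> lies in the domain only for
          \<open>c > 0\<close>; for \<open>c = 0\<close> the bound to be reached is 0.\<close>
        assume 1: "cut \<beta> v = 1"
        show False
        proof (cases "c = 0")
          case True
          then show False using 1 \<open>\<not> ?r \<le> cut \<beta> (c ## v)\<close> cut_range[of \<beta> "c ## v"] by simp
        next
          case False
          have "real c + 1 - 1 \<le> \<beta>" using c by simp
          then have b: "0 < (real c + 1 - 1) / \<beta>" "(real c + 1 - 1) / \<beta> \<le> 1"
            "expansion \<beta> ((real c + 1 - 1) / \<beta>) = c ## expansion \<beta> 1"
            using branch[of 1 "(real c + 1 - 1) / \<beta>"] False by auto
          then have "(real c + 1 - 1) / \<beta> \<le> cut \<beta> (c ## v)"
            using v by (intro le_cut) (auto simp: alt_le_Stream)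
          then show False using 1 \<open>\<not> ?r \<le> cut \<beta> (c ## v)\<close> by simp
        qed
      qed
    qed
  qed
qed

lemma val_eq_cut:
  assumes "\<beta> > 1" "adm (kneading \<beta>) v"
  shows "val \<beta> v = cut \<beta> v"
proof -
  have "val \<beta> v = cut \<beta> (sdrop 0 v)"
  proof (rule val_unique[where C = 1 and f = "\<lambda>k. cut \<beta> (sdrop k v)"])
    fix k
    show "\<bar>cut \<beta> (sdrop k v)\<bar> \<le> 1" using cut_range[of \<beta> "sdrop k v"] by auto
    have "sdrop k v = v !! k ## sdrop (Suc k) v"
      by (metis sdrop_simps stream.collapse)
    then show "cut \<beta> (sdrop k v) = (real (v !! k) + 1 - cut \<beta> (sdrop (Suc k) v)) / \<beta>"
      using cut_Stream[OF assms(1), of "v !! k" "sdrop (Suc k) v"] adm_sdrop[OF assms(2), of k] by simp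
  qed (rule assms)
  then show ?thesis by simp
qed

lemma val_mono:
  assumes "\<beta> > 1" "adm (kneading \<beta>) v" "adm (kneading \<beta>) w" "alt_le v w"
  shows "val \<beta> v \<le> val \<beta> w"
  using val_eq_cut assms cut_mono by metis

lemma val_range:
  assumes "\<beta> > 1" "adm (kneading \<beta>) v"
  shows "0 \<le> val \<beta> v \<and> val \<beta> v \<le> 1"
  using val_eq_cut[OF assms] cut_range by metis

lemma val_pos:
  assumes "\<beta> > 1" "adm (kneading \<beta>) v" "val \<beta> (stl v) < 1"
  shows "0 < val \<beta> v"
proof -
  obtain c w where v: "v = c ## w" by (cases v)
  have "bounded_by (shd (kneading \<beta>)) w" using adm_bounded adm_stl assms(2) v by blast
  then have "val \<beta> v = (real c + 1 - val \<beta> w) / \<beta>" unfolding v using val_Stream assms(1) by blast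
  then show ?thesis using assms v by simp
qed

text \<open>Sequences whose first digits differ can have equal values only as digit \<open>c\<close>
  followed by value 0 and digit \<open>c + 1\<close> followed by value 1. Values below 1 along all
  shifts exclude the latter, and by \<open>val_pos\<close> also the value 0.\<close>

lemma val_strict_mono:
  assumes \<beta>: "\<beta> > 1" and "adm (kneading \<beta>) v" "adm (kneading \<beta>) w"
    and "\<And>k. val \<beta> (sdrop k v) < 1" "\<And>k. val \<beta> (sdrop k w) < 1" "alt_less v w"
  shows "val \<beta> v < val \<beta> w"
proof -
  obtain k where "v !! k \<noteq> w !! k" using assms(6) alt_less_irrefl stream_eqI by metis
  then show ?thesis using assms(2-)
  proof (induction k arbitrary: v w rule: less_induct)
    case (less k)
    obtain c v' where v: "v = c ## v'" by (cases v)
    obtain d w' where w: "w = d ## w'" by (cases w)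
    have a: "adm (kneading \<beta>) v'" "adm (kneading \<beta>) w'" using less.prems adm_stl v w by blast+
    have 1: "val \<beta> (sdrop k v') < 1" "val \<beta> (sdrop k w') < 1" for k
      using less.prems(4)[of "Suc k"] less.prems(5)[of "Suc k"] v w by auto
    have e: "val \<beta> v = (real c + 1 - val \<beta> v') / \<beta>" "val \<beta> w = (real d + 1 - val \<beta> w') / \<beta>"
      unfolding v w using val_Stream[OF \<beta>] adm_bounded a by blast+
    have "real c + 1 - val \<beta> v' < real d + 1 - val \<beta> w'"
    proof (cases "c = d")
      case True
      with less.prems v w have "alt_less w' v'" by (simp add: alt_less_Stream)
      moreover obtain l where "k = Suc l" "w' !! l \<noteq> v' !! l"
        using less.prems(1) True v w by (cases k) auto
      ultimately have "val \<beta> w' < val \<beta> v'"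
        using less.IH[of l w' v'] a 1 by auto
      then show ?thesis using True by simp
    next
      case False
      with less.prems v w have "c < d" by (simp add: alt_less_Stream)
      moreover have "0 < val \<beta> v'" using val_pos[OF \<beta> a(1)] 1(1)[of 1] by simp
      moreover have "val \<beta> w' < 1" using 1(2)[of 0] by simp
      ultimately show ?thesis by (simp add: field_simps)
    qed
    then show ?case unfolding e using \<beta> by (simp add: divide_strict_right_mono)
  qed
qed

section \<open>Dependence of the expansion of 1 on the base\<close>

lemma sum_of_bool_less: "D \<le> M \<Longrightarrow> (\<Sum>c<M. of_bool (c < D)) = (of_nat D :: real)"
proof -
  assume "D \<le> M"
  then have "{..<M} \<inter> {c. c < D} = {..<D}" by auto
  then show ?thesis by (simp add: sum_of_bool_eq)
qed

text \<open>If \<open>x > \<beta>\<close> were a solution, then \<open>h\<close> below would be an eigenfunction, with eigenvalue \<open>x\<close>,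
  of the transfer operator \<open>f \<mapsto> (s \<mapsto> \<Sum>{f y | y. T_neg \<beta> y = s})\<close>. That operator multiplies
  the integral by \<open>\<beta>\<close>, so \<open>h\<close> would vanish almost everywhere; but \<open>h\<close> is bounded away from \<open>0\<close>
  to the left of \<open>1\<close>.\<close>

lemma val_kneading_neq_1:
  assumes \<beta>: "\<beta> > 1" and x: "x > \<beta>"
  shows "val x (kneading \<beta>) \<noteq> 1"
proof
  assume v1: "val x (kneading \<beta>) = 1"
  define X where "X k = (T_neg \<beta> ^^ k) 1" for k
  define q where "q = - 1 / x"
  define h where "h s = (\<Sum>k. q ^ k * of_bool (s \<le> X k))" for s
  define M where "M = nat \<lfloor>\<beta>\<rfloor> + 1"
  define D where "D k = nat \<lfloor>\<beta> * X k\<rfloor>" for k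
  have q: "\<bar>q\<bar> < 1" "\<bar>q\<bar> = 1 / x" "q \<noteq> 0" unfolding q_def using \<beta> x by auto
  have X: "0 < X k" "X k \<le> 1" for k using T_neg_power_range[of 1 k \<beta>] unfolding X_def by auto
  have XS: "X (Suc k) = T_neg \<beta> (X k)" for k unfolding X_def by simp
  have D: "real (D k) = \<beta> * X k - 1 + X (Suc k)" for k
    unfolding D_def XS using digit_eq[OF \<beta> X(1)] .
  have DM: "D k < M" for k
  proof -
    have "\<beta> * X k \<le> \<beta> * 1" using X \<beta> by (intro mult_left_mono) auto
    then show ?thesis unfolding D_def M_def by (simp add: floor_mono nat_mono less_Suc_eq_le)
  qed
  have geo: "summable (\<lambda>k. \<bar>q\<bar> ^ k)" using q by (intro summable_geometric) auto
  have smb: "summable (\<lambda>k. q ^ k * of_bool (P k))" for P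
    by (rule summable_comparison_test'[OF geo, of 0]) (auto simp: power_abs)
  have bnd: "\<bar>h s\<bar> \<le> 1 / (1 - \<bar>q\<bar>)" for s
  proof -
    have "norm (h s) \<le> (\<Sum>k. \<bar>q\<bar> ^ k)" unfolding h_def
      by (rule norm_suminf_le[OF _ geo]) (auto simp: power_abs)
    then show ?thesis using suminf_geometric[of "\<bar>q\<bar>"] q by simp
  qed
  have h0: "h s = 0" if "s > 1" for s
  proof -
    have "\<not> s \<le> X k" for k using X[of k] that by auto
    then show ?thesis unfolding h_def by simp
  qed

  have eigen: "x * h s = (\<Sum>c<M. h ((real c + 1 - s) / \<beta>))"
    if s: "0 < s" "s < 1" "s \<notin> range X" for s
  proof -
    \<comment> \<open>Each of the first \<open>D k\<close> branches has its preimage of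
      \<open>s\<close> below \<open>X k\<close>; the next one does so exactly when \<open>s\<close>
      exceeds the image \<open>X (Suc k)\<close>. Preimages beyond 1 may be included in the sums,
      since \<open>h\<close> vanishes there.\<close>
    have cnt: "(\<Sum>c<M. of_bool ((real c + 1 - s) / \<beta> \<le> X k)) = real (D k) + 1 - of_bool (s \<le> X (Suc k))" for k
    proof -
      have ne: "s \<noteq> X (Suc k)" using s by auto
      have iff: "(real c + 1 - s) / \<beta> \<le> X k \<longleftrightarrow> real c - D k \<le> s - X (Suc k)" for c
      proof -
        have "(real c + 1 - s) / \<beta> \<le> X k \<longleftrightarrow> real c + 1 - s \<le> \<beta> * X k"
          using \<beta> by (simp add: pos_divide_le_eq mult.commute)
        then show ?thesis using D[of k] by (simp only:, intro iffI) linarith+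
      qed
      show ?thesis
      proof (cases "s \<le> X (Suc k)")
        case True
        then have "(real c + 1 - s) / \<beta> \<le> X k \<longleftrightarrow> c < D k" for c
          unfolding iff using s X[of "Suc k"] ne by linarith
        then show ?thesis using True sum_of_bool_less[of "D k" M] DM[of k] by simp
      next
        case False
        then have "(real c + 1 - s) / \<beta> \<le> X k \<longleftrightarrow> c < Suc (D k)" for c
          unfolding iff using s X[of "Suc k"] ne by linarith
        then show ?thesis using False sum_of_bool_less[of "Suc (D k)" M] DM[of k] by simp
      qed
    qed
    have "(\<Sum>c<M. h ((real c + 1 - s) / \<beta>)) = (\<Sum>k. \<Sum>c<M. q ^ k * of_bool ((real c + 1 - s) / \<beta> \<le> X k))"
      unfolding h_def by (rule suminf_sum[symmetric]) (rule smb)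
    also have "\<dots> = (\<Sum>k. q ^ k * (real (D k) + 1) - q ^ k * of_bool (s \<le> X (Suc k)))"
      by (simp add: sum_distrib_left[symmetric] cnt right_diff_distrib)
    \<comment> \<open>The assumed equation enters here: the series of
      \<open>q ^ k * (D k + 1)\<close> equals \<open>x * val x (kneading \<beta>) = x\<close>.
      Shifting the index in \<open>h\<close> splits off the term \<open>k = 0\<close>, which is 1
      because \<open>s \<le> X 0\<close>.\<close>
    also have "\<dots> = x + x * (h s - 1)"
    proof -
      have "(\<lambda>k. (real (kneading \<beta> !! k) + 1) / (- x) ^ Suc k) sums - 1"
        using val_summable[OF _ expansion_bounded[OF \<beta>], of x 1] v1 x \<beta>
        unfolding val_def by (simp add: sums_iff)
      from sums_mult[OF this, of "- x"]
      have "(\<lambda>k. - x * ((real (kneading \<beta> !! k) + 1) / (- x) ^ Suc k)) sums x" by simp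
      moreover have "- x * ((real (kneading \<beta> !! k) + 1) / (- x) ^ Suc k) = q ^ k * (real (D k) + 1)" for k
      proof -
        have "y * (A / y ^ Suc k) = (1 / y) ^ k * A" if "y \<noteq> 0" for y A :: real
          using that by (simp add: power_divide)
        from this[of "- x"] show ?thesis
          unfolding D_def X_def q_def expansion_snth using x \<beta> by simp
      qed
      ultimately have 1: "(\<lambda>k. q ^ k * (real (D k) + 1)) sums x" by simp
      have "(\<lambda>k. q ^ k * of_bool (s \<le> X k)) sums h s"
        unfolding h_def using smb by (rule summable_sums)
      moreover have "s \<le> X 0" using s unfolding X_def by simp
      ultimately have "(\<lambda>k. q ^ Suc k * of_bool (s \<le> X (Suc k))) sums (h s - 1)"
        using sums_Suc_iff[of "\<lambda>k. q ^ k * of_bool (s \<le> X k)" "h s - 1"] by simp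
      from sums_mult[OF this, of "- x"]
      have "(\<lambda>k. - x * (q ^ Suc k * of_bool (s \<le> X (Suc k)))) sums (- x * (h s - 1))" .
      moreover have "- x * (q ^ Suc k * r) = q ^ k * r" for k r
      proof -
        have "- x * q = 1" using x \<beta> unfolding q_def by simp
        then have "(- x * q) * (q ^ k * r) = q ^ k * r" by simp
        then show ?thesis by (simp only: power_Suc mult.assoc)
      qed
      ultimately have "(\<lambda>k. q ^ k * of_bool (s \<le> X (Suc k))) sums (- x * (h s - 1))" by simp
      from sums_diff[OF 1 this] show ?thesis by (simp add: sums_iff)
    qed
    finally show ?thesis by (simp add: algebra_simps)
  qed

  define g where "g s = indicator {0<..1} s * \<bar>h s\<bar>" for s :: real
  have h_meas: "h \<in> borel_measurable borel" unfolding h_def by measurable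
  have g_meas [measurable]: "g \<in> borel_measurable borel" unfolding g_def using h_meas by measurable
  have g_nonneg: "0 \<le> g s" for s unfolding g_def by simp
  have g_le: "g s \<le> 1 / (1 - \<bar>q\<bar>) * indicator {0<..1} s" for s
    unfolding g_def using bnd[of s] by (simp add: indicator_def)
  have g_int: "integrable lborel (\<lambda>s. indicator A s * g s)" if "A \<in> sets borel" for A
  proof (rule Bochner_Integration.integrable_bound)
    show "integrable lborel (\<lambda>s::real. 1 / (1 - \<bar>q\<bar>) * indicator {0<..1} s :: real)"
      by (intro integrable_mult_right integrable_real_indicator) auto
    show "AE s in lborel. norm (indicator A s * g s) \<le> norm (1 / (1 - \<bar>q\<bar>) * indicator {0<..1} s :: real)"
    proof (intro AE_I2)
      fix s
      show "norm (indicator A s * g s) \<le> norm (1 / (1 - \<bar>q\<bar>) * indicator {0<..1} s :: real)"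
        using g_le[of s] g_nonneg[of s] q by (cases "s \<in> A") auto
    qed
    show "(\<lambda>s. indicator A s * g s) \<in> borel_measurable lborel" using that by measurable
  qed
  have g_int': "integrable lborel g" using g_int[of UNIV] by simp
  let ?G = "\<lambda>c s. indicator {0<..<1} s * g ((real c + 1 - s) / \<beta>)"
  let ?A = "\<lambda>c. {real c / \<beta><..<(real c + 1) / \<beta>}"
  have sub: "integrable lborel (?G c) \<and> (\<integral>s. ?G c s \<partial>lborel) = \<beta> * (\<integral>u. indicator (?A c) u * g u \<partial>lborel)" for c
  proof -
    have eq: "indicator (?A c) ((real c + 1) / \<beta> + - (1 / \<beta>) * s) * g ((real c + 1) / \<beta> + - (1 / \<beta>) * s) = ?G c s" for s
    proof -
      have 1: "(real c + 1) / \<beta> + - (1 / \<beta>) * s = (real c + 1 - s) / \<beta>" by (simp add: diff_divide_distrib)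
      have "(real c + 1 - s) / \<beta> \<in> ?A c \<longleftrightarrow> s \<in> {0<..<1}"
        using \<beta> by (auto simp: divide_less_cancel)
      then show ?thesis unfolding 1 by (simp add: indicator_def)
    qed
    have "integrable lborel (\<lambda>s. indicator (?A c) ((real c + 1) / \<beta> + - (1 / \<beta>) * s) * g ((real c + 1) / \<beta> + - (1 / \<beta>) * s))"
      by (rule lborel_integrable_real_affine[OF g_int]) (use \<beta> in auto)
    moreover have "(\<integral>u. indicator (?A c) u * g u \<partial>lborel) = \<bar>- (1 / \<beta>)\<bar> *\<^sub>R
       (\<integral>s. indicator (?A c) ((real c + 1) / \<beta> + - (1 / \<beta>) * s) * g ((real c + 1) / \<beta> + - (1 / \<beta>) * s) \<partial>lborel)"
      by (rule lborel_integral_real_affine) (use \<beta> in auto)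
    ultimately show ?thesis unfolding eq using \<beta> by simp
  qed
  have "countable (range X \<union> {1})" by simp
  then have "AE s in lborel. s \<notin> range X \<union> {1}"
    by (intro AE_not_in countable_imp_null_set_lborel)
  \<comment> \<open>With absolute values the eigenvalue equation becomes an inequality. It was
    derived off the orbit of 1, but that orbit is countable and hence null.\<close>
  then have "AE s in lborel. x * g s \<le> (\<Sum>c<M. ?G c s)"
  proof (rule AE_mp, intro AE_I2 impI)
    fix s assume s: "s \<notin> range X \<union> {1}"
    show "x * g s \<le> (\<Sum>c<M. ?G c s)"
    proof (cases "s \<in> {0<..<1}")
      case True
      have "g ((real c + 1 - s) / \<beta>) = \<bar>h ((real c + 1 - s) / \<beta>)\<bar>" for c
      proof -
        have "0 < (real c + 1 - s) / \<beta>" using True \<beta> by simp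
        then show ?thesis using h0[of "(real c + 1 - s) / \<beta>"] unfolding g_def
          by (cases "(real c + 1 - s) / \<beta> \<le> 1") (auto simp: indicator_def)
      qed
      moreover have "x * g s = \<bar>x * h s\<bar>" using True x \<beta> unfolding g_def by (simp add: abs_mult)
      moreover have "\<bar>x * h s\<bar> \<le> (\<Sum>c<M. \<bar>h ((real c + 1 - s) / \<beta>)\<bar>)"
        using eigen[of s] True s by (simp add: sum_abs)
      ultimately show ?thesis using True by simp
    next
      case False
      with s have "g s = 0" unfolding g_def by auto
      then show ?thesis using g_nonneg by (simp add: sum_nonneg)
    qed
  qed
  then have "(\<integral>s. x * g s \<partial>lborel) \<le> (\<integral>s. (\<Sum>c<M. ?G c s) \<partial>lborel)"
    by (intro integral_mono_AE integrable_mult_right g_int' Bochner_Integration.integrable_sum sub[THEN conjunct1])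
  also have "\<dots> = (\<Sum>c<M. \<beta> * (\<integral>u. indicator (?A c) u * g u \<partial>lborel))"
    by (subst Bochner_Integration.integral_sum) (use sub in auto)
  also have "\<dots> = \<beta> * (\<integral>u. (\<Sum>c<M. indicator (?A c) u * g u) \<partial>lborel)"
    using g_int by (subst Bochner_Integration.integral_sum) (auto simp: sum_distrib_left)
  also have "\<dots> \<le> \<beta> * (\<integral>u. g u \<partial>lborel)"
  proof (intro mult_left_mono integral_mono)
    fix u
    have "(\<Sum>c<M. indicator (?A c) u) \<le> (1::real)"
    proof (cases "\<exists>c. u \<in> ?A c")
      case True
      then obtain c where c: "u \<in> ?A c" by blast
      have "c' = c" if "u \<in> ?A c'" for c'
      proof -
        have "real c < \<beta> * u" "\<beta> * u < real c + 1" "real c' < \<beta> * u" "\<beta> * u < real c' + 1"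
          using c that \<beta> by (auto simp: field_simps)
        then show ?thesis by linarith
      qed
      then have "(\<Sum>c'<M. indicator (?A c') u) = (\<Sum>c'<M. if c' = c then 1 else (0::real))"
        using c by (intro sum.cong refl) (metis indicator_simps)
      also have "\<dots> \<le> 1" by simp
      finally show ?thesis .
    next
      case False
      then have "indicator (?A c) u = (0::real)" for c by (metis indicator_simps(2))
      then show ?thesis by (simp only: sum.neutral_const)
    qed
    from mult_right_mono[OF this g_nonneg[of u]]
    show "(\<Sum>c<M. indicator (?A c) u * g u) \<le> g u" by (simp add: sum_distrib_right)
  next
    show "integrable lborel (\<lambda>u. \<Sum>c<M. indicator (?A c) u * g u)"
      by (intro Bochner_Integration.integrable_sum g_int) auto
  qed (use g_int' \<beta> in auto)
  finally have "x * (\<integral>u. g u \<partial>lborel) \<le> \<beta> * (\<integral>u. g u \<partial>lborel)" using g_int' by simp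
  moreover have "0 \<le> (\<integral>u. g u \<partial>lborel)" using g_nonneg by simp
  ultimately have int0: "(\<integral>u. g u \<partial>lborel) = 0" using x
    by (metis linorder_not_le mult_less_cancel_right order_antisym_conv)

  \<comment> \<open>\<open>H\<close> is the left limit of \<open>h\<close> at 1: near 1 only the
    orbit points equal to 1 remain. It is 1 if the orbit never returns to 1, and otherwise satisfies
    \<open>H = q ^ p * H + 1\<close> with \<open>p\<close> the first return time.\<close>
  define H where "H = (\<Sum>k. q ^ k * of_bool (X k = 1))"
  have X0: "X 0 = 1" unfolding X_def by simp
  have H: "H \<noteq> 0"
  proof (cases "\<exists>p>0. X p = 1")
    case False
    have "X k \<noteq> 1" if "k \<notin> {0}" for k
    proof -
      have "k > 0" using that by simp
      with False show ?thesis by metis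
    qed
    then have "H = (\<Sum>k\<in>{0}. q ^ k * of_bool (X k = 1))"
      unfolding H_def by (intro suminf_finite) simp_all
    then show ?thesis using X0 by simp
  next
    case True
    define p where "p = (LEAST p. p > 0 \<and> X p = 1)"
    have p: "p > 0" "X p = 1" using LeastI_ex[OF True] unfolding p_def by auto
    have least: "X k \<noteq> 1" if "0 < k" "k < p" for k
      using not_less_Least[of k "\<lambda>p. p > 0 \<and> X p = 1"] that unfolding p_def by auto
    have per: "X (k + p) = X k" for k
      using p(2) unfolding X_def by (simp add: funpow_add)
    have "H = (\<Sum>k. q ^ (k + p) * of_bool (X (k + p) = 1)) + (\<Sum>k<p. q ^ k * of_bool (X k = 1))"
      unfolding H_def by (rule suminf_split_initial_segment[OF smb])
    also have "(\<Sum>k<p. q ^ k * of_bool (X k = 1)) = (\<Sum>k\<in>{0}. q ^ k * of_bool (X k = 1))"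
      by (rule sum.mono_neutral_right) (use p least in auto)
    also have "(\<Sum>k. q ^ (k + p) * of_bool (X (k + p) = 1)) = q ^ p * H"
      unfolding H_def per by (subst suminf_mult[symmetric]) (auto simp: smb power_add mult_ac)
    finally have "H = q ^ p * H + 1" using X0 by simp
    then show ?thesis by auto
  qed
  have "(\<lambda>k. \<bar>q\<bar> ^ k * (1 / (1 - \<bar>q\<bar>))) \<longlonglongrightarrow> 0"
    using q x \<beta> by (intro tendsto_mult_left_zero LIMSEQ_realpow_zero) auto
  then have "\<forall>\<^sub>F k in sequentially. \<bar>q\<bar> ^ k * (1 / (1 - \<bar>q\<bar>)) < \<bar>H\<bar> / 2"
    using H by (intro order_tendstoD) auto
  then obtain K where K: "\<bar>q\<bar> ^ K * (1 / (1 - \<bar>q\<bar>)) < \<bar>H\<bar> / 2"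
    by (auto simp: eventually_sequentially)
  \<comment> \<open>To the right of all orbit points below 1 with index less than \<open>K\<close>,
    the functions \<open>h\<close> and \<open>H\<close> differ only in the tail from
    \<open>K\<close> on, which is less than \<open>\<bar>H\<bar> / 2\<close>.\<close>
  define F where "F = insert 0 {X k | k. k < K \<and> X k < 1}"
  have F: "finite F" unfolding F_def by simp
  define s0 where "s0 = Max F"
  have s0: "0 \<le> s0" "s0 < 1" unfolding s0_def using F by (auto simp: F_def)
  have near: "\<bar>h s\<bar> \<ge> \<bar>H\<bar> / 2" if s: "s0 < s" "s < 1" for s
  proof -
    have eq: "of_bool (s \<le> X k) = (of_bool (X k = 1) :: real)" if "k < K" for k
    proof (cases "X k = 1")
      case False
      then have "X k \<in> F" using that X(2)[of k] unfolding F_def by auto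
      then have "X k \<le> s0" unfolding s0_def using F by simp
      then show ?thesis using s False by auto
    qed (use s in auto)
    let ?f = "\<lambda>k. q ^ k * of_bool (s \<le> X k) - q ^ k * of_bool (X k = 1)"
    have sm: "summable ?f" by (intro summable_diff smb)
    have "h s - H = suminf ?f" unfolding h_def H_def by (rule suminf_diff[OF smb smb])
    also have "\<dots> = (\<Sum>k. ?f (k + K)) + (\<Sum>k<K. ?f k)"
      by (rule suminf_split_initial_segment[OF sm])
    also have "(\<Sum>k<K. ?f k) = 0" using eq by simp
    finally have "norm (h s - H) = norm (\<Sum>k. ?f (k + K))" by simp
    also have "\<dots> \<le> (\<Sum>k. \<bar>q\<bar> ^ K * \<bar>q\<bar> ^ k)"
    proof (rule norm_suminf_le)
      show "summable (\<lambda>k. \<bar>q\<bar> ^ K * \<bar>q\<bar> ^ k)" by (intro summable_mult geo)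
    qed (auto simp: power_abs abs_mult power_add mult.commute)
    also have "\<dots> = \<bar>q\<bar> ^ K * (1 / (1 - \<bar>q\<bar>))"
      using suminf_mult[OF geo] suminf_geometric[of "\<bar>q\<bar>"] q by simp
    finally have "norm (h s - H) < \<bar>H\<bar> / 2" using K by (rule le_less_trans)
    then show ?thesis unfolding real_norm_def by linarith
  qed
  have "(1 - s0) * (\<bar>H\<bar> / 2) = (\<integral>u. indicator {s0<..<1} u * (\<bar>H\<bar> / 2) \<partial>lborel)"
    using s0 by simp
  also have "\<dots> \<le> (\<integral>u. g u \<partial>lborel)"
  proof (rule integral_mono)
    show "integrable lborel (\<lambda>u. indicator {s0<..<1} u * (\<bar>H\<bar> / 2))"
      by (intro integrable_mult_left integrable_real_indicator) (use s0 in auto)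
    show "indicator {s0<..<1} u * (\<bar>H\<bar> / 2) \<le> g u" for u
      using near[of u] g_nonneg[of u] s0 unfolding g_def by (auto simp: indicator_def)
  qed (rule g_int')
  finally have "(1 - s0) * (\<bar>H\<bar> / 2) \<le> 0" using int0 by simp
  moreover have "(1 - s0) * (\<bar>H\<bar> / 2) > 0" using s0 H by simp
  ultimately show False by simp
qed

text \<open>For large bases the value is below 1, so a base \<open>s \<ge> \<beta>\<close> with
  value at least 1 suffices. The supremum \<open>s\<close> of the bases \<open>b\<close> with
  \<open>kneading b \<le> a\<close> is one: for \<open>y\<close> slightly above \<open>s\<close> the
  sequence \<open>a\<close> lies below \<open>kneading y\<close>, hence \<open>val_mono\<close> in
  base \<open>y\<close> compares it with \<open>kneading b\<close> for \<open>b\<close> slightly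
  below \<open>s\<close>, whose value in base \<open>b\<close> is 1. Monotonicity of the kneading
  sequences is not yet available here; it is a consequence.\<close>

lemma solution_of_kneading_le:
  assumes a: "adm a a" and \<beta>: "\<beta> > 1" and le: "alt_le (kneading \<beta>) a"
  shows "\<exists>x\<ge>\<beta>. val x a = 1"
proof -
  define N where "N = shd a"
  define B where "B = {b. b \<ge> \<beta> \<and> alt_le (kneading b) a}"
  define s where "s = Sup B"
  have N: "bounded_by N a" unfolding N_def using adm_bounded a .
  have B1: "b < real N + 1" if "b \<in> B" for b
  proof -
    have "nat \<lfloor>b\<rfloor> \<le> N" using that alt_le_shd[of "kneading b" a] unfolding B_def N_def
      by (metis (no_types, lifting) expansion_Stream mem_Collect_eq mult.right_neutral stream.sel(1))
    then show ?thesis by linarith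
  qed
  have bdd: "bdd_above B" by (rule bdd_aboveI[of _ "real N + 1"]) (use B1 in force)
  have \<beta>B: "\<beta> \<in> B" unfolding B_def using le by simp
  have s: "s \<ge> \<beta>" "s \<le> real N + 1" unfolding s_def
    using cSup_upper[OF \<beta>B bdd] cSup_least[of B "real N + 1"] \<beta>B B1 by force+
  have ge: "val s a \<ge> 1"
  proof (rule ccontr)
    assume "\<not> val s a \<ge> 1"
    \<comment> \<open>A third, for three changes of base: \<open>kneading b\<close> from
      \<open>b\<close> to \<open>s\<close> and from \<open>s\<close> to \<open>y\<close>, and
      \<open>a\<close> from \<open>y\<close> back to \<open>s\<close>.\<close>
    define e where "e = (1 - val s a) / 3"
    have e: "e > 0" unfolding e_def using \<open>\<not> val s a \<ge> 1\<close> by simp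
    let ?d = "\<lambda>y. (real N + 1) * \<bar>1 / (s - 1) - 1 / (y - 1)\<bar>"
    have "(?d \<longlongrightarrow> (real N + 1) * \<bar>1 / (s - 1) - 1 / (s - 1)\<bar>) (nhds s)"
      using s \<beta> by (intro tendsto_intros filterlim_ident) auto
    then have "\<forall>\<^sub>F y in nhds s. ?d y < e"
      using e by (intro order_tendstoD) auto
    moreover have "\<forall>\<^sub>F y in nhds s. y > 1" using s \<beta>
      by (intro order_tendstoD(1)[where y = s] filterlim_ident) auto
    ultimately have "\<forall>\<^sub>F y in nhds s. ?d y < e \<and> y > 1" by (rule eventually_conj)
    then obtain \<eta> where \<eta>: "\<eta> > 0" "\<And>y. \<bar>y - s\<bar> < \<eta> \<Longrightarrow> ?d y < e \<and> y > 1"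
      unfolding eventually_nhds_metric by (auto simp: dist_real_def)
    have close: "\<bar>val s w - val y w\<bar> < e" if "bounded_by N w" "\<bar>y - s\<bar> < \<eta>" for w y
      using val_diff[of s y N w] that \<eta>(2)[of y] s \<beta> by auto
    obtain b where b: "b \<in> B" "s - \<eta> < b"
      using less_cSupD[of B "s - \<eta>"] \<beta>B \<eta> unfolding s_def by auto
    have bs: "b \<le> s" unfolding s_def using b bdd by (intro cSup_upper)
    have b1: "b > 1" "alt_le (kneading b) a" using b \<beta> unfolding B_def by auto
    define y where "y = s + \<eta> / 2"
    have y: "y > s" "\<bar>y - s\<bar> < \<eta>" unfolding y_def using \<eta> by auto
    have "y \<notin> B" using cSup_upper[OF _ bdd, of y] y unfolding s_def by auto
    then have ya: "alt_less a (kneading y)" using y s \<beta> unfolding B_def by (simp add: not_alt_le)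
    have aa: "adm a (kneading b)" using adm_mono[OF b1(2) adm_expansion[of b 1]] b1 by simp
    have "val y (kneading b) \<le> val y a"
      by (rule val_mono) (use y s \<beta> adm_mono[OF alt_less_imp_le[OF ya]] a aa b1 in auto)
    moreover have Nb: "bounded_by N (kneading b)" unfolding N_def using adm_bounded aa .
    moreover have cb: "\<bar>val s (kneading b) - val b (kneading b)\<bar> < e"
      using close[OF Nb, of b] b bs \<eta>(1) by simp
    moreover have "val b (kneading b) = 1" using val_expansion[of b 1] b1 by simp
    moreover have "val y a - val s a < e" "val s (kneading b) - val y (kneading b) < e"
      using close[OF N y(2)] close[OF Nb y(2)] by linarith+
    ultimately have "1 < val s a + 3 * e" by linarith
    moreover have "3 * e = 1 - val s a" unfolding e_def by (simp only: times_divide_eq_right) simp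
    ultimately show False by linarith
  qed
  have "\<exists>x. s \<le> x \<and> x \<le> real N + 3 \<and> val x a = 1"
  proof (rule IVT2')
    have "\<bar>val (real N + 3) a\<bar> \<le> (real N + 1) / (real N + 3 - 1)" using N by (intro abs_val_le) auto
    also have "\<dots> < 1" by simp
    finally show "val (real N + 3) a \<le> 1" by simp
    show "continuous_on {s..real N + 3} (\<lambda>x. val x a)"
      by (rule continuous_on_subset[OF continuous_on_val[OF N]]) (use s \<beta> in auto)
  qed (use ge s in auto)
  then show ?thesis using s(1) order_trans by blast
qed

text \<open>A failure would give \<open>kneading \<beta>\<close> the value 1 in some base
  \<open>x \<ge> \<gamma>\<close>, hence to the right of its own base.\<close>

lemma kneading_strict_mono:
  assumes "1 < \<beta>" "\<beta> < \<gamma>" shows "alt_less (kneading \<beta>) (kneading \<gamma>)"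
proof (rule ccontr)
  assume "\<not> ?thesis"
  then have "alt_le (kneading \<gamma>) (kneading \<beta>)" by (simp add: not_alt_less)
  moreover have "adm (kneading \<beta>) (kneading \<beta>)" using adm_expansion assms by simp
  ultimately obtain x where "x \<ge> \<gamma>" "val x (kneading \<beta>) = 1"
    using solution_of_kneading_le[of "kneading \<beta>" \<gamma>] assms by auto
  then show False using val_kneading_neq_1[of \<beta> x] assms by auto
qed

lemma val_less_1_of_le_kneading:
  assumes "adm a a" "1 < \<beta>" "alt_le a (kneading \<beta>)" "\<beta> < x"
  shows "val x a < 1"
proof -
  have k: "alt_le (kneading \<beta>) (kneading x)"
    using kneading_strict_mono[OF assms(2,4)] by (rule alt_less_imp_le)
  have "adm (kneading x) (kneading \<beta>)"
    using adm_mono[OF k] adm_expansion[of \<beta> 1] assms by simp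
  moreover have "adm (kneading x) a" using adm_mono[OF k] adm_mono[OF assms(3,1)] .
  ultimately have "val x a \<le> val x (kneading \<beta>)" "val x (kneading \<beta>) \<le> 1"
    using val_mono[of x] val_range[of x] assms by auto
  moreover have "val x (kneading \<beta>) \<noteq> 1" using val_kneading_neq_1 assms by simp
  ultimately show ?thesis by simp
qed

section \<open>The fixed point of the substitution\<close>

definition phi_stream :: "nat stream \<Rightarrow> nat stream" where
  "phi_stream w = flat (smap phi w)"

lemma phi_stream_Stream: "phi_stream (c ## w) = phi c @- phi_stream w"
  unfolding phi_stream_def by (simp add: flat_Stream phi_def)

lemma phi_stream_shift: "phi_stream (p @- w) = phi_word p @- phi_stream w"
  by (induction p) (auto simp: phi_word_def phi_stream_Stream)

lemma phi_stream_power_shift: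
  "(phi_stream ^^ k) (p @- w) = (phi_word ^^ k) p @- (phi_stream ^^ k) w"
  by (induction k) (auto simp: phi_stream_shift)

lemma phi_stream_cases:
  assumes "bounded_by 1 w"
  obtains v where "w = 0 ## v" "phi_stream w = 1 ## phi_stream v" "bounded_by 1 v"
  | v where "w = 1 ## v" "phi_stream w = 1 ## 0 ## 0 ## phi_stream v" "bounded_by 1 v"
proof -
  obtain c v where w: "w = c ## v" by (cases w)
  with assms have "c = 0 \<or> c = 1" "bounded_by 1 v" by auto
  then show thesis using that w by (auto simp: phi_stream_Stream phi_def)
qed

lemma shd_phi_stream [simp]: "shd (phi_stream w) = 1"
  by (cases w) (simp add: phi_stream_Stream phi_def)

lemma bounded_phi_stream: "bounded_by 1 w \<Longrightarrow> bounded_by 1 (phi_stream w)"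
  unfolding bounded_by_def[of _ "phi_stream w"]
proof
  fix k assume "bounded_by 1 w"
  then show "phi_stream w !! k \<le> 1"
  proof (induction k arbitrary: w rule: less_induct)
    case (less k)
    from less.prems show ?case
    proof (cases rule: phi_stream_cases)
      case (1 v)
      then show ?thesis using less.IH[of "k - 1" v] by (cases k) auto
    next
      case (2 v)
      then show ?thesis using less.IH[of "k - 3" v]
        by (cases k; cases "k - 1"; cases "k - 2") auto
    qed
  qed
qed

lemma bounded_phi_stream_power: "bounded_by 1 w \<Longrightarrow> bounded_by 1 ((phi_stream ^^ k) w)"
  by (induction k) (auto simp: bounded_phi_stream simp del: One_nat_def)

text \<open>Both images have odd length, so a common letter reverses the order before and after
  substitution. For 0 against 1, the images first differ in their second letter: 1, which starts the
  next image, against 0. At an even place the larger letter is the smaller sequence.\<close>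

lemma phi_stream_less:
  assumes "bounded_by 1 v" "bounded_by 1 w" "alt_less v w"
  shows "alt_less (phi_stream v) (phi_stream w)"
proof -
  obtain k where "v !! k \<noteq> w !! k" using assms(3) alt_less_irrefl stream_eqI by metis
  then show ?thesis using assms
  proof (induction k arbitrary: v w rule: less_induct)
    case (less k)
    have IH: "alt_less (phi_stream w') (phi_stream v')"
      if vw: "v = c ## v'" "w = c ## w'" "bounded_by 1 v'" "bounded_by 1 w'" for c v' w'
    proof -
      obtain l where "k = Suc l" "w' !! l \<noteq> v' !! l"
        using less.prems(1) vw by (cases k) auto
      then show ?thesis using less.IH[of l w' v'] less.prems vw by (auto simp: alt_less_Stream)
    qed
    show ?case
      using less.prems(2)
    proof (cases rule: phi_stream_cases)
      case v: (1 v')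
      show ?thesis using less.prems(3)
      proof (cases rule: phi_stream_cases)
        case w: (1 w')
        then show ?thesis using v IH by (simp add: alt_less_Stream)
      next
        case w: (2 w')
        have "alt_less (0 ## 0 ## phi_stream w') (phi_stream v')"
          using shd_phi_stream[of v'] by (cases "phi_stream v'") (simp add: alt_less_Stream)
        then show ?thesis using v w by (simp add: alt_less_Stream)
      qed
    next
      case v: (2 v')
      show ?thesis using less.prems(3)
      proof (cases rule: phi_stream_cases)
        case w: (1 w')
        then show ?thesis using v less.prems(4) by (simp add: alt_less_Stream)
      next
        case w: (2 w')
        then show ?thesis using v IH[of 1 v' w'] by (simp add: alt_less_Stream)
      qed
    qed
  qed
qed

lemma phi_stream_le:
  "bounded_by 1 v \<Longrightarrow> bounded_by 1 w \<Longrightarrow> alt_le v w \<Longrightarrow> alt_le (phi_stream v) (phi_stream w)"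
  using phi_stream_less unfolding alt_le_def by blast

text \<open>A shift of the image either starts at a block boundary, and is then the image of a
  shift, or starts with a 0 inside a block 100 and is below anything that starts with 1.\<close>

lemma adm_phi_stream:
  assumes "adm w w" "bounded_by 1 w"
  shows "adm (phi_stream w) (phi_stream w)"
proof -
  have "alt_le (sdrop j (phi_stream v)) (phi_stream w)" if "adm w v" "bounded_by 1 v" for j v
    using that
  proof (induction j arbitrary: v rule: less_induct)
    case (less j)
    show ?case
    proof (cases "j = 0")
      case True
      then show ?thesis using phi_stream_le[OF less.prems(2) assms(2) adm_le[OF less.prems(1)]] by simp
    next
      case j: False
      have 0: "alt_le (0 ## s) (phi_stream w)" for s
        using shd_phi_stream[of w] by (cases "phi_stream w") (simp add: alt_le_Stream)
      show ?thesis using less.prems(2)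
      proof (cases rule: phi_stream_cases)
        case (1 v')
        then show ?thesis using less.IH[of "j - 1" v'] j adm_stl less.prems(1) by (cases j) auto
      next
        case v': (2 v')
        consider "j = 1" | "j = 2" | i where "j = Suc (Suc (Suc i))"
          using j by (metis One_nat_def Suc_1 not0_implies_Suc)
        then show ?thesis
        proof cases
          case 1 then show ?thesis using v' 0 by simp
        next
          case 2 then show ?thesis using v' 0 by (simp add: numeral_2_eq_2)
        next
          case (3 i) then show ?thesis using v' less.IH[of i v'] adm_stl less.prems(1) by auto
        qed
      qed
    qed
  qed
  then show ?thesis using assms unfolding adm_def[of "phi_stream w"] by blast
qed

text \<open>Approximations of \<open>u_seq\<close> from above, chosen because their values are explicitly computable.\<close>

definition u_upper :: "nat \<Rightarrow> nat stream" where
  "u_upper k = (phi_stream ^^ k) (1 ## sconst 0)"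

lemma bounded_sconst_0 [simp]: "bounded_by N (sconst 0)"
  unfolding bounded_by_def by simp

lemma bounded_u_upper: "bounded_by 1 (u_upper k)"
  unfolding u_upper_def by (intro bounded_phi_stream_power) simp

lemma sdrop_sconst [simp]: "sdrop k (sconst x) = sconst x"
  by (induction k) auto

lemma adm_u_upper: "adm (u_upper k) (u_upper k)"
proof (induction k)
  case 0
  have "alt_le (sdrop k (1 ## sconst 0)) (1 ## sconst 0)" for k
  proof (cases k)
    case (Suc j)
    have "sconst 0 = (0::nat) ## sconst 0" by (metis siterate.ctr id_apply)
    then have "alt_le (sconst 0) ((1::nat) ## sconst 0)" by (metis alt_le_Stream zero_less_one)
    then show ?thesis using Suc by simp
  qed simp
  then show ?case unfolding u_upper_def adm_def by simp
next
  case (Suc k)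
  then show ?case using adm_phi_stream[OF _ bounded_u_upper[of k]] unfolding u_upper_def by simp
qed

lemma u_upper_decreasing: "alt_le (u_upper (Suc k)) (u_upper k)"
proof (induction k)
  case 0
  have 0: "sconst 0 = (0::nat) ## sconst 0" by (metis siterate.ctr id_apply)
  have 1: "1 ## sconst 0 = 1 ## 0 ## 0 ## 0 ## (sconst 0 :: nat stream)"
    by (subst 0, subst 0, subst 0) (rule refl)
  have "phi_stream (1 ## sconst 0) = [1, 0, 0] @- phi_stream (sconst 0)"
    unfolding phi_stream_Stream by (simp add: phi_def)
  moreover have "alt_le ([1, 0, 0] @- t) (1 ## 0 ## 0 ## 0 ## s)" if "shd t = 1" for s t :: "nat stream"
    using that by (cases t) (simp add: alt_le_Stream)
  ultimately have "alt_le (phi_stream (1 ## sconst 0)) (1 ## 0 ## 0 ## 0 ## sconst 0)"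
    by (metis shd_phi_stream)
  then show ?case unfolding u_upper_def using 1 by simp
next
  case (Suc k)
  then show ?case using phi_stream_le[OF bounded_u_upper bounded_u_upper Suc] unfolding u_upper_def by simp
qed

lemma u_upper_antimono: "k \<le> l \<Longrightarrow> alt_le (u_upper l) (u_upper k)"
  by (induction l rule: dec_induct) (auto intro: alt_le_trans u_upper_decreasing)

lemma stake_u_upper:
  assumes "j \<le> k" shows "stake j (u_upper k) = stake j u_seq"
proof -
  let ?p = "(phi_word ^^ k) [1]"
  have "u_upper k = (phi_stream ^^ k) ([1] @- sconst 0)" unfolding u_upper_def by simp
  then have "u_upper k = ?p @- (phi_stream ^^ k) (sconst 0)" by (simp only: phi_stream_power_shift)
  then have "stake (length ?p) (u_upper k) = stake (length ?p) u_seq"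
    unfolding stake_u_seq by (simp add: stake_shift)
  moreover have "min j (length ?p) = j" using assms length_phi_word_power[of k] by simp
  ultimately show ?thesis by (metis take_stake)
qed

lemma u_le_u_upper: "alt_le u_seq (u_upper k)"
proof (rule ccontr)
  assume "\<not> ?thesis"
  then have "alt_less (u_upper k) u_seq" by (simp add: not_alt_le)
  from alt_less_at_prefix[OF this] obtain j where
    j: "\<And>v w. stake j v = stake j (u_upper k) \<Longrightarrow> stake j w = stake j u_seq \<Longrightarrow> alt_less v w"
    by blast
  have "alt_less (u_upper k) (u_upper (max j k))"
    by (rule j) (simp_all add: stake_u_upper)
  then show False using u_upper_antimono[of k "max j k"] not_alt_less[of "u_upper k" "u_upper (max j k)"] by simp
qed

lemma u_less_imp_u_upper_less:
  assumes "alt_less u_seq a" shows "\<exists>k. alt_less (u_upper k) a"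
proof -
  from alt_less_at_prefix[OF assms] obtain j where
    "\<And>v w. stake j v = stake j u_seq \<Longrightarrow> stake j w = stake j a \<Longrightarrow> alt_less v w"
    by blast
  then have "alt_less (u_upper j) a" by (simp add: stake_u_upper)
  then show ?thesis by blast
qed

section \<open>Explicit values of the approximations to \<open>u_seq\<close>\<close>

fun word_val :: "real \<Rightarrow> nat list \<Rightarrow> real" where
  "word_val x [] = 0"
| "word_val x (c # p) = (real c + 1 - word_val x p) / x"

lemma bounded_by_mono: "bounded_by N w \<Longrightarrow> N \<le> M \<Longrightarrow> bounded_by M w"
  unfolding bounded_by_def using le_trans by blast

lemma bounded_by_shift: "bounded_by N w \<Longrightarrow> \<exists>M. bounded_by M (p @- w)"
proof (induction p)
  case (Cons c p)
  then obtain M where "bounded_by M (p @- w)" by blast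
  then have "bounded_by (max c M) ((c # p) @- w)" using bounded_by_mono by auto
  then show ?case by blast
qed auto

lemma val_shift:
  assumes "x > 1" "bounded_by N w"
  shows "val x (p @- w) = word_val x p + (- 1 / x) ^ length p * val x w"
proof (induction p)
  case (Cons c p)
  obtain M where "bounded_by M (p @- w)" using bounded_by_shift[OF assms(2)] by blast
  from val_Stream[OF assms(1) this, of c] Cons show ?case
    using assms(1) by (simp add: diff_divide_distrib add_divide_distrib)
qed simp

lemma word_val_append:
  "x \<noteq> 0 \<Longrightarrow> word_val x (p @ r) = word_val x p + (- 1 / x) ^ length p * word_val x r"
  by (induction p) (auto simp: diff_divide_distrib add_divide_distrib)

text \<open>Since 0 is mapped to 1, this one family contains the iterated images of both letters.
  The lengths 1, 1, 3, 5, 11, ... are the Jacobsthal numbers; being odd, they give every factor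
  \<open>(- 1 / x) ^ length (phi_0 k)\<close> the same sign.\<close>

definition phi_0 :: "nat \<Rightarrow> nat list" where
  "phi_0 k = (phi_word ^^ k) [0]"

lemma phi_0_Suc: "phi_0 (Suc k) = (phi_word ^^ k) [1]"
  unfolding phi_0_def funpow_Suc_right o_apply by (simp add: phi_word_def phi_def)

lemma phi_0_Suc_Suc: "phi_0 (Suc (Suc k)) = phi_0 (Suc k) @ phi_0 k @ phi_0 k"
  unfolding phi_0_Suc phi_word_power_Suc
  using phi_word_power_append[of k "[0]" "[0]"] by (simp add: phi_0_def)

lemma phi_0_0: "phi_0 0 = [0]" "phi_0 (Suc 0) = [1]"
  by (simp_all add: phi_0_def phi_word_def phi_def)

lemma odd_length_phi_0: "odd (length (phi_0 k))"
proof (induction k rule: nat_less_induct)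
  case (1 k)
  consider "k = 0" | "k = 1" | j where "k = Suc (Suc j)" by (metis One_nat_def not0_implies_Suc)
  then show ?case using 1 by cases (auto simp: phi_0_0 phi_0_Suc_Suc)
qed

lemma phi_0_nonempty [simp]: "phi_0 k \<noteq> []"
  using odd_length_phi_0[of k] by auto

lemma length_phi_0: "k \<le> length (phi_0 k)"
  by (cases k) (auto simp: phi_0_Suc length_phi_word_power Suc_leI simp del: One_nat_def)

text \<open>The decomposition \<open>phi_0_Suc_Suc\<close> gives a two-step recursion, and the
  oddness of the lengths makes it factor: each step multiplies the product by
  \<open>1 - (1/x) ^ length (phi_0 j)\<close>.\<close>

lemma word_val_phi_0:
  assumes "x > 1"
  shows "word_val x (phi_0 k) = 1 + (1/x) ^ length (phi_0 k) - (\<Prod>j<k. 1 - (1/x) ^ length (phi_0 j))"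
proof (induction k rule: nat_less_induct)
  case (1 k)
  consider "k = 0" | "k = 1" | j where "k = Suc (Suc j)" by (metis One_nat_def not0_implies_Suc)
  then show ?case
  proof cases
    case 1 then show ?thesis by (simp add: phi_0_0)
  next
    case 2 then show ?thesis using assms by (simp add: phi_0_0 field_simps)
  next
    case (3 j)
    define y where "y = 1 / x"
    define p where "p = length (phi_0 j)"
    define q where "q = length (phi_0 (Suc j))"
    define P where "P = (\<Prod>i<j. 1 - y ^ length (phi_0 i))"
    have m: "(- 1 / x) ^ p = - (y ^ p)" "(- 1 / x) ^ q = - (y ^ q)"
      using odd_length_phi_0 unfolding p_def q_def y_def by (simp_all add: power_minus_odd)
    have "word_val x (phi_0 j) = 1 + y ^ p - P" "word_val x (phi_0 (Suc j)) = 1 + y ^ q - P * (1 - y ^ p)"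
      using 1 3 unfolding y_def p_def q_def P_def by simp_all
    then have "word_val x (phi_0 k) = 1 + y ^ q - P * (1 - y ^ p) - y ^ q * ((1 + y ^ p - P) - y ^ p * (1 + y ^ p - P))"
      using assms 3 m by (simp add: phi_0_Suc_Suc word_val_append p_def[symmetric] q_def[symmetric])
    also have "\<dots> = 1 + y ^ (q + (p + p)) - P * (1 - y ^ p) * (1 - y ^ q)"
      by (simp add: power_add algebra_simps)
    finally show ?thesis using 3 unfolding P_def y_def p_def q_def by (simp add: phi_0_Suc_Suc)
  qed
qed

text \<open>The tail after \<open>phi_0 (Suc k)\<close> has period \<open>phi_0 k\<close>, so its
  value solves a linear equation. As the other factors are positive, value 1 means
  \<open>y ^ (2 * p) + y ^ q = 1\<close>, and its root tends to 1 as the exponents grow.\<close>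

lemma val_u_upper:
  fixes x :: real and k :: nat
  defines "y \<equiv> 1 / x" and "p \<equiv> length (phi_0 k)" and "q \<equiv> length (phi_0 (Suc k))"
  assumes x: "x > 1"
  shows "val x (u_upper k) = 1 - (\<Prod>j<k. 1 - y ^ length (phi_0 j)) * (1 - y ^ (2 * p) - y ^ q) / (1 + y ^ p)"
proof -
  define P where "P = (\<Prod>i<k. 1 - y ^ length (phi_0 i))"
  define z where "z = (phi_stream ^^ k) (sconst 0)"
  have z: "bounded_by 1 z" unfolding z_def by (intro bounded_phi_stream_power) simp
  have m: "(- 1 / x) ^ p = - (y ^ p)" "(- 1 / x) ^ q = - (y ^ q)"
    using odd_length_phi_0 unfolding p_def q_def y_def by (simp_all add: power_minus_odd)
  have "sconst (0::nat) = [0] @- sconst 0" by (metis siterate.ctr id_apply shift.simps)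
  then have "z = phi_0 k @- z" unfolding z_def phi_0_def by (metis phi_stream_power_shift)
  then have "val x z = word_val x (phi_0 k) - y ^ p * val x z"
    using val_shift[OF x z, of "phi_0 k"] m unfolding p_def by simp
  moreover have "word_val x (phi_0 k) = 1 + y ^ p - P"
    using word_val_phi_0[OF x, of k] unfolding y_def p_def P_def .
  moreover have y: "1 + y ^ p > 0" using x unfolding y_def by (simp add: add_pos_pos)
  ultimately have vz: "val x z = (1 + y ^ p - P) / (1 + y ^ p)" by (simp add: field_simps)
  have "u_upper k = (phi_stream ^^ k) ([1] @- sconst 0)" unfolding u_upper_def by simp
  then have "u_upper k = phi_0 (Suc k) @- z" unfolding z_def phi_0_Suc by (simp only: phi_stream_power_shift)
  then have "val x (u_upper k) = word_val x (phi_0 (Suc k)) - y ^ q * val x z"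
    using val_shift[OF x z, of "phi_0 (Suc k)"] m unfolding q_def by simp
  also have "word_val x (phi_0 (Suc k)) = 1 + y ^ q - P * (1 - y ^ p)"
    using word_val_phi_0[OF x, of "Suc k"] unfolding y_def p_def q_def P_def by simp
  finally have "val x (u_upper k) = 1 + y ^ q - P * (1 - y ^ p) - y ^ q * ((1 + y ^ p - P) / (1 + y ^ p))"
    unfolding vz .
  also have "\<dots> = 1 - P * (1 - y ^ (2 * p) - y ^ q) / (1 + y ^ p)"
    using y by (simp add: field_simps power_mult power2_eq_square power_even_eq)
  finally show ?thesis unfolding P_def .
qed

text \<open>Otherwise \<open>u_upper k\<close> has value 1 in some base
  \<open>x \<ge> \<beta>\<close>. But the lengths are at least \<open>k\<close>, so once
  \<open>(1 / \<beta>) ^ k < 1 / 2\<close> the two powers in \<open>val_u_upper\<close> sum to less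
  than 1.\<close>

lemma u_upper_less_kneading:
  assumes "\<beta> > 1" shows "\<exists>k. alt_less (u_upper k) (kneading \<beta>)"
proof -
  have "(\<lambda>k. (1 / \<beta>) ^ k) \<longlonglongrightarrow> 0" using assms by (intro LIMSEQ_realpow_zero) auto
  then have "\<forall>\<^sub>F k in sequentially. (1 / \<beta>) ^ k < 1 / 2" by (rule order_tendstoD) simp
  then obtain k where k: "(1 / \<beta>) ^ k < 1 / 2" by (auto simp: eventually_sequentially)
  have "alt_less (u_upper k) (kneading \<beta>)"
  proof (rule ccontr)
    assume "\<not> ?thesis"
    then have "alt_le (kneading \<beta>) (u_upper k)" by (simp add: not_alt_less)
    from solution_of_kneading_le[OF adm_u_upper assms this]
    obtain x where x: "x \<ge> \<beta>" "val x (u_upper k) = 1" by blast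
    define y where "y = 1 / x"
    have y: "0 < y" "y < 1" "y \<le> 1 / \<beta>" unfolding y_def using x(1) assms by (auto simp: frac_le)
    have small: "y ^ l < 1 / 2" if "k \<le> l" for l
    proof -
      have "y ^ l \<le> y ^ k" using y that by (intro power_decreasing) auto
      also have "\<dots> \<le> (1 / \<beta>) ^ k" using y by (intro power_mono) auto
      finally show ?thesis using k by simp
    qed
    have "y ^ (2 * length (phi_0 k)) < 1 / 2" "y ^ length (phi_0 (Suc k)) < 1 / 2"
      using length_phi_0[of k] length_phi_0[of "Suc k"] by (intro small; simp)+
    then have "1 - y ^ (2 * length (phi_0 k)) - y ^ length (phi_0 (Suc k)) > 0" by simp
    moreover have "(\<Prod>j<k. 1 - y ^ length (phi_0 j)) > 0"
      using y odd_length_phi_0 by (intro prod_pos) (auto simp: power_less_one_iff odd_pos)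
    moreover have "1 + y ^ length (phi_0 k) > 0" using y by (simp add: add_pos_pos)
    ultimately have "(\<Prod>j<k. 1 - y ^ length (phi_0 j)) *
      (1 - y ^ (2 * length (phi_0 k)) - y ^ length (phi_0 (Suc k))) / (1 + y ^ length (phi_0 k)) > 0"
      by (intro divide_pos_pos mult_pos_pos)
    moreover have "x > 1" using x(1) assms by simp
    ultimately show False using x(2) val_u_upper[of x k] unfolding y_def by linarith
  qed
  then show ?thesis by blast
qed

lemma val_u_upper_solution: "\<exists>x>1. val x (u_upper k) = 1"
proof -
  let ?p = "2 * length (phi_0 k)" and ?q = "length (phi_0 (Suc k))"
  have pq: "0 < ?p" "0 < ?q" using odd_pos[OF odd_length_phi_0] by auto
  have "\<exists>y. 0 \<le> y \<and> y \<le> 1 \<and> y ^ ?p + y ^ ?q = (1::real)"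
    by (rule IVT') (use pq in \<open>auto intro!: continuous_intros simp: power_0_left\<close>)
  then obtain y :: real where y: "0 \<le> y" "y \<le> 1" "y ^ ?p + y ^ ?q = 1" by blast
  have z: "1 - y ^ ?p - y ^ ?q = 0" using y(3) by simp
  have "y \<noteq> 0" "y \<noteq> 1" using y(3) pq by (auto simp: power_0_left)
  then have "1 / y > 1" using y by simp
  moreover have "val (1 / y) (u_upper k) = 1"
    using val_u_upper[OF calculation, of k] z by simp
  ultimately show ?thesis by blast
qed

lemma le_u_imp_less_kneading:
  assumes "alt_le a u_seq" "\<beta> > 1" shows "alt_less a (kneading \<beta>)"
  using u_upper_less_kneading[OF assms(2)] assms(1) u_le_u_upper alt_le_less_trans alt_le_trans by blast

text \<open>If \<open>a\<close> were below all kneading sequences, so would be some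
  \<open>u_upper k\<close>, whose value would then be below 1 in every base \<open>x > 1\<close>,
  against \<open>val_u_upper_solution\<close>.\<close>

lemma u_less_imp_kneading_le:
  assumes "alt_less u_seq a" shows "\<exists>\<beta>>1. alt_le (kneading \<beta>) a"
proof (rule ccontr)
  assume *: "\<not> ?thesis"
  obtain k where k: "alt_less (u_upper k) a" using u_less_imp_u_upper_less[OF assms] by blast
  obtain x where x: "x > 1" "val x (u_upper k) = 1" using val_u_upper_solution by blast
  obtain \<beta> where \<beta>: "1 < \<beta>" "\<beta> < x" using dense x(1) by blast
  have "alt_less a (kneading \<beta>)" using * \<beta> not_alt_le by blast
  then have "alt_le (u_upper k) (kneading \<beta>)" using alt_less_trans[OF k] by (simp add: alt_le_def)
  from val_less_1_of_le_kneading[OF adm_u_upper \<beta>(1) this \<beta>(2)] x show False by simp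
qed

section \<open>The number attached to a sequence\<close>

lemma hat_eq: "adm a a \<Longrightarrow> hat a = a"
  unfolding hat_def alt_Sup_def
proof (rule the_equality)
  assume a: "adm a a"
  have m: "a \<in> {sdrop k a |k. True}" using sdrop.simps(1)[of a] by (metis (mono_tags) mem_Collect_eq)
  then show "(\<forall>t\<in>{sdrop k a |k. True}. alt_le t a) \<and> (\<forall>s'. (\<forall>t\<in>{sdrop k a |k. True}. alt_le t s') \<longrightarrow> alt_le a s')"
    using a unfolding adm_def by blast
  fix s assume "(\<forall>t\<in>{sdrop k a |k. True}. alt_le t s) \<and> (\<forall>s'. (\<forall>t\<in>{sdrop k a |k. True}. alt_le t s') \<longrightarrow> alt_le s s')"
  then show "s = a" using a m unfolding adm_def by (intro alt_le_antisym) blast+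
qed

lemma b_num_cases:
  assumes "adm a a"
  obtains "b_num a = 1" "alt_le a u_seq"
  | "b_num a > 1" "val (b_num a) a = 1" "\<And>x. x > 1 \<Longrightarrow> val x a = 1 \<Longrightarrow> x \<le> b_num a" "alt_less u_seq a"
proof (cases "alt_less u_seq a")
  case False
  then have "b_num a = 1" unfolding b_num_def by (simp add: hat_eq[OF assms])
  then show thesis using that(1) False by (simp add: not_alt_less)
next
  case True
  define N where "N = shd a"
  have N: "bounded_by N a" unfolding N_def using adm_bounded assms .
  obtain \<beta> where \<beta>: "\<beta> > 1" "alt_le (kneading \<beta>) a" using u_less_imp_kneading_le[OF True] by blast
  obtain x0 where x0: "x0 \<ge> \<beta>" "val x0 a = 1" using solution_of_kneading_le[OF assms \<beta>] by blast
  have bound: "x \<le> real N + 2" if "x > 1" "val x a = 1" for x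
  proof -
    have "1 \<le> (real N + 1) / (x - 1)" using abs_val_le[OF that(1) N] that(2) by simp
    then show ?thesis using that(1) by (simp add: field_simps)
  qed
  \<comment> \<open>\<open>GREATEST\<close> has a meaning only if a maximum is attained. The
    solutions from \<open>x0\<close> on are bounded, because values tend to 0 for large bases, and
    closed, hence compact.\<close>
  let ?S = "{x \<in> {x0..real N + 2}. val x a = 1}"
  have cont: "continuous_on {x0..real N + 2} (\<lambda>x. val x a)"
    by (rule continuous_on_subset[OF continuous_on_val[OF N]]) (use x0 \<beta> in auto)
  have "closed ?S" by (rule continuous_closed_preimage_constant[OF cont]) simp
  then have "compact ({x0..real N + 2} \<inter> ?S)" by (intro compact_Int_closed) auto
  moreover have "{x0..real N + 2} \<inter> ?S = ?S" by auto
  moreover have "x0 \<in> ?S" using x0 \<beta> bound by auto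
  ultimately obtain b where b: "b \<in> ?S" "\<And>x. x \<in> ?S \<Longrightarrow> x \<le> b"
    using compact_attains_sup[of ?S] by auto
  have "b > 1" "val b a = 1" using b(1) x0 \<beta> by auto
  moreover have max: "x \<le> b" if "x > 1" "val x a = 1" for x
    using b that bound[OF that] by (cases "x0 \<le> x") auto
  ultimately have "(GREATEST x. x > 1 \<and> val x a = 1) = b"
    by (intro Greatest_equality) auto
  moreover have "b_num a = (GREATEST x. x > 1 \<and> val x a = 1)"
    using True unfolding b_num_def hat_eq[OF assms] val_def by (simp add: add_eq_0_iff)
  ultimately have "b_num a = b" by simp
  then show thesis using that(2) True \<open>b > 1\<close> \<open>val b a = 1\<close> max by blast
qed

lemma b_num_ge_1: "adm a a \<Longrightarrow> b_num a \<ge> 1"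
  by (cases rule: b_num_cases[of a]) auto

lemma val_less_1_of_no_solution:
  assumes a: "adm a a" and \<beta>: "\<beta> > 1" and no: "\<And>x. x \<ge> \<beta> \<Longrightarrow> val x a \<noteq> 1"
  shows "val \<beta> a < 1"
proof (rule ccontr)
  assume "\<not> val \<beta> a < 1"
  define N where "N = shd a"
  have N: "bounded_by N a" unfolding N_def using adm_bounded a .
  define R where "R = max \<beta> (real N + 3)"
  have "\<bar>val R a\<bar> \<le> (real N + 1) / (R - 1)" using N unfolding R_def by (intro abs_val_le) auto
  also have "\<dots> \<le> 1" unfolding R_def by (simp add: field_simps)
  finally have "val R a \<le> 1" by simp
  moreover have "continuous_on {\<beta>..R} (\<lambda>x. val x a)"
    by (rule continuous_on_subset[OF continuous_on_val[OF N]]) (use \<beta> in auto)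
  ultimately have "\<exists>x. \<beta> \<le> x \<and> x \<le> R \<and> val x a = 1"
    using \<open>\<not> val \<beta> a < 1\<close> by (intro IVT2') (auto simp: R_def)
  then show False using no by blast
qed

lemma b_num_less_iff:
  assumes a: "adm a a" and \<beta>: "\<beta> > 1"
  shows "b_num a < \<beta> \<longleftrightarrow> alt_less a (kneading \<beta>) \<and> val \<beta> a < 1"
proof
  assume b: "b_num a < \<beta>"
  have no: "val x a \<noteq> 1" if "x \<ge> \<beta>" for x
    using a
  proof (cases rule: b_num_cases)
    case 1
    have "1 < x" using \<beta> that by simp
    then obtain \<gamma> where \<gamma>: "1 < \<gamma>" "\<gamma> < x" using dense by blast
    have "alt_le a (kneading \<gamma>)" using le_u_imp_less_kneading[OF 1(2) \<gamma>(1)] by (simp add: alt_le_def)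
    from val_less_1_of_le_kneading[OF a \<gamma>(1) this \<gamma>(2)] show ?thesis by simp
  next
    case 2
    show ?thesis
    proof
      assume "val x a = 1"
      then have "x \<le> b_num a" using 2(3)[of x] that \<beta> by simp
      then show False using that b by simp
    qed
  qed
  moreover have "alt_less a (kneading \<beta>)"
    using solution_of_kneading_le[OF a \<beta>] no not_alt_less by blast
  ultimately show "alt_less a (kneading \<beta>) \<and> val \<beta> a < 1"
    using val_less_1_of_no_solution[OF a \<beta>] by blast
next
  assume *: "alt_less a (kneading \<beta>) \<and> val \<beta> a < 1"
  from a show "b_num a < \<beta>"
  proof (cases rule: b_num_cases)
    case 1
    then show ?thesis using \<beta> by simp
  next
    case 2
    have "\<not> \<beta> < b_num a"
      using val_less_1_of_le_kneading[OF a \<beta>, of "b_num a"] * 2(2) by (auto simp: alt_le_def)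
    moreover have "b_num a \<noteq> \<beta>" using * 2(2) by auto
    ultimately show ?thesis by simp
  qed
qed

section \<open>Eventual periodicity and Yrrap numbers\<close>

lemma eventually_periodic_iff:
  "eventually_periodic w \<longleftrightarrow> (\<exists>i j. i < j \<and> sdrop i w = sdrop j w)"
proof
  assume "eventually_periodic w"
  then obtain p q where pq: "q \<noteq> []" "w = p @- cycle q" unfolding eventually_periodic_def by blast
  have 1: "sdrop (length p) w = cycle q" by (simp add: pq sdrop_shift)
  have "sdrop (length q) (cycle q) = cycle q"
    by (subst cycle_eq_shift[OF pq(1), symmetric]) (simp add: sdrop_shift)
  then have "sdrop (length q) (sdrop (length p) w) = cycle q" using 1 by simp
  then have "sdrop (length p + length q) w = cycle q" by (simp add: sdrop_add)
  then show "\<exists>i j. i < j \<and> sdrop i w = sdrop j w" using 1 pq(1)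
    by (metis length_greater_0_conv less_add_same_cancel1)
next
  assume "\<exists>i j. i < j \<and> sdrop i w = sdrop j w"
  then obtain i j where ij: "i < j" "sdrop i w = sdrop j w" by blast
  let ?s = "sdrop i w"
  have "sdrop (j - i) ?s = sdrop j w" using ij(1) by (subst sdrop_add) simp
  then have "sdrop (j - i) ?s = ?s" using ij(2) by simp
  then have "stake (j - i) ?s @- ?s = ?s" by (metis stake_sdrop)
  moreover have "stake (j - i) ?s \<noteq> []" using ij by (metis length_0_conv length_stake zero_less_diff less_numeral_extra(3))
  ultimately have "?s = cycle (stake (j - i) ?s)" by (intro shift_eq_imp_cycle)
  then have "w = stake i w @- cycle (stake (j - i) ?s)" by (metis stake_sdrop)
  then show "eventually_periodic w" unfolding eventually_periodic_def
    using \<open>stake (j - i) ?s \<noteq> []\<close> by blast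
qed

lemma finite_sdrop:
  assumes "eventually_periodic w" shows "finite (range (\<lambda>k. sdrop k w))"
proof -
  obtain i j where ij: "i < j" "sdrop i w = sdrop j w" using assms eventually_periodic_iff by blast
  have "sdrop k w \<in> (\<lambda>k. sdrop k w) ` {..<j}" for k
  proof (induction k rule: less_induct)
    case (less k)
    show ?case
    proof (cases "k < j")
      case False
      then have "sdrop k w = sdrop (k - j) (sdrop j w)" by (simp add: sdrop_add)
      also have "\<dots> = sdrop (k - j + i) w" by (simp add: ij(2)[symmetric] sdrop_add add.commute)
      finally show ?thesis using less[of "k - j + i"] ij False by simp
    qed auto
  qed
  then have "range (\<lambda>k. sdrop k w) \<subseteq> (\<lambda>k. sdrop k w) ` {..<j}" by blast
  then show ?thesis by (rule finite_subset) simp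
qed

text \<open>In base \<open>b\<close> the orbit of 1 stays among the values of the shifts of
  \<open>a\<close>, and an eventually periodic sequence has only finitely many shifts. The orbit of
  1 may leave the order of the shifts, so \<open>kneading b\<close> need not equal
  \<open>a\<close>.\<close>

lemma yrrap_b_num:
  assumes a: "adm a a" and per: "eventually_periodic a" and "b_num a \<noteq> 1"
  shows "yrrap (b_num a)"
proof -
  define b where "b = b_num a"
  have b: "b > 1" "val b a = 1"
    using a assms(3) unfolding b_def by (cases rule: b_num_cases; simp)+
  define V where "V k = val b (sdrop k a)" for k
  have Nk: "bounded_by (shd a) (sdrop k a)" for k using adm_bounded adm_sdrop[OF a] .
  \<comment> \<open>\<open>b_num_less_iff\<close> places \<open>a\<close> below
    \<open>kneading \<gamma>\<close> only for \<open>\<gamma> > b\<close>; the bounds are carried to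
    \<open>b\<close> by continuity from the right.\<close>
  have V01: "0 \<le> V k \<and> V k \<le> 1" for k
  proof -
    have r: "0 \<le> val \<gamma> (sdrop k a) \<and> val \<gamma> (sdrop k a) \<le> 1" if "\<gamma> > b" for \<gamma>
    proof (rule val_range)
      have "alt_less a (kneading \<gamma>)" using b_num_less_iff[OF a, of \<gamma>] that b unfolding b_def by auto
      then show "adm (kneading \<gamma>) (sdrop k a)"
        using adm_mono[OF alt_less_imp_le] adm_sdrop[OF a] by blast
    qed (use that b in simp)
    have "((\<lambda>x. val x (sdrop k a)) \<longlongrightarrow> V k) (at b within {1<..})"
      using continuous_on_val[OF Nk] b unfolding continuous_on_def V_def by auto
    then have lim: "((\<lambda>x. val x (sdrop k a)) \<longlongrightarrow> V k) (at_right b)"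
      by (rule tendsto_within_subset) (use b in auto)
    have "\<forall>\<^sub>F x in at_right b. 0 \<le> val x (sdrop k a)" "\<forall>\<^sub>F x in at_right b. val x (sdrop k a) \<le> 1"
      using r by (auto simp: eventually_at_filter)
    then show ?thesis using tendsto_lowerbound[OF lim] tendsto_upperbound[OF lim] by auto
  qed
  have VS: "V k = (real (a !! k) + 1 - V (Suc k)) / b" for k
  proof -
    have "sdrop k a = a !! k ## sdrop (Suc k) a" by (metis sdrop_simps stream.collapse)
    then show ?thesis unfolding V_def using val_Stream[OF b(1) Nk] by metis
  qed
  have V0: "V 0 = 1" unfolding V_def using b by simp
  have "(T_neg b ^^ k) 1 \<in> range V" for k
  proof (induction k)
    case 0
    show ?case using V0 by (metis funpow_0 rangeI)
  next
    case (Suc k)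
    then obtain j where j: "(T_neg b ^^ k) 1 = V j" by auto
    have e: "b * V j = real (a !! j) + 1 - V (Suc j)" using VS[of j] b by simp
    \<comment> \<open>The value 0 is the excluded endpoint. There \<open>b * V j\<close> is the
      integer \<open>a !! j + 1\<close>, the floor takes that digit, and the orbit continues at 1,
      which is \<open>V 0\<close>.\<close>
    have "T_neg b (V j) = (if V (Suc j) = 0 then V 0 else V (Suc j))"
    proof (cases "V (Suc j) = 0")
      case True
      then have "b * V j = of_int (int (a !! j) + 1)" using e by simp
      then show ?thesis using True V0 unfolding T_neg_def by (simp only: floor_of_int) simp
    next
      case False
      then have "0 < V (Suc j)" "V (Suc j) \<le> 1" using V01[of "Suc j"] by auto
      then have "\<lfloor>b * V j\<rfloor> = int (a !! j)" unfolding e by linarith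
      then show ?thesis using False e unfolding T_neg_def by simp
    qed
    then show ?case using j by auto
  qed
  moreover have "finite (range V)"
    using finite_imageI[OF finite_sdrop[OF per], of "val b"] unfolding V_def by (simp add: image_image)
  ultimately have "finite (range (\<lambda>k. (T_neg b ^^ k) 1))" by (metis finite_subset image_subsetI)
  then have "\<not> inj (\<lambda>k. (T_neg b ^^ k) 1)" using finite_imageD by blast
  then obtain i j where "(T_neg b ^^ i) 1 = (T_neg b ^^ j) 1" "i < j"
    unfolding inj_def by (metis linorder_neqE_nat)
  then have "sdrop i (kneading b) = sdrop j (kneading b)" by (simp add: sdrop_expansion)
  with \<open>i < j\<close> have "eventually_periodic (kneading b)" using eventually_periodic_iff by blast
  then show ?thesis using b unfolding yrrap_def b_def by simp
qed

section \<open>Sequences ordered by a permutation\<close>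

text \<open>Two sequences are followed along \<open>f\<close> until they differ; each common digit
  swaps the pair. Only weak antitonicity of \<open>f\<close> is asked for, because in the
  applications the successor of the last position is redirected and distinct positions may
  merge.\<close>

lemma orbit_order:
  assumes f: "\<And>j. j \<in> S \<Longrightarrow> f j \<in> S" and s: "\<And>j. j \<in> S \<Longrightarrow> s j = dig j ## s (f j)"
    and step: "\<And>j k. j \<in> S \<Longrightarrow> k \<in> S \<Longrightarrow> \<rho> j < (\<rho> k :: nat) \<Longrightarrow>
      dig j < dig k \<or> dig j = dig k \<and> \<rho> (f k) \<le> \<rho> (f j)"
    and inj: "inj_on \<rho> S" and jk: "j \<in> S" "k \<in> S" "\<rho> j \<le> \<rho> k"
  shows "alt_le (s j) (s k)"
proof (cases "s j = s k")
  case False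
  then obtain i where "s j !! i \<noteq> s k !! i" using stream_eqI by blast
  moreover have "\<rho> j < \<rho> k" using jk inj False by (metis inj_onD order_le_less)
  ultimately have "alt_less (s j) (s k)" using jk(1,2)
  proof (induction i arbitrary: j k)
    case 0
    then show ?case using step[of j k] s[of j] s[of k] by (auto simp: alt_less_Stream)
  next
    case (Suc i)
    show ?case
    proof (cases "dig j < dig k")
      case True
      then show ?thesis using s Suc.prems by (simp add: alt_less_Stream)
    next
      case False
      then have eq: "dig j = dig k" "\<rho> (f k) \<le> \<rho> (f j)" using step[of j k] Suc.prems by auto
      have ne: "s (f k) !! i \<noteq> s (f j) !! i" using Suc.prems s[of j] s[of k] by auto
      then have "f k \<noteq> f j" by auto
      then have "\<rho> (f k) < \<rho> (f j)" using eq f Suc.prems inj by (metis inj_onD order_le_less)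
      then have "alt_less (s (f k)) (s (f j))" using Suc.IH[OF ne] f Suc.prems by blast
      then show ?thesis using s Suc.prems eq by (simp add: alt_less_Stream)
    qed
  qed
  then show ?thesis by (rule alt_less_imp_le)
qed simp

lemma orbit_shift:
  assumes "\<And>j. j \<in> S \<Longrightarrow> f j \<in> S" "\<And>j. j \<in> S \<Longrightarrow> s j = dig j ## s (f j)" "j \<in> S"
  shows "\<exists>k\<in>S. sdrop t (s j) = s k"
proof (induction t)
  case (Suc t)
  then obtain k where "k \<in> S" "sdrop t (s j) = s k" by blast
  then have "sdrop (Suc t) (s j) = s (f k)" using assms(2)[of k] by (metis sdrop_simps(2) stream.sel(2))
  then show ?case using assms(1) \<open>k \<in> S\<close> by blast
qed (use assms in auto)

text \<open>The digit words that an orbit with pattern \<open>\<pi>\<close> can have: points with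
  equal digits lie on one decreasing branch. Position \<open>n\<close> has no condition, since
  nothing is known about its image.\<close>

definition consistent :: "nat \<Rightarrow> (nat \<Rightarrow> nat) \<Rightarrow> (nat \<Rightarrow> nat) \<Rightarrow> bool" where
  "consistent n \<pi> \<zeta> \<longleftrightarrow> (\<forall>j\<in>{1..<n}. \<forall>k\<in>{1..<n}. \<pi> j < \<pi> k \<longrightarrow>
     \<zeta> j < \<zeta> k \<or> \<zeta> j = \<zeta> k \<and> \<pi> (k + 1) < \<pi> (j + 1))"

lemma consistentD:
  "consistent n \<pi> \<zeta> \<Longrightarrow> j \<in> {1..<n} \<Longrightarrow> k \<in> {1..<n} \<Longrightarrow> \<pi> j < \<pi> k \<Longrightarrow>
    \<zeta> j < \<zeta> k \<or> \<zeta> j = \<zeta> k \<and> \<pi> (Suc k) < \<pi> (Suc j)"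
  unfolding consistent_def by simp

definition tail_seq :: "nat \<Rightarrow> (nat \<Rightarrow> nat) \<Rightarrow> nat stream \<Rightarrow> nat \<Rightarrow> nat stream" where
  "tail_seq n \<zeta> y j = subword \<zeta> j n @- y"

text \<open>Closure under shifts, together with the order, makes the sequence at the maximal
  position dominate all shifts of all the sequences; see \<open>compatible_adm\<close>.\<close>

definition compatible :: "nat \<Rightarrow> (nat \<Rightarrow> nat) \<Rightarrow> (nat \<Rightarrow> nat stream) \<Rightarrow> bool" where
  "compatible n \<pi> s \<longleftrightarrow>
     (\<forall>j\<in>{1..n}. \<forall>k\<in>{1..n}. \<pi> j \<le> \<pi> k \<longrightarrow> alt_le (s j) (s k)) \<and>
     (\<forall>j\<in>{1..n}. \<forall>t. \<exists>k\<in>{1..n}. sdrop t (s j) = s k)"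

lemma subword_Cons: "j < n \<Longrightarrow> subword \<zeta> j n = \<zeta> j # subword \<zeta> (Suc j) n"
  unfolding subword_def by (simp add: upt_conv_Cons)

lemma subword_self [simp]: "subword \<zeta> n n = []"
  unfolding subword_def by simp

lemma length_subword [simp]: "length (subword \<zeta> j n) = n - j"
  unfolding subword_def by simp

lemma nth_subword: "i < n - j \<Longrightarrow> subword \<zeta> j n ! i = \<zeta> (j + i)"
  unfolding subword_def by simp

lemma tail_seq_Stream: "j < n \<Longrightarrow> tail_seq n \<zeta> y j = \<zeta> j ## tail_seq n \<zeta> y (Suc j)"
  unfolding tail_seq_def by (simp add: subword_Cons)

lemma tail_seq_end [simp]: "tail_seq n \<zeta> y n = y"
  unfolding tail_seq_def by simp

lemma tail_seq_cycle:
  "q < n \<Longrightarrow> tail_seq n \<zeta> (cycle (subword \<zeta> q n)) q = cycle (subword \<zeta> q n)"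
  unfolding tail_seq_def by (intro cycle_eq_shift) (simp add: subword_Cons)

lemma permutes_inj_eq: "\<pi> permutes S \<Longrightarrow> \<pi> j = \<pi> k \<longleftrightarrow> j = k"
  using permutes_inj inj_eq by metis

text \<open>The periodic tail amounts to identifying position \<open>n\<close> with its neighbour
  \<open>q\<close>. No value of \<open>\<pi>\<close> separates the two, so replacing one by the
  other only weakens strict inequalities.\<close>

lemma compatible_cycle:
  assumes \<pi>: "\<pi> permutes {1..n}" and \<zeta>: "consistent n \<pi> \<zeta>" and q: "q \<in> {1..<n}"
    and adj: "\<pi> q + 1 = \<pi> n \<or> \<pi> n + 1 = \<pi> q"
  shows "compatible n \<pi> (tail_seq n \<zeta> (cycle (subword \<zeta> q n)))"
proof -
  let ?s = "tail_seq n \<zeta> (cycle (subword \<zeta> q n))"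
  let ?f = "\<lambda>j. if Suc j = n then q else Suc j"
  have eq: "\<pi> i = \<pi> j \<longleftrightarrow> i = j" for i j using permutes_inj_eq[OF \<pi>] .
  have sn: "?s n = ?s q" using tail_seq_cycle[of q n \<zeta>] q by simp
  have f: "?f j \<in> {1..<n}" if "j \<in> {1..<n}" for j using that q by auto
  have s: "?s j = \<zeta> j ## ?s (?f j)" if "j \<in> {1..<n}" for j
    using that sn tail_seq_Stream[of j n] by auto
  have step: "\<zeta> j < \<zeta> k \<or> \<zeta> j = \<zeta> k \<and> \<pi> (?f k) \<le> \<pi> (?f j)"
    if "j \<in> {1..<n}" "k \<in> {1..<n}" "\<pi> j < \<pi> k" for j k
    using consistentD[OF \<zeta> that] that adj by (auto simp: eq)
  have inj: "inj_on \<pi> {1..<n}" using eq by (auto simp: inj_on_def)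
  have ord: "alt_le (?s j) (?s k)" if "j \<in> {1..<n}" "k \<in> {1..<n}" "\<pi> j \<le> \<pi> k" for j k
    by (rule orbit_order[where f = ?f and dig = \<zeta>, OF f s step inj that])
  have shift: "\<exists>k\<in>{1..<n}. sdrop t (?s j) = ?s k" if "j \<in> {1..<n}" for j t
    by (rule orbit_shift[where f = ?f and dig = \<zeta>, OF f s that])
  let ?r = "\<lambda>j. if j = n then q else j"
  have r: "?r j \<in> {1..<n}" "?s (?r j) = ?s j" if "j \<in> {1..n}" for j
    using that q sn by auto
  show ?thesis
    unfolding compatible_def
  proof (intro conjI ballI allI impI)
    fix j k assume jk: "j \<in> {1..n}" "k \<in> {1..n}" "\<pi> j \<le> \<pi> k"
    show "alt_le (?s j) (?s k)"
    proof (cases "j = k")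
      case False
      then have "\<pi> j < \<pi> k" using jk eq by (metis order_le_less)
      then have "\<pi> (?r j) \<le> \<pi> (?r k)" using adj by auto
      from ord[OF r(1)[OF jk(1)] r(1)[OF jk(2)] this] show ?thesis using r(2) jk by simp
    qed simp
  next
    fix j t assume j: "j \<in> {1..n}"
    from shift[OF r(1)[OF j]] obtain k where "k \<in> {1..<n}" "sdrop t (?s j) = ?s k"
      unfolding r(2)[OF j] by blast
    then show "\<exists>k\<in>{1..n}. sdrop t (?s j) = ?s k" by (intro bexI[of _ k]) auto
  qed
qed

text \<open>Here position \<open>n\<close> is lowest and is given digit 0 and successor
  \<open>m\<close>: the smallest point goes to the largest, which satisfies the order condition
  against every other position.\<close>

lemma compatible_zero:
  assumes \<pi>: "\<pi> permutes {1..n}" and \<zeta>: "consistent n \<pi> \<zeta>" and m: "m \<in> {1..n}" "\<pi> m = n"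
    and 1: "\<pi> n = 1"
  shows "compatible n \<pi> (tail_seq n \<zeta> (0 ## cycle (subword \<zeta> m n @ [0])))"
    "tail_seq n \<zeta> (0 ## cycle (subword \<zeta> m n @ [0])) m = cycle (subword \<zeta> m n @ [0])"
proof -
  define s where "s = tail_seq n \<zeta> (0 ## cycle (subword \<zeta> m n @ [0]))"
  let ?f = "\<lambda>j. if j = n then m else Suc j"
  let ?d = "\<lambda>j. if j = n then 0 else \<zeta> j"
  have eq: "\<pi> i = \<pi> j \<longleftrightarrow> i = j" for i j using permutes_inj_eq[OF \<pi>] .
  have sm: "s m = cycle (subword \<zeta> m n @ [0])"
    using cycle_eq_shift[of "subword \<zeta> m n @ [0]"] unfolding s_def tail_seq_def by simp
  then show "tail_seq n \<zeta> (0 ## cycle (subword \<zeta> m n @ [0])) m = cycle (subword \<zeta> m n @ [0])"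
    unfolding s_def .
  have f: "?f j \<in> {1..n}" if "j \<in> {1..n}" for j using that m by auto
  have s: "s j = ?d j ## s (?f j)" if "j \<in> {1..n}" for j
    using that sm tail_seq_Stream[of j n \<zeta>] unfolding s_def by auto
  have img: "\<pi> j \<in> {1..n}" if "j \<in> {1..n}" for j using permutes_in_image[OF \<pi>] that by blast
  have step: "?d j < ?d k \<or> ?d j = ?d k \<and> \<pi> (?f k) \<le> \<pi> (?f j)"
    if jk: "j \<in> {1..n}" "k \<in> {1..n}" "\<pi> j < \<pi> k" for j k
  proof -
    have k: "k \<noteq> n" using jk img[of j] 1 by auto
    show ?thesis
    proof (cases "j = n")
      case True
      have "\<pi> (Suc k) \<le> n" using img[of "Suc k"] jk k by auto
      then show ?thesis using True k m by auto
    next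
      case False
      then show ?thesis using consistentD[OF \<zeta> _ _ jk(3)] jk k by auto
    qed
  qed
  have inj: "inj_on \<pi> {1..n}" using eq by (auto simp: inj_on_def)
  have "compatible n \<pi> s"
    unfolding compatible_def
    using orbit_order[where f = ?f and dig = ?d, OF f s step inj]
      orbit_shift[where f = ?f and dig = ?d, OF f s] by blast
  then show "compatible n \<pi> (tail_seq n \<zeta> (0 ## cycle (subword \<zeta> m n @ [0])))"
    unfolding s_def .
qed

lemma compatible_adm:
  assumes \<pi>: "\<pi> permutes {1..n}" and "compatible n \<pi> s" "m \<in> {1..n}" "\<pi> m = n" "j \<in> {1..n}"
  shows "adm (s m) (s j)"
  unfolding adm_def
proof
  fix t
  obtain k where k: "k \<in> {1..n}" "sdrop t (s j) = s k" using assms(2,5) unfolding compatible_def by blast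
  then have "\<pi> k \<le> \<pi> m" using permutes_in_image[OF \<pi>] assms(4) by (metis atLeastAtMost_iff)
  then show "alt_le (sdrop t (s j)) (s m)" using k assms(2,3) unfolding compatible_def by simp
qed

section \<open>Realizing a permutation\<close>

text \<open>The comparison with the \<open>n\<close>-th point decides everything: two positions with
  equal digits are advanced together until one of them is \<open>n\<close>.\<close>

lemma realize_real:
  assumes \<beta>: "\<beta> > 1" and n: "n \<ge> 1" and \<pi>: "\<pi> permutes {1..n}" and \<zeta>: "consistent n \<pi> \<zeta>"
    and x01: "\<And>j. j \<in> {1..n} \<Longrightarrow> 0 < x j \<and> x j \<le> 1"
    and rec: "\<And>j. j \<in> {1..<n} \<Longrightarrow> x j = (real (\<zeta> j) + 1 - x (Suc j)) / \<beta>"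
    and lt: "\<And>j. j \<in> {1..<n} \<Longrightarrow> \<pi> j < \<pi> n \<Longrightarrow> x j < x n"
    and gt: "\<And>j. j \<in> {1..<n} \<Longrightarrow> \<pi> n < \<pi> j \<Longrightarrow> x n < x j"
  shows "is_Pat (x 1) (T_neg \<beta>) n \<pi>" and "i < n \<Longrightarrow> (T_neg \<beta> ^^ i) (x 1) = x (Suc i)"
proof -
  have eq: "\<pi> i = \<pi> j \<longleftrightarrow> i = j" for i j using permutes_inj_eq[OF \<pi>] .
  have ord: "x j < x k" if "j \<in> {1..n}" "k \<in> {1..n}" "\<pi> j < \<pi> k" for j k
    using that
  proof (induction "n - max j k" arbitrary: j k rule: less_induct)
    case less
    consider "j = n" | "k = n" | "j < n" "k < n" using less.prems by force
    then show ?case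
    proof cases
      case 1
      then show ?thesis using gt[of k] less.prems by force
    next
      case 2
      then show ?thesis using lt[of j] less.prems by force
    next
      case 3
      have jk: "j \<in> {1..<n}" "k \<in> {1..<n}" using 3 less.prems by auto
      have x1: "0 < x (Suc j)" "x (Suc k) \<le> 1" using x01[of "Suc j"] x01[of "Suc k"] jk by auto
      have "real (\<zeta> j) + 1 - x (Suc j) < real (\<zeta> k) + 1 - x (Suc k)"
      proof (cases "\<zeta> j < \<zeta> k")
        case True
        then show ?thesis using x1 by linarith
      next
        case False
        then have e: "\<zeta> j = \<zeta> k" "\<pi> (Suc k) < \<pi> (Suc j)"
          using consistentD[OF \<zeta> jk less.prems(3)] by auto
        have "x (Suc k) < x (Suc j)"
          by (rule less.hyps) (use e jk in auto)
        then show ?thesis using e by simp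
      qed
      then show ?thesis unfolding rec[OF jk(1)] rec[OF jk(2)] using \<beta> by (simp add: divide_strict_right_mono)
    qed
  qed
  have T: "T_neg \<beta> (x j) = x (Suc j)" if j: "j \<in> {1..<n}" for j
  proof -
    have e: "\<beta> * x j = real (\<zeta> j) + 1 - x (Suc j)" using rec[OF j] \<beta> by simp
    have "0 < x (Suc j)" "x (Suc j) \<le> 1" using x01[of "Suc j"] j by auto
    then have "\<lfloor>\<beta> * x j\<rfloor> = int (\<zeta> j)" unfolding e by linarith
    then show ?thesis using e unfolding T_neg_def by simp
  qed
  have it: "(T_neg \<beta> ^^ i) (x 1) = x (Suc i)" if "i < n" for i
    using that
  proof (induction i)
    case (Suc i)
    then show ?case using T[of "Suc i"] by simp
  qed simp
  then show "i < n \<Longrightarrow> (T_neg \<beta> ^^ i) (x 1) = x (Suc i)" .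
  have less_iff: "\<pi> j < \<pi> k \<longleftrightarrow> x j < x k" if "j \<in> {1..n}" "k \<in> {1..n}" for j k
    using ord[OF that] ord[OF that(2,1)] eq[of j k] by (cases "\<pi> j" "\<pi> k" rule: linorder_cases) auto
  show "is_Pat (x 1) (T_neg \<beta>) n \<pi>"
    unfolding is_Pat_def
  proof (intro conjI allI impI ballI)
    fix i j assume ij: "i < j \<and> j < n"
    then have "\<pi> (Suc i) \<noteq> \<pi> (Suc j)" using eq by simp
    then have "x (Suc i) \<noteq> x (Suc j)"
      using less_iff[of "Suc i" "Suc j"] less_iff[of "Suc j" "Suc i"] ij
      by (cases "\<pi> (Suc i)" "\<pi> (Suc j)" rule: linorder_cases) auto
    then show "(T_neg \<beta> ^^ i) (x 1) \<noteq> (T_neg \<beta> ^^ j) (x 1)" using it ij by simp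
  next
    fix i j assume ij: "i \<in> {1..n}" "j \<in> {1..n}"
    then have "i - 1 < n" "j - 1 < n" "Suc (i - 1) = i" "Suc (j - 1) = j" by auto
    then show "(\<pi> i < \<pi> j) = ((T_neg \<beta> ^^ (i - 1)) (x 1) < (T_neg \<beta> ^^ (j - 1)) (x 1))"
      using it[of "i - 1"] it[of "j - 1"] less_iff[OF ij] by simp
  qed (rule \<pi>)
qed

text \<open>A tie between \<open>V n\<close> and the points on one side of it is broken by moving the \<open>n\<close>-th point
  away from that side: the other points move by a smaller amount.\<close>

lemma realize_perturbed:
  fixes V :: "nat \<Rightarrow> real" and \<sigma> :: real
  assumes \<beta>: "\<beta> > 1" and n: "n \<ge> 1" and \<pi>: "\<pi> permutes {1..n}" and \<zeta>: "consistent n \<pi> \<zeta>"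
    and V01: "\<And>j. j \<in> {1..n} \<Longrightarrow> 0 < V j \<and> V j < 1"
    and rec: "\<And>j. j \<in> {1..<n} \<Longrightarrow> V j = (real (\<zeta> j) + 1 - V (Suc j)) / \<beta>"
    and \<sigma>: "\<sigma> = 1 \<or> \<sigma> = - 1"
    and le: "\<And>j. j \<in> {1..<n} \<Longrightarrow> \<pi> j < \<pi> n \<Longrightarrow> if \<sigma> = 1 then V j \<le> V n else V j < V n"
    and ge: "\<And>j. j \<in> {1..<n} \<Longrightarrow> \<pi> n < \<pi> j \<Longrightarrow> if \<sigma> = 1 then V n < V j else V n \<le> V j"
  shows "(n, \<pi>) \<in> patterns {0<..1} (T_neg \<beta>)"
proof -
  \<comment> \<open>Moving the last point by \<open>\<sigma> * e\<close> forces this displacement on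
    the others, by the recursion; away from \<open>n\<close> it is smaller by a factor less than
    1.\<close>
  define x where "x e j = V j + (- 1 / \<beta>) ^ (n - j) * (\<sigma> * e)" for e :: real and j
  have lim: "((\<lambda>e. x e j) \<longlongrightarrow> V j) (at_right 0)" for j
  proof -
    have "((\<lambda>e. x e j) \<longlongrightarrow> V j + (- 1 / \<beta>) ^ (n - j) * (\<sigma> * 0)) (at_right 0)"
      unfolding x_def by (intro tendsto_intros)
    then show ?thesis by simp
  qed
  have xn: "x e n = V n + \<sigma> * e" for e unfolding x_def by simp
  have c: "\<bar>(- 1 / \<beta>) ^ (n - j)\<bar> < 1" if "j \<in> {1..<n}" for j
  proof -
    have "\<bar>(- 1 / \<beta>) ^ (n - j)\<bar> = (1 / \<beta>) ^ (n - j)" using \<beta> by (simp add: power_abs)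
    also have "\<dots> < 1" using \<beta> that by (simp add: power_less_one_iff)
    finally show ?thesis .
  qed
  have diff: "x e j - x e n = V j - V n - (1 - (- 1 / \<beta>) ^ (n - j)) * (\<sigma> * e)" for e j
    unfolding xn unfolding x_def by (simp add: algebra_simps)
  have evlt: "\<forall>\<^sub>F e in at_right 0. x e j < x e k" if "V j < V k" for j k
  proof -
    have "((\<lambda>e. x e k - x e j) \<longlongrightarrow> V k - V j) (at_right 0)" by (intro tendsto_diff lim)
    from order_tendstoD(1)[OF this, of 0] that show ?thesis by simp
  qed
  have pos: "\<forall>\<^sub>F e in at_right 0. (0::real) < e" by (simp add: eventually_at_filter)
  have "\<forall>\<^sub>F e in at_right 0. \<forall>j\<in>{1..n}. 0 < x e j \<and> x e j \<le> 1"
  proof (intro eventually_ball_finite ballI)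
    fix j assume "j \<in> {1..n}"
    then have "\<forall>\<^sub>F e in at_right 0. 0 < x e j" "\<forall>\<^sub>F e in at_right 0. x e j < 1"
      using V01[of j] by (auto intro: order_tendstoD[OF lim])
    then show "\<forall>\<^sub>F e in at_right 0. 0 < x e j \<and> x e j \<le> 1"
      by eventually_elim simp
  qed simp
  moreover have "\<forall>\<^sub>F e in at_right 0. \<forall>j\<in>{1..<n}. \<pi> j < \<pi> n \<longrightarrow> x e j < x e n"
  proof (intro eventually_ball_finite ballI)
    fix j assume j: "j \<in> {1..<n}"
    show "\<forall>\<^sub>F e in at_right 0. \<pi> j < \<pi> n \<longrightarrow> x e j < x e n"
    proof (cases "\<pi> j < \<pi> n \<and> V j = V n")
      case True
      then have "\<sigma> = 1" using le[OF j] by (auto split: if_splits)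
      from pos show ?thesis
      proof eventually_elim
        case (elim e)
        have "0 < (1 - (- 1 / \<beta>) ^ (n - j)) * (\<sigma> * e)"
          using c[OF j, THEN abs_less_iff[THEN iffD1], THEN conjunct1] elim \<open>\<sigma> = 1\<close> by (intro mult_pos_pos) auto
        then show ?case using diff[of e j] True by simp
      qed
    next
      case False
      then have "V j < V n \<or> \<not> \<pi> j < \<pi> n" using le[OF j] by (auto split: if_splits)
      then show ?thesis using evlt by auto
    qed
  qed simp
  moreover have "\<forall>\<^sub>F e in at_right 0. \<forall>j\<in>{1..<n}. \<pi> n < \<pi> j \<longrightarrow> x e n < x e j"
  proof (intro eventually_ball_finite ballI)
    fix j assume j: "j \<in> {1..<n}"
    show "\<forall>\<^sub>F e in at_right 0. \<pi> n < \<pi> j \<longrightarrow> x e n < x e j"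
    proof (cases "\<pi> n < \<pi> j \<and> V j = V n")
      case True
      then have "\<sigma> = - 1" using ge[OF j] \<sigma> by (auto split: if_splits)
      from pos show ?thesis
      proof eventually_elim
        case (elim e)
        have "0 < (1 - (- 1 / \<beta>) ^ (n - j)) * (- (\<sigma> * e))"
          using c[OF j, THEN abs_less_iff[THEN iffD1], THEN conjunct1] elim \<open>\<sigma> = - 1\<close> by (intro mult_pos_pos) auto
        then show ?case using diff[of e j] True by simp
      qed
    next
      case False
      then have "V n < V j \<or> \<not> \<pi> n < \<pi> j" using ge[OF j] by (auto split: if_splits)
      then show ?thesis using evlt by auto
    qed
  qed simp
  ultimately have "\<forall>\<^sub>F e in at_right 0. (\<forall>j\<in>{1..n}. 0 < x e j \<and> x e j \<le> 1) \<and>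
      (\<forall>j\<in>{1..<n}. \<pi> j < \<pi> n \<longrightarrow> x e j < x e n) \<and> (\<forall>j\<in>{1..<n}. \<pi> n < \<pi> j \<longrightarrow> x e n < x e j)"
    by eventually_elim blast
  then obtain e where e: "\<forall>j\<in>{1..n}. 0 < x e j \<and> x e j \<le> 1"
      "\<forall>j\<in>{1..<n}. \<pi> j < \<pi> n \<longrightarrow> x e j < x e n" "\<forall>j\<in>{1..<n}. \<pi> n < \<pi> j \<longrightarrow> x e n < x e j"
    using eventually_happens[of _ "at_right (0::real)"] by fastforce
  have "x e j = (real (\<zeta> j) + 1 - x e (Suc j)) / \<beta>" if j: "j \<in> {1..<n}" for j
  proof -
    have "n - j = Suc (n - Suc j)" using j by auto
    then show ?thesis using rec[OF j] \<beta> unfolding x_def by (simp add: field_simps)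
  qed
  then have "is_Pat (x e 1) (T_neg \<beta>) n \<pi>"
    using realize_real(1)[OF \<beta> n \<pi> \<zeta>, of "x e"] e by blast
  then show ?thesis using n e(1) unfolding patterns_def by auto
qed

text \<open>Below 1 distinct sequences have distinct values, so \<open>strict\<close> leaves one
  side of the \<open>n\<close>-th point free of ties. That is the side towards which the point is
  moved.\<close>

lemma realize:
  assumes \<beta>: "\<beta> > 1" and n: "n \<ge> 1" and \<pi>: "\<pi> permutes {1..n}" and \<zeta>: "consistent n \<pi> \<zeta>"
    and comp: "compatible n \<pi> (tail_seq n \<zeta> y)" and m: "m \<in> {1..n}" "\<pi> m = n"
    and a: "alt_less (tail_seq n \<zeta> y m) (kneading \<beta>)" "val \<beta> (tail_seq n \<zeta> y m) < 1"
    and strict: "(\<forall>j\<in>{1..<n}. \<pi> n < \<pi> j \<longrightarrow> tail_seq n \<zeta> y j \<noteq> y) \<or>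
      (\<forall>j\<in>{1..<n}. \<pi> j < \<pi> n \<longrightarrow> tail_seq n \<zeta> y j \<noteq> y)"
  shows "(n, \<pi>) \<in> patterns {0<..1} (T_neg \<beta>)"
proof -
  let ?s = "tail_seq n \<zeta> y"
  define V where "V j = val \<beta> (?s j)" for j
  have ad: "adm (kneading \<beta>) (?s j)" if "j \<in> {1..n}" for j
    using compatible_adm[OF \<pi> comp m that] adm_mono[OF alt_less_imp_le[OF a(1)]] by blast
  have adk: "adm (kneading \<beta>) (?s m)" using ad m by blast
  have small: "val \<beta> (sdrop t (?s j)) < 1" if j: "j \<in> {1..n}" for j t
  proof -
    have "val \<beta> (sdrop t (?s j)) \<le> val \<beta> (?s m)"
      by (intro val_mono \<beta> adm_sdrop ad j adk adm_le compatible_adm[OF \<pi> comp m])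
    then show ?thesis using a(2) by simp
  qed
  have V01: "0 < V j \<and> V j < 1" if j: "j \<in> {1..n}" for j
  proof -
    have "0 < val \<beta> (?s j)" by (intro val_pos \<beta> ad j) (use small[OF j, of 1] in simp)
    then show ?thesis using small[OF j, of 0] unfolding V_def by simp
  qed
  have rec: "V j = (real (\<zeta> j) + 1 - V (Suc j)) / \<beta>" if j: "j \<in> {1..<n}" for j
  proof -
    have "bounded_by (shd (kneading \<beta>)) (?s (Suc j))" using adm_bounded ad[of "Suc j"] j by auto
    from val_Stream[OF \<beta> this, of "\<zeta> j"] show ?thesis
      using tail_seq_Stream[of j n \<zeta> y] j unfolding V_def by simp
  qed
  have mono: "V j \<le> V k" if "j \<in> {1..n}" "k \<in> {1..n}" "\<pi> j \<le> \<pi> k" for j k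
    unfolding V_def using that comp by (intro val_mono \<beta> ad) (auto simp: compatible_def)
  have smono: "V j < V k" if jk: "j \<in> {1..n}" "k \<in> {1..n}" "\<pi> j \<le> \<pi> k" "?s j \<noteq> ?s k" for j k
    unfolding V_def
  proof (intro val_strict_mono \<beta> ad jk small)
    have "alt_le (?s j) (?s k)" using comp jk unfolding compatible_def by blast
    then show "alt_less (?s j) (?s k)" using jk(4) unfolding alt_le_def by blast
  qed
  have n1: "n \<in> {1..n}" using n by simp
  from strict show ?thesis
  proof
    assume st: "\<forall>j\<in>{1..<n}. \<pi> n < \<pi> j \<longrightarrow> ?s j \<noteq> y"
    show ?thesis
    proof (rule realize_perturbed[OF \<beta> n \<pi> \<zeta>, OF V01 rec, of 1])
      fix j assume j: "j \<in> {1..<n}" "\<pi> n < \<pi> j"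
      then have "?s n \<noteq> ?s j" using st by auto
      with j show "if (1::real) = 1 then V n < V j else V n \<le> V j"
        using smono[of n j] n1 by simp
    next
      fix j assume "j \<in> {1..<n}" "\<pi> j < \<pi> n"
      then show "if (1::real) = 1 then V j \<le> V n else V j < V n"
        using mono[of j n] n1 by simp
    qed auto
  next
    assume st: "\<forall>j\<in>{1..<n}. \<pi> j < \<pi> n \<longrightarrow> ?s j \<noteq> y"
    show ?thesis
    proof (rule realize_perturbed[OF \<beta> n \<pi> \<zeta>, OF V01 rec, of "- 1"])
      fix j assume j: "j \<in> {1..<n}" "\<pi> j < \<pi> n"
      then have "?s j \<noteq> ?s n" using st by auto
      with j show "if (- 1::real) = 1 then V j \<le> V n else V j < V n"
        using smono[of j n] n1 by simp
    next
      fix j assume "j \<in> {1..<n}" "\<pi> n < \<pi> j"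
      then show "if (- 1::real) = 1 then V n < V j else V n \<le> V j"
        using mono[of n j] n1 by simp
    qed auto
  qed
qed

section \<open>Consistent digits\<close>

text \<open>Digits are compared through neighbouring ranks, but the rank \<open>c = \<pi> n\<close>
  carries no digit, so the chain has to jump over it.\<close>

lemma skip_induct:
  fixes c n :: nat
  assumes step: "\<And>i. 1 \<le> i \<Longrightarrow> Suc i \<le> n \<Longrightarrow> i \<noteq> c \<Longrightarrow> Suc i \<noteq> c \<Longrightarrow> R i (Suc i)"
    and skip: "2 \<le> c \<Longrightarrow> Suc c \<le> n \<Longrightarrow> R (c - 1) (Suc c)"
    and trans: "\<And>i j k. R i j \<Longrightarrow> R j k \<Longrightarrow> R i k"
    and ij: "1 \<le> i" "i < j" "j \<le> n" "i \<noteq> c" "j \<noteq> c"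
  shows "R i j"
  using ij(2-)
proof (induction j rule: less_induct)
  case (less j)
  define p where "p = (if j - 1 = c then j - 2 else j - 1)"
  have p: "i \<le> p" "p < j" "p \<noteq> c" using less.prems ij(1) unfolding p_def by (auto split: if_splits)
  have "R p j"
  proof (cases "j - 1 = c")
    case True
    then show ?thesis using skip less.prems ij(1) p unfolding p_def by (auto simp: numeral_2_eq_2)
  next
    case False
    then show ?thesis using step[of "j - 1"] less.prems ij(1) p unfolding p_def by auto
  qed
  show ?case
  proof (cases "i = p")
    case False
    then have "R i p" using less.IH[of p] p less.prems by auto
    then show ?thesis using \<open>R p j\<close> trans by blast
  qed (use \<open>R p j\<close> in simp)
qed

lemma consistent_advance:
  assumes \<zeta>: "consistent n \<pi> \<zeta>" and "1 \<le> j" "1 \<le> k" "j + t \<le> n" "k + t \<le> n"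
    and "\<And>u. u < t \<Longrightarrow> \<zeta> (j + u) = \<zeta> (k + u)" and "\<pi> j < \<pi> k"
  shows "if even t then \<pi> (j + t) < \<pi> (k + t) else \<pi> (k + t) < \<pi> (j + t)"
  using assms(4-6)
proof (induction t)
  case (Suc t)
  then have "if even t then \<pi> (j + t) < \<pi> (k + t) else \<pi> (k + t) < \<pi> (j + t)" by simp
  then show ?case
    using consistentD[OF \<zeta>, of "j + t" "k + t"] consistentD[OF \<zeta>, of "k + t" "j + t"] Suc.prems assms(2,3)
    by (auto split: if_splits)
qed (use assms in simp)

lemma consistent_mono:
  "consistent n \<pi> \<zeta> \<Longrightarrow> j \<in> {1..<n} \<Longrightarrow> k \<in> {1..<n} \<Longrightarrow> \<pi> j \<le> \<pi> k \<Longrightarrow> \<pi> permutes {1..n} \<Longrightarrow> \<zeta> j \<le> \<zeta> k"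
  using consistentD[of n \<pi> \<zeta> j k] permutes_inj_eq[of \<pi> "{1..n}" j k] by (cases "\<pi> j = \<pi> k") auto

text \<open>The ranks at which a digit is forced to grow: equal digits would require the successors
  in reverse order. The second alternative is the jump over \<open>\<pi> n\<close>, recorded at the
  rank \<open>\<pi> n - 1\<close>.\<close>

definition rise :: "nat \<Rightarrow> (nat \<Rightarrow> nat) \<Rightarrow> nat \<Rightarrow> bool" where
  "rise n \<pi> i \<longleftrightarrow>
     (i \<noteq> \<pi> n \<and> \<pi> n \<noteq> i + 1 \<and> \<pi> (inv \<pi> i + 1) < \<pi> (inv \<pi> (i + 1) + 1)) \<or>
     (i + 1 = \<pi> n \<and> \<pi> n \<noteq> n \<and> \<pi> (l_pos n \<pi> + 1) < \<pi> (r_pos n \<pi> + 1))"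

definition rises :: "nat \<Rightarrow> (nat \<Rightarrow> nat) \<Rightarrow> nat \<Rightarrow> nat" where
  "rises n \<pi> i = card {i'. 1 \<le> i' \<and> i' < i \<and> rise n \<pi> i'}"

lemma z_digit_eq: "z_digit n \<pi> j = rises n \<pi> (\<pi> j)"
  unfolding z_digit_def rises_def rise_def ..

lemma rises_1 [simp]: "rises n \<pi> (Suc 0) = 0"
  unfolding rises_def by simp

lemma rises_Suc: "1 \<le> i \<Longrightarrow> rises n \<pi> (Suc i) = rises n \<pi> i + of_bool (rise n \<pi> i)"
proof -
  assume "1 \<le> i"
  then have "{i'. 1 \<le> i' \<and> i' < Suc i \<and> rise n \<pi> i'} =
    (if rise n \<pi> i then insert i {i'. 1 \<le> i' \<and> i' < i \<and> rise n \<pi> i'} else {i'. 1 \<le> i' \<and> i' < i \<and> rise n \<pi> i'})"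
    by (auto simp: less_Suc_eq)
  then show ?thesis unfolding rises_def by simp
qed

lemma not_rise_last: "\<not> rise n \<pi> (\<pi> n)"
  unfolding rise_def by simp

context
  fixes n :: nat and \<pi> :: "nat \<Rightarrow> nat"
  assumes \<pi>: "\<pi> permutes {1..n}"
begin

lemma perm_eq: "\<pi> i = \<pi> j \<longleftrightarrow> i = j"
  using permutes_inj_eq[OF \<pi>] .

lemma perm_inv: "\<pi> (inv \<pi> i) = i" "inv \<pi> (\<pi> i) = i"
  using permutes_inverses[OF \<pi>] by auto

lemma perm_range: "j \<in> {1..n} \<Longrightarrow> \<pi> j \<in> {1..n}"
  using permutes_in_image[OF \<pi>] by blast

lemma inv_range: "i \<in> {1..n} \<Longrightarrow> i \<noteq> \<pi> n \<Longrightarrow> inv \<pi> i \<in> {1..<n}"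
  using permutes_in_image[OF permutes_inv[OF \<pi>], of i] perm_inv(1)[of i] by (cases "inv \<pi> i = n") auto

lemma consistent_z_digit: "consistent n \<pi> (z_digit n \<pi>)"
  unfolding consistent_def
proof (intro ballI impI)
  fix j k assume jk: "j \<in> {1..<n}" "k \<in> {1..<n}" "\<pi> j < \<pi> k"
  define g where "g i = \<pi> (inv \<pi> i + 1)" for i
  let ?c = "rises n \<pi>"
  let ?R = "\<lambda>i j. ?c i \<le> ?c j \<and> (?c i = ?c j \<longrightarrow> g j < g i)"
  have ne: "g i \<noteq> g j" if "i \<noteq> j" for i j
    using that unfolding g_def perm_eq by (metis add_right_cancel perm_inv(1))
  have "?R (\<pi> j) (\<pi> k)"
  proof (rule skip_induct[where c = "\<pi> n" and n = n and R = ?R and i = "\<pi> j" and j = "\<pi> k"])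
    fix i assume i: "1 \<le> i" "Suc i \<le> n" "i \<noteq> \<pi> n" "Suc i \<noteq> \<pi> n"
    have "rise n \<pi> i \<longleftrightarrow> g i < g (Suc i)" using i unfolding rise_def g_def by auto
    then show "?R i (Suc i)" using rises_Suc[OF i(1)] ne[of i "Suc i"] by auto
  next
    assume c: "2 \<le> \<pi> n" "Suc (\<pi> n) \<le> n"
    have "rise n \<pi> (\<pi> n - 1) \<longleftrightarrow> g (\<pi> n - 1) < g (Suc (\<pi> n))"
      using c unfolding rise_def g_def l_pos_def r_pos_def by auto
    moreover have "?c (Suc (\<pi> n)) = ?c (\<pi> n - 1) + of_bool (rise n \<pi> (\<pi> n - 1))"
      using rises_Suc[of "\<pi> n" n \<pi>] rises_Suc[of "\<pi> n - 1" n \<pi>] not_rise_last c by simp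
    moreover have "g (\<pi> n - 1) \<noteq> g (Suc (\<pi> n))" by (rule ne) linarith
    ultimately show "?R (\<pi> n - 1) (Suc (\<pi> n))" by auto
  next
    show "1 \<le> \<pi> j" "\<pi> k \<le> n" using perm_range[of j] perm_range[of k] jk by auto
    show "\<pi> j \<noteq> \<pi> n" "\<pi> k \<noteq> \<pi> n" using jk perm_eq by auto
  qed (use jk in auto)
  then show "z_digit n \<pi> j < z_digit n \<pi> k \<or> z_digit n \<pi> j = z_digit n \<pi> k \<and> \<pi> (k + 1) < \<pi> (j + 1)"
    unfolding z_digit_eq g_def by (auto simp: perm_inv)
qed

text \<open>A rise forced on \<open>z_digit\<close> is forced on \<open>w\<close> as well, so the
  excess of \<open>w\<close> over \<open>z_digit\<close> grows weakly with the rank. At the lowest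
  rank \<open>z_digit\<close> is 0, which gives the second claim.\<close>

lemma consistent_excess:
  assumes w: "consistent n \<pi> w" and jk: "j \<in> {1..<n}" "k \<in> {1..<n}" "\<pi> j \<le> \<pi> k"
  shows "w j + z_digit n \<pi> k \<le> w k + z_digit n \<pi> j"
    and "z_digit n \<pi> j \<le> w j"
proof -
  let ?c = "rises n \<pi>"
  let ?R = "\<lambda>i j. w (inv \<pi> i) + ?c j \<le> w (inv \<pi> j) + ?c i"
  have R: "?R i j" if "1 \<le> i" "i < j" "j \<le> n" "i \<noteq> \<pi> n" "j \<noteq> \<pi> n" for i j
  proof (rule skip_induct[where c = "\<pi> n" and n = n and R = ?R and i = i and j = j])
    fix i assume i: "1 \<le> i" "Suc i \<le> n" "i \<noteq> \<pi> n" "Suc i \<noteq> \<pi> n"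
    have "w (inv \<pi> i) < w (inv \<pi> (Suc i)) \<or>
        w (inv \<pi> i) = w (inv \<pi> (Suc i)) \<and> \<pi> (Suc (inv \<pi> (Suc i))) < \<pi> (Suc (inv \<pi> i))"
      using i by (intro consistentD[OF w] inv_range) (auto simp: perm_inv)
    moreover have "rise n \<pi> i \<longleftrightarrow> \<pi> (Suc (inv \<pi> i)) < \<pi> (Suc (inv \<pi> (Suc i)))"
      using i unfolding rise_def by auto
    ultimately show "?R i (Suc i)" using rises_Suc[OF i(1)] by auto
  next
    assume c: "2 \<le> \<pi> n" "Suc (\<pi> n) \<le> n"
    let ?i = "\<pi> n - 1" and ?j = "Suc (\<pi> n)"
    have "w (inv \<pi> ?i) < w (inv \<pi> ?j) \<or>
        w (inv \<pi> ?i) = w (inv \<pi> ?j) \<and> \<pi> (Suc (inv \<pi> ?j)) < \<pi> (Suc (inv \<pi> ?i))"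
      using c by (intro consistentD[OF w] inv_range) (auto simp: perm_inv)
    moreover have "rise n \<pi> ?i \<longleftrightarrow> \<pi> (Suc (inv \<pi> ?i)) < \<pi> (Suc (inv \<pi> ?j))"
      using c unfolding rise_def l_pos_def r_pos_def by auto
    moreover have "?c ?j = ?c ?i + of_bool (rise n \<pi> ?i)"
      using rises_Suc[of "\<pi> n" n \<pi>] rises_Suc[of "\<pi> n - 1" n \<pi>] not_rise_last c by simp
    ultimately show "?R ?i ?j" by auto
  qed (use that in auto)
  have r: "\<pi> j \<noteq> \<pi> n" "\<pi> k \<noteq> \<pi> n" "\<pi> j \<in> {1..n}" "\<pi> k \<in> {1..n}"
    using jk perm_range[of j] perm_range[of k] perm_eq by auto
  show "w j + z_digit n \<pi> k \<le> w k + z_digit n \<pi> j"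
  proof (cases "\<pi> j = \<pi> k")
    case True
    then show ?thesis using perm_eq by auto
  next
    case False
    then show ?thesis using R[of "\<pi> j" "\<pi> k"] r jk by (simp add: z_digit_eq perm_inv)
  qed
  \<comment> \<open>The lowest rank that carries a digit.\<close>
  define f where "f = (if \<pi> n = 1 then 2 else Suc 0)"
  have "?c f = 0"
    unfolding f_def using rises_Suc[of 1 n \<pi>] not_rise_last[of n \<pi>] by (auto simp: numeral_2_eq_2)
  moreover have "f \<le> \<pi> j" "1 \<le> f" "f \<noteq> \<pi> n" using r unfolding f_def by auto
  ultimately show "z_digit n \<pi> j \<le> w j"
    using R[of f "\<pi> j"] r by (cases "f = \<pi> j") (auto simp: z_digit_eq perm_inv)
qed

end

section \<open>Spirals and commuting words\<close>

lemma spiral_below: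
  fixes \<tau> :: "nat \<Rightarrow> int"
  assumes inj: "inj_on \<tau> {0..K}" and k: "k \<in> {1..K}" "k' \<in> {1..K}" "\<tau> k = \<tau> 0 - 1" "\<tau> k' = \<tau> 0 + 1"
    and shift: "\<And>i j. i < K \<Longrightarrow> j < K \<Longrightarrow> \<tau> i < \<tau> j \<Longrightarrow>
      if e then \<tau> (Suc i) < \<tau> (Suc j) else \<tau> (Suc j) < \<tau> (Suc i)"
    and below: "\<tau> 1 < \<tau> 0"
  shows "k = 1 \<and> k' = 2"
proof -
  have "k \<noteq> k'" using k by auto
  then have K: "2 \<le> K" using k by auto
  have ne: "\<tau> i \<noteq> \<tau> j" if "i \<le> K" "j \<le> K" "i \<noteq> j" for i j
    using inj that by (auto simp: inj_on_def)
  \<comment> \<open>If steps preserve the order, the sequence keeps descending from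
    \<open>\<tau> 0\<close> and never reaches the neighbour above.\<close>
  have ev: "\<not> e"
  proof
    assume e
    have "\<tau> (Suc i) < \<tau> i \<and> \<tau> (Suc i) < \<tau> 0" if "i < K" for i
      using that
    proof (induction i)
      case (Suc i)
      then show ?case using shift[of "Suc i" i] \<open>e\<close> by auto
    qed (use below in simp)
    moreover have "k' - 1 < K" "Suc (k' - 1) = k'" using k by auto
    ultimately have "\<tau> k' < \<tau> 0" by metis
    then show False using k by simp
  qed
  have sh: "\<tau> (Suc j) \<le> \<tau> (Suc i)" if "i < K" "j < K" "\<tau> i \<le> \<tau> j" for i j
    using shift[of i j] ev that ne[of i j] by (cases "i = j") auto
  show ?thesis
  proof (cases "\<tau> 2 < \<tau> 0")
    case True
    \<comment> \<open>An inward spiral stays in the interval between its first two terms, again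
      missing the upper neighbour.\<close>
    have "\<tau> 1 \<le> \<tau> i \<and> \<tau> i \<le> \<tau> 0" if "i \<le> K" for i
      using that
    proof (induction i)
      case (Suc i)
      then have i: "\<tau> 1 \<le> \<tau> i" "\<tau> i \<le> \<tau> 0" "i < K" by auto
      have "\<tau> (Suc 0) \<le> \<tau> (Suc i)" using sh[of i 0] i K by simp
      moreover have "\<tau> (Suc i) \<le> \<tau> (Suc 1)" using sh[of 1 i] i K by simp
      ultimately show ?case using True by (simp add: numeral_2_eq_2)
    qed (use below in simp)
    from this[of k'] k show ?thesis by auto
  next
    case False
    then have t2: "\<tau> 0 < \<tau> 2" using ne[of 2 0] K by auto
    \<comment> \<open>In an outward spiral the first two terms after \<open>\<tau> 0\<close> remain
      the closest ones on their sides, so the adjacent entries can only be these.\<close>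
    have out: "if odd i then \<tau> i \<le> \<tau> 1 else \<tau> 2 \<le> \<tau> i" if "1 \<le> i" "i \<le> K" for i
      using that
    proof (induction i rule: dec_induct)
      case (step i)
      show ?case
      proof (cases "odd i")
        case True
        then have "\<tau> i \<le> \<tau> 1" using step by simp
        then have "\<tau> (Suc 1) \<le> \<tau> (Suc i)" using sh[of i 1] step K by simp
        then have "\<tau> 2 \<le> \<tau> (Suc i)" by (simp add: numeral_2_eq_2)
        then show ?thesis using True by simp
      next
        case False
        then have "\<tau> 2 \<le> \<tau> i" using step by simp
        then have "\<tau> (Suc i) \<le> \<tau> (Suc 0)" using sh[of 0 i] step K t2 by simp
        then show ?thesis using False by simp
      qed
    qed simp
    have "odd k" using out[of k] k t2 by (auto split: if_splits)
    then have "\<tau> k = \<tau> 1" using out[of k] k below by auto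
    then have "k = 1" using ne[of k 1] k by auto
    moreover have "even k'" using out[of k'] k below by (auto split: if_splits)
    then have "\<tau> k' = \<tau> 2" using out[of k'] k t2 by auto
    then have "k' = 2" using ne[of k' 2] k K by auto
    ultimately show ?thesis by simp
  qed
qed

lemma spiral:
  fixes \<tau> :: "nat \<Rightarrow> int"
  assumes inj: "inj_on \<tau> {0..K}" and k: "k \<in> {1..K}" "k' \<in> {1..K}" "\<tau> k = \<tau> 0 - 1" "\<tau> k' = \<tau> 0 + 1"
    and shift: "\<And>i j. i < K \<Longrightarrow> j < K \<Longrightarrow> \<tau> i < \<tau> j \<Longrightarrow>
      if e then \<tau> (Suc i) < \<tau> (Suc j) else \<tau> (Suc j) < \<tau> (Suc i)"
  shows "k = 1 \<and> k' = 2 \<or> k = 2 \<and> k' = 1"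
proof (cases "\<tau> 1 < \<tau> 0")
  case True
  then show ?thesis using spiral_below[OF assms] by blast
next
  case False
  have "1 \<le> K" using k by auto
  then have "\<tau> 1 \<noteq> \<tau> 0" using inj_onD[OF inj, of 1 0] by auto
  then have "- \<tau> 1 < - \<tau> 0" using False by auto
  moreover have "inj_on (\<lambda>i. - \<tau> i) {0..K}" using inj by (auto simp: inj_on_def)
  moreover have "if e then - \<tau> (Suc i) < - \<tau> (Suc j) else - \<tau> (Suc j) < - \<tau> (Suc i)"
    if "i < K" "j < K" "- \<tau> i < - \<tau> j" for i j
    using shift[of j i] that by auto
  ultimately show ?thesis using spiral_below[of "\<lambda>i. - \<tau> i" K k' k e] k by auto
qed

text \<open>Commuting words are powers of one word \<open>v\<close>. The entries of \<open>\<pi>\<close> at distance a multiple of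
  \<open>length v\<close> from \<open>n\<close> are then arranged monotonically or in a spiral, which leaves few
  possibilities for the two neighbours of \<open>\<pi> n\<close>.\<close>

lemma commuting_subwords:
  assumes \<pi>: "\<pi> permutes {1..n}" and \<zeta>: "consistent n \<pi> \<zeta>"
    and l: "l \<in> {1..<n}" "\<pi> l + 1 = \<pi> n" and r: "r \<in> {1..<n}" "\<pi> r = \<pi> n + 1"
    and comm: "subword \<zeta> l n @ subword \<zeta> r n = subword \<zeta> r n @ subword \<zeta> l n"
  shows "subword \<zeta> l n = subword \<zeta> r n @ subword \<zeta> r n \<or> subword \<zeta> r n = subword \<zeta> l n @ subword \<zeta> l n"
proof -
  obtain k k' v where v: "concat (replicate k v) = subword \<zeta> l n" "concat (replicate k' v) = subword \<zeta> r n"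
    using comm_append_are_replicate[OF comm] by blast
  define p where "p = length v"
  define K where "K = max k k'"
  have len: "length (concat (replicate i v)) = i * p" for i
    unfolding p_def by (induction i) auto
  have kp: "k * p = n - l" "k' * p = n - r" using len v by (metis length_subword)+
  then have pos: "0 < p" "0 < k" "0 < k'" using l r by (auto intro: Nat.gr0I)
  have "\<exists>q\<in>{l, r}. concat (replicate K v) = subword \<zeta> q n \<and> K * p = n - q"
    using v kp unfolding K_def by (cases "k \<le> k'") (auto simp: max_def)
  then obtain q where q: "q \<in> {1..<n}" "concat (replicate K v) = subword \<zeta> q n" "K * p = n - q"
    using l r by auto
  have Kp: "i * p < n" if "i \<le> K" for i
    using mult_le_mono1[OF that, of p] q by auto
  have dig: "\<zeta> (n - Suc i * p + t) = v ! t" if it: "i < K" "t < p" for i t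
  proof -
    have K: "K = (K - Suc i) + (1 + i)" using it by simp
    have "concat (replicate ((K - Suc i) + (1 + i)) v) = concat (replicate (K - Suc i) v) @ v @ concat (replicate i v)"
      by (simp only: replicate_add concat_append) simp
    then have "concat (replicate K v) = concat (replicate (K - Suc i) v) @ v @ concat (replicate i v)"
      unfolding K[symmetric] .
    then have "concat (replicate K v) ! ((K - Suc i) * p + t) = v ! t"
      using it by (simp add: nth_append len p_def)
    moreover have "(K - Suc i) * p + Suc i * p = K * p" using it by (metis add_mult_distrib Suc_leI le_add_diff_inverse2)
    then have e: "q + ((K - Suc i) * p + t) = n - Suc i * p + t" "(K - Suc i) * p + t < n - q"
      using q(1,3) it by auto
    ultimately show ?thesis using nth_subword[OF e(2), of \<zeta>] e(1) q(2) by simp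
  qed
  \<comment> \<open>Index 0 is the position \<open>n\<close>, and one step goes back by one block of
    equal letters. By injectivity, stepping back also preserves the order for even block length and
    reverses it for odd.\<close>
  define \<tau> where "\<tau> i = int (\<pi> (n - i * p))" for i
  have "k = 1 \<and> k' = 2 \<or> k = 2 \<and> k' = 1"
  proof (rule spiral[where \<tau> = \<tau> and K = K and e = "even p"])
    show "inj_on \<tau> {0..K}"
    proof (rule inj_onI)
      fix i j assume ij: "i \<in> {0..K}" "j \<in> {0..K}" "\<tau> i = \<tau> j"
      then have "n - i * p = n - j * p" unfolding \<tau>_def using permutes_inj_eq[OF \<pi>] by simp
      moreover have "i * p < n" "j * p < n" using Kp ij by auto
      ultimately have "i * p = j * p" by linarith
      then show "i = j" using pos by simp
    qed
    show "k \<in> {1..K}" "k' \<in> {1..K}" using pos unfolding K_def by auto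
    have "n - k * p = l" "n - k' * p = r" using kp l r by auto
    then show "\<tau> k = \<tau> 0 - 1" "\<tau> k' = \<tau> 0 + 1" using l r unfolding \<tau>_def by auto
    fix i j assume ij: "i < K" "j < K" "\<tau> i < \<tau> j"
    show "if even p then \<tau> (Suc i) < \<tau> (Suc j) else \<tau> (Suc j) < \<tau> (Suc i)"
    proof -
      have b: "Suc i * p < n" "Suc j * p < n" using Kp[of "Suc i"] Kp[of "Suc j"] ij by simp_all
      define A B where "A = n - Suc i * p" and "B = n - Suc j * p"
      have s: "A + p = n - i * p" "B + p = n - j * p" "1 \<le> A" "1 \<le> B" "A + p \<le> n" "B + p \<le> n"
        unfolding A_def B_def using b by auto
      have d: "\<zeta> (A + u) = \<zeta> (B + u)" if "u < p" for u
        unfolding A_def B_def using dig ij that by simp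
      have less: "\<pi> (A + p) < \<pi> (B + p)" using ij(3) unfolding \<tau>_def s by simp
      then have "A \<noteq> B" by auto
      then have "\<pi> A \<noteq> \<pi> B" using permutes_inj_eq[OF \<pi>] by simp
      then have "if even p then \<pi> A < \<pi> B else \<pi> B < \<pi> A"
        using consistent_advance[OF \<zeta> s(3,4,5,6) d] consistent_advance[OF \<zeta> s(4,3,6,5) d[symmetric]] less
        by (cases "\<pi> A" "\<pi> B" rule: linorder_cases) (auto split: if_splits)
      then show ?thesis unfolding \<tau>_def A_def B_def by (simp only: of_nat_less_iff)
    qed
  qed
  then show ?thesis using v by (auto simp: numeral_2_eq_2)
qed

definition between :: "nat \<Rightarrow> nat \<Rightarrow> nat \<Rightarrow> bool" where
  "between a b c \<longleftrightarrow> a < b \<and> b < c \<or> c < b \<and> b < a"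

text \<open>An entry strictly between two entries with equal digits shares their digit, so it can be
  advanced with them and stays between. After \<open>D - i\<close> steps it would separate
  \<open>\<pi> hi\<close> from the adjacent \<open>\<pi> n\<close>. If position \<open>n\<close> is
  reached earlier, \<open>\<pi> n\<close> itself is between, hence so is its neighbour
  \<open>\<pi> lo\<close>, which has room for the remaining steps.\<close>

lemma not_between_doubled:
  assumes \<pi>: "\<pi> permutes {1..n}" and \<zeta>: "consistent n \<pi> \<zeta>"
    and lo: "1 \<le> lo" "hi = lo + D" "n = hi + D"
    and dig: "\<And>i. i < D \<Longrightarrow> \<zeta> (lo + i) = \<zeta> (hi + i)"
    and adj: "\<pi> lo + 1 = \<pi> n \<and> \<pi> hi = \<pi> n + 1 \<or> \<pi> hi + 1 = \<pi> n \<and> \<pi> lo = \<pi> n + 1"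
    and ij: "i < D" "j \<in> {1..<n}"
  shows "\<not> between (\<pi> (lo + i)) (\<pi> j) (\<pi> (hi + i))"
proof -
  have step: "between (\<pi> (lo + Suc i)) (\<pi> (Suc j)) (\<pi> (hi + Suc i))"
    if "between (\<pi> (lo + i)) (\<pi> j) (\<pi> (hi + i))" "i < D" "j \<in> {1..<n}" for i j
  proof -
    have r: "lo + i \<in> {1..<n}" "hi + i \<in> {1..<n}" using lo that by auto
    note c = consistentD[OF \<zeta>]
    from that(1) have "\<pi> (lo + i) < \<pi> j \<and> \<pi> j < \<pi> (hi + i) \<or> \<pi> (hi + i) < \<pi> j \<and> \<pi> j < \<pi> (lo + i)"
      unfolding between_def .
    then show ?thesis
    proof
      assume *: "\<pi> (lo + i) < \<pi> j \<and> \<pi> j < \<pi> (hi + i)"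
      then show ?thesis using c[OF r(1) that(3)] c[OF that(3) r(2)] dig[OF that(2)]
        unfolding between_def by auto
    next
      assume *: "\<pi> (hi + i) < \<pi> j \<and> \<pi> j < \<pi> (lo + i)"
      then show ?thesis using c[OF r(2) that(3)] c[OF that(3) r(1)] dig[OF that(2)]
        unfolding between_def by auto
    qed
  qed
  have adv: "between (\<pi> (lo + (i + u))) (\<pi> (j + u)) (\<pi> (hi + (i + u)))"
    if "between (\<pi> (lo + i)) (\<pi> j) (\<pi> (hi + i))" "i + u \<le> D" "1 \<le> j" "j + u \<le> n" for i j u
    using that
  proof (induction u)
    case (Suc u)
    then show ?case using step[of "i + u" "j + u"] by auto
  qed simp
  have A: False if "between (\<pi> (lo + i)) (\<pi> j) (\<pi> (hi + i))" "i < D" "1 \<le> j" "j + (D - i) \<le> n" for i j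
    using adv[OF that(1), of "D - i"] that lo adj unfolding between_def by auto
  show ?thesis
  proof
    assume b: "between (\<pi> (lo + i)) (\<pi> j) (\<pi> (hi + i))"
    show False
    proof (cases "j + (D - i) \<le> n")
      case True
      then show False using A[OF b] ij by auto
    next
      case False
      define i' where "i' = i + (n - j)"
      have i': "i' < D" "1 \<le> i'" using False ij unfolding i'_def by auto
      have "between (\<pi> (lo + i')) (\<pi> n) (\<pi> (hi + i'))"
        using adv[OF b, of "n - j"] i' ij unfolding i'_def by simp
      moreover have "\<pi> lo \<noteq> \<pi> (lo + i')" "\<pi> lo \<noteq> \<pi> (hi + i')"
        using permutes_inj_eq[OF \<pi>] i' lo by auto
      ultimately have "between (\<pi> (lo + i')) (\<pi> lo) (\<pi> (hi + i'))"
        using adj unfolding between_def by auto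
      moreover have "lo + (D - i') \<le> n" using lo by linarith
      ultimately show False using A[of i' lo] i' lo by blast
    qed
  qed
qed

section \<open>Collapsed permutations\<close>

context
  fixes n :: nat and \<pi> :: "nat \<Rightarrow> nat"
  assumes n: "n \<ge> 1" and \<pi>: "\<pi> permutes {1..n}"
begin

lemma m_pos: "m_pos n \<pi> \<in> {1..n}" "\<pi> (m_pos n \<pi>) = n"
proof -
  show "\<pi> (m_pos n \<pi>) = n" unfolding m_pos_def using perm_inv(1)[OF \<pi>] .
  then show "m_pos n \<pi> \<in> {1..n}" using permutes_in_image[OF \<pi>, of "m_pos n \<pi>"] n by simp
qed

lemma perm_le_m: "j \<in> {1..n} \<Longrightarrow> \<pi> j \<le> \<pi> (m_pos n \<pi>)"
  using perm_range[OF \<pi>, of j] m_pos by simp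

lemma l_pos:
  assumes "\<pi> n \<noteq> 1" shows "l_pos n \<pi> \<in> {1..<n}" "\<pi> (l_pos n \<pi>) + 1 = \<pi> n"
proof -
  have r: "\<pi> n - 1 \<in> {1..n}" "\<pi> n - 1 \<noteq> \<pi> n" using perm_range[OF \<pi>, of n] n assms by auto
  then show "l_pos n \<pi> \<in> {1..<n}" unfolding l_pos_def by (rule inv_range[OF \<pi>])
  show "\<pi> (l_pos n \<pi>) + 1 = \<pi> n" unfolding l_pos_def using perm_inv(1)[OF \<pi>] r by auto
qed

lemma r_pos:
  assumes "\<pi> n \<noteq> n" shows "r_pos n \<pi> \<in> {1..<n}" "\<pi> (r_pos n \<pi>) = \<pi> n + 1"
proof -
  have r: "\<pi> n + 1 \<in> {1..n}" "\<pi> n + 1 \<noteq> \<pi> n" using perm_range[OF \<pi>, of n] n assms by auto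
  then show "r_pos n \<pi> \<in> {1..<n}" unfolding r_pos_def by (rule inv_range[OF \<pi>])
  show "\<pi> (r_pos n \<pi>) = \<pi> n + 1" unfolding r_pos_def using perm_inv(1)[OF \<pi>] .
qed

lemma not_last: "m_pos n \<pi> \<noteq> n \<Longrightarrow> \<pi> n \<noteq> n"
  using m_pos(2) perm_eq[OF \<pi>] by metis

lemma odd_imp_not_last: "odd (n - m_pos n \<pi>) \<Longrightarrow> \<pi> n \<noteq> n"
  using not_last by (metis diff_self_eq_0 even_zero)

lemma collapsed_cases:
  assumes "collapsed n \<pi>"
  defines "l \<equiv> l_pos n \<pi>" and "r \<equiv> r_pos n \<pi>"
  obtains D where "D > 0" "{i. int i < \<bar>int r - int l\<bar>} = {..<D}"
    "l \<in> {1..<n}" "r \<in> {1..<n}" "\<pi> l + 1 = \<pi> n" "\<pi> r = \<pi> n + 1"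
    "r = l + D \<and> n = r + D \<or> l = r + D \<and> n = l + D"
    "\<And>i. i < D \<Longrightarrow> z_digit n \<pi> (l + i) = z_digit n \<pi> (r + i)"
proof -
  let ?z = "z_digit n \<pi>"
  have "\<pi> n \<noteq> 1" "\<pi> n \<noteq> n" using assms(1) unfolding collapsed_def by auto
  then have lr: "l \<in> {1..<n}" "r \<in> {1..<n}" "\<pi> l + 1 = \<pi> n" "\<pi> r = \<pi> n + 1"
    using l_pos r_pos unfolding l_def r_def by auto
  have "subword ?z l n = subword ?z r n @ subword ?z r n \<or> subword ?z r n = subword ?z l n @ subword ?z l n"
    using assms(1) unfolding collapsed_def l_def r_def Let_def by blast
  then show thesis
  proof
    assume *: "subword ?z l n = subword ?z r n @ subword ?z r n"
    have len: "n - l = (n - r) + (n - r)" using arg_cong[OF *, of length] by simp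
    show thesis
    proof (rule that[of "n - r"])
      fix i assume i: "i < n - r"
      then have "subword ?z l n ! i = subword ?z r n ! i" unfolding * by (simp add: nth_append)
      then show "?z (l + i) = ?z (r + i)" using i len by (simp add: nth_subword)
    qed (use lr len in auto)
  next
    assume *: "subword ?z r n = subword ?z l n @ subword ?z l n"
    have len: "n - r = (n - l) + (n - l)" using arg_cong[OF *, of length] by simp
    show thesis
    proof (rule that[of "n - l"])
      fix i assume i: "i < n - l"
      then have "subword ?z r n ! i = subword ?z l n ! i" unfolding * by (simp add: nth_append)
      then show "?z (l + i) = ?z (r + i)" using i len by (simp add: nth_subword)
    qed (use lr len in auto)
  qed
qed

lemma z_shift_eq:
  "z_shift n \<pi> i j = z_digit n \<pi> j +
     of_bool ((if even i then \<pi> (r_pos n \<pi> + i) else \<pi> (l_pos n \<pi> + i)) \<le> \<pi> j)"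
  unfolding z_shift_def by auto

lemma consistent_z_shift: "consistent n \<pi> (z_shift n \<pi> i)"
  unfolding consistent_def
proof (intro ballI impI)
  fix j k assume jk: "j \<in> {1..<n}" "k \<in> {1..<n}" "\<pi> j < \<pi> k"
  from consistentD[OF consistent_z_digit[OF \<pi>] jk] jk(3)
  show "z_shift n \<pi> i j < z_shift n \<pi> i k \<or> z_shift n \<pi> i j = z_shift n \<pi> i k \<and> \<pi> (k + 1) < \<pi> (j + 1)"
    unfolding z_shift_eq by auto
qed

text \<open>Thus the threshold of \<open>z_shift n \<pi> i\<close> is always the larger of the two
  entries, and the extra unit separates the digits at \<open>l_pos n \<pi> + i\<close> and
  \<open>r_pos n \<pi> + i\<close>.\<close>

lemma collapsed_orientation:
  assumes "collapsed n \<pi>" "int i < \<bar>int (r_pos n \<pi>) - int (l_pos n \<pi>)\<bar>"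
  shows "if even i then \<pi> (l_pos n \<pi> + i) < \<pi> (r_pos n \<pi> + i) else \<pi> (r_pos n \<pi> + i) < \<pi> (l_pos n \<pi> + i)"
proof (rule collapsed_cases[OF assms(1)])
  fix D
  assume D: "{i. int i < \<bar>int (r_pos n \<pi>) - int (l_pos n \<pi>)\<bar>} = {..<D}"
    "l_pos n \<pi> \<in> {1..<n}" "r_pos n \<pi> \<in> {1..<n}" "\<pi> (l_pos n \<pi>) + 1 = \<pi> n" "\<pi> (r_pos n \<pi>) = \<pi> n + 1"
    "r_pos n \<pi> = l_pos n \<pi> + D \<and> n = r_pos n \<pi> + D \<or> l_pos n \<pi> = r_pos n \<pi> + D \<and> n = l_pos n \<pi> + D"
    "\<And>i. i < D \<Longrightarrow> z_digit n \<pi> (l_pos n \<pi> + i) = z_digit n \<pi> (r_pos n \<pi> + i)"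
  have "i < D" using assms(2) D(1) by blast
  then show ?thesis
    by (intro consistent_advance[OF consistent_z_digit[OF \<pi>]]) (use D in auto)
qed

lemma z_shift_separates:
  assumes "collapsed n \<pi>" "int i < \<bar>int (r_pos n \<pi>) - int (l_pos n \<pi>)\<bar>"
  shows "z_shift n \<pi> i (l_pos n \<pi> + i) \<noteq> z_shift n \<pi> i (r_pos n \<pi> + i)"
proof (rule collapsed_cases[OF assms(1)])
  fix D
  assume D: "{i. int i < \<bar>int (r_pos n \<pi>) - int (l_pos n \<pi>)\<bar>} = {..<D}"
    "\<And>i. i < D \<Longrightarrow> z_digit n \<pi> (l_pos n \<pi> + i) = z_digit n \<pi> (r_pos n \<pi> + i)"
  have "i < D" using assms(2) D(1) by blast
  then show ?thesis using D(2)[of i] collapsed_orientation[OF assms] unfolding z_shift_eq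
    by (auto split: if_splits)
qed

lemma z_shift_m:
  assumes "collapsed n \<pi>" "int i < \<bar>int (r_pos n \<pi>) - int (l_pos n \<pi>)\<bar>"
  shows "z_shift n \<pi> i (m_pos n \<pi>) = z_digit n \<pi> (m_pos n \<pi>) + 1"
proof (rule collapsed_cases[OF assms(1)])
  fix D
  assume D: "{i. int i < \<bar>int (r_pos n \<pi>) - int (l_pos n \<pi>)\<bar>} = {..<D}"
    "l_pos n \<pi> \<in> {1..<n}" "r_pos n \<pi> \<in> {1..<n}"
    "r_pos n \<pi> = l_pos n \<pi> + D \<and> n = r_pos n \<pi> + D \<or> l_pos n \<pi> = r_pos n \<pi> + D \<and> n = l_pos n \<pi> + D"
  have "i < D" using assms(2) D(1) by blast
  then have "r_pos n \<pi> + i \<in> {1..n}" "l_pos n \<pi> + i \<in> {1..n}" using D(2-) by auto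
  then show ?thesis using perm_le_m unfolding z_shift_eq by simp
qed

text \<open>The excess over \<open>z_digit\<close> is 0 or 1 and grows weakly with the rank. It is 0
  at the lower of the two separated entries and 1 at the upper, and by
  \<open>not_between_doubled\<close> no other entry lies between them, so it is known
  everywhere.\<close>

lemma eq_z_shift:
  assumes col: "collapsed n \<pi>" and i: "int i < \<bar>int (r_pos n \<pi>) - int (l_pos n \<pi>)\<bar>"
    and w: "consistent n \<pi> w" and le: "\<And>j. j \<in> {1..<n} \<Longrightarrow> w j \<le> z_digit n \<pi> j + 1"
    and ne: "w (l_pos n \<pi> + i) \<noteq> w (r_pos n \<pi> + i)" and j: "j \<in> {1..<n}"
  shows "w j = z_shift n \<pi> i j"
proof (rule collapsed_cases[OF col])
  let ?l = "l_pos n \<pi>" and ?r = "r_pos n \<pi>" and ?z = "z_digit n \<pi>"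
  fix D
  assume D: "{i. int i < \<bar>int ?r - int ?l\<bar>} = {..<D}"
    "?l \<in> {1..<n}" "?r \<in> {1..<n}" "\<pi> ?l + 1 = \<pi> n" "\<pi> ?r = \<pi> n + 1"
    "?r = ?l + D \<and> n = ?r + D \<or> ?l = ?r + D \<and> n = ?l + D"
    "\<And>i. i < D \<Longrightarrow> ?z (?l + i) = ?z (?r + i)"
  have iD: "i < D" using i D(1) by blast
  have nb: "\<not> between (\<pi> (?l + i)) (\<pi> j) (\<pi> (?r + i))"
    using D(6)
  proof
    assume *: "?r = ?l + D \<and> n = ?r + D"
    show ?thesis
      by (rule not_between_doubled[OF \<pi> consistent_z_digit[OF \<pi>], of ?l ?r D]) (use * D iD j in auto)
  next
    assume *: "?l = ?r + D \<and> n = ?l + D"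
    have "\<not> between (\<pi> (?r + i)) (\<pi> j) (\<pi> (?l + i))"
      by (rule not_between_doubled[OF \<pi> consistent_z_digit[OF \<pi>], of ?r ?l D]) (use * D iD j in auto)
    then show ?thesis unfolding between_def by auto
  qed
  define lo up where "lo = (if even i then ?l + i else ?r + i)" and "up = (if even i then ?r + i else ?l + i)"
  have r: "lo \<in> {1..<n}" "up \<in> {1..<n}" unfolding lo_def up_def using D iD by auto
  have less: "\<pi> lo < \<pi> up" using collapsed_orientation[OF col i] unfolding lo_def up_def by (auto split: if_splits)
  have ne': "w lo \<noteq> w up" "?z lo = ?z up" using ne D(7)[OF iD] unfolding lo_def up_def by (auto split: if_splits)
  have nb': "\<pi> j \<le> \<pi> lo \<or> \<pi> up \<le> \<pi> j" using nb less unfolding between_def lo_def up_def by (auto split: if_splits)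
  have "w lo \<le> w up" using consistent_mono[OF w r _ \<pi>] less by simp
  then have lu: "w lo = ?z lo" "w up = ?z up + 1"
    using ne' consistent_excess(2)[OF \<pi> w r(1) r(1)] le[OF r(2)] by auto
  have sh: "z_shift n \<pi> i j = ?z j + of_bool (\<pi> up \<le> \<pi> j)"
    unfolding z_shift_eq up_def by auto
  show ?thesis
  proof (cases "\<pi> up \<le> \<pi> j")
    case True
    then show ?thesis using sh consistent_excess(1)[OF \<pi> w r(2) j] lu le[OF j] by simp
  next
    case False
    then have "\<pi> j \<le> \<pi> lo" using nb' by simp
    then show ?thesis using sh False consistent_excess(1)[OF \<pi> w j r(1)] consistent_excess(2)[OF \<pi> w j j] lu by simp
  qed
qed

section \<open>The sequence attached to a permutation\<close>

lemma finite_alt_Min: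
  assumes "finite S" "S \<noteq> {}"
  shows "alt_Min S \<in> S" "t \<in> S \<Longrightarrow> alt_le (alt_Min S) t"
proof -
  have "\<exists>s\<in>S. \<forall>t\<in>S. alt_le s t"
    using assms
  proof (induction rule: finite_ne_induct)
    case (insert x F)
    then obtain s where s: "s \<in> F" "\<forall>t\<in>F. alt_le s t" by blast
    show ?case
    proof (cases "alt_le s x")
      case False
      then have "alt_le x s" using not_alt_le alt_less_imp_le by blast
      then show ?thesis using s alt_le_trans by (intro bexI[of _ x]) auto
    qed (use s in auto)
  qed auto
  then obtain s where "s \<in> S \<and> (\<forall>t\<in>S. alt_le s t)" by blast
  then have "alt_Min S \<in> S \<and> (\<forall>t\<in>S. alt_le (alt_Min S) t)"
    unfolding alt_Min_def by (rule theI) (use \<open>s \<in> S \<and> (\<forall>t\<in>S. alt_le s t)\<close> alt_le_antisym in blast)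
  then show "alt_Min S \<in> S" "t \<in> S \<Longrightarrow> alt_le (alt_Min S) t" by auto
qed

text \<open>To get the least sequence, the tail must be as small as possible when the prefix has
  even length and as large as possible when it has odd length. The periods at the left and right
  neighbours of \<open>n\<close> are these extremes.\<close>

definition q_pos :: nat where
  "q_pos = (if even (n - m_pos n \<pi>) then l_pos n \<pi> else r_pos n \<pi>)"

definition candidate :: "(nat \<Rightarrow> nat) \<Rightarrow> nat stream" where
  "candidate \<zeta> = subword \<zeta> (m_pos n \<pi>) n @- cycle (subword \<zeta> q_pos n)"

lemma a_seq_cases:
  obtains "even (n - m_pos n \<pi>)" "\<pi> n = 1" "a_seq n \<pi> = cycle (subword (z_digit n \<pi>) (m_pos n \<pi>) n @ [0])"
  | "\<pi> n \<noteq> 1 \<or> odd (n - m_pos n \<pi>)" "\<not> collapsed n \<pi>" "a_seq n \<pi> = candidate (z_digit n \<pi>)"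
  | "collapsed n \<pi>" "a_seq n \<pi> = alt_Min {candidate (z_shift n \<pi> i) |i. int i < \<bar>int (r_pos n \<pi>) - int (l_pos n \<pi>)\<bar>}"
  unfolding a_seq_def Let_def candidate_def q_pos_def
  using that[unfolded candidate_def q_pos_def]
  by (cases "even (n - m_pos n \<pi>)"; cases "collapsed n \<pi>"; cases "\<pi> n = 1") (auto simp: collapsed_def)

lemma a_seq_collapsed:
  assumes "collapsed n \<pi>"
  shows "\<exists>i. int i < \<bar>int (r_pos n \<pi>) - int (l_pos n \<pi>)\<bar> \<and> a_seq n \<pi> = candidate (z_shift n \<pi> i)"
    and "int i < \<bar>int (r_pos n \<pi>) - int (l_pos n \<pi>)\<bar> \<Longrightarrow> alt_le (a_seq n \<pi>) (candidate (z_shift n \<pi> i))"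
proof -
  let ?I = "{i. int i < \<bar>int (r_pos n \<pi>) - int (l_pos n \<pi>)\<bar>}"
  let ?S = "{candidate (z_shift n \<pi> i) |i. int i < \<bar>int (r_pos n \<pi>) - int (l_pos n \<pi>)\<bar>}"
  have S: "?S = (\<lambda>i. candidate (z_shift n \<pi> i)) ` ?I" by auto
  obtain D where "D > 0" "?I = {..<D}" using collapsed_cases[OF assms] by metis
  then have "finite ?S" "?S \<noteq> {}" unfolding S by auto
  moreover have "a_seq n \<pi> = alt_Min ?S"
    by (rule a_seq_cases) (use assms in \<open>auto simp: collapsed_def\<close>)
  ultimately show "\<exists>i. int i < \<bar>int (r_pos n \<pi>) - int (l_pos n \<pi>)\<bar> \<and> a_seq n \<pi> = candidate (z_shift n \<pi> i)"
    and "int i < \<bar>int (r_pos n \<pi>) - int (l_pos n \<pi>)\<bar> \<Longrightarrow> alt_le (a_seq n \<pi>) (candidate (z_shift n \<pi> i))"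
    using finite_alt_Min[of ?S] by auto
qed

lemma q_pos:
  assumes "\<pi> n \<noteq> 1 \<or> odd (n - m_pos n \<pi>)"
  shows "q_pos \<in> {1..<n}" "\<pi> q_pos + 1 = \<pi> n \<or> \<pi> n + 1 = \<pi> q_pos"
proof -
  show "q_pos \<in> {1..<n}" "\<pi> q_pos + 1 = \<pi> n \<or> \<pi> n + 1 = \<pi> q_pos"
    using l_pos r_pos assms odd_imp_not_last unfolding q_pos_def by (auto split: if_splits)
qed

lemma tail_seq_candidate:
  "tail_seq n \<zeta> (cycle (subword \<zeta> q_pos n)) (m_pos n \<pi>) = candidate \<zeta>"
  unfolding tail_seq_def candidate_def ..

text \<open>A tie on the far side of \<open>n\<close> would, by order, include the neighbour on that
  side. Both neighbours would then carry the sequence \<open>y\<close>, and prepending their words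
  to \<open>y\<close> in either order gives \<open>y\<close>, so the words commute.\<close>

lemma strict_of_not_commuting:
  assumes \<zeta>: "consistent n \<pi> \<zeta>" and q: "\<pi> n \<noteq> 1 \<or> odd (n - m_pos n \<pi>)"
    and nc: "\<pi> n \<noteq> 1 \<Longrightarrow> \<pi> n \<noteq> n \<Longrightarrow> subword \<zeta> (l_pos n \<pi>) n @ subword \<zeta> (r_pos n \<pi>) n \<noteq>
      subword \<zeta> (r_pos n \<pi>) n @ subword \<zeta> (l_pos n \<pi>) n"
  defines "y \<equiv> cycle (subword \<zeta> q_pos n)"
  shows "(\<forall>j\<in>{1..<n}. \<pi> n < \<pi> j \<longrightarrow> tail_seq n \<zeta> y j \<noteq> y) \<or>
      (\<forall>j\<in>{1..<n}. \<pi> j < \<pi> n \<longrightarrow> tail_seq n \<zeta> y j \<noteq> y)"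
proof -
  let ?s = "tail_seq n \<zeta> y" and ?l = "l_pos n \<pi>" and ?r = "r_pos n \<pi>"
  have comp: "compatible n \<pi> ?s" unfolding y_def by (rule compatible_cycle[OF \<pi> \<zeta> q_pos[OF q]])
  have le: "alt_le (?s j) (?s k)" if "j \<in> {1..n}" "k \<in> {1..n}" "\<pi> j \<le> \<pi> k" for j k
    using comp that unfolding compatible_def by blast
  have "?s q_pos = y" unfolding y_def by (rule tail_seq_cycle) (use q_pos[OF q] in simp)
  then have sq: "q_pos = ?l \<Longrightarrow> ?s ?l = y" "q_pos = ?r \<Longrightarrow> ?s ?r = y" by auto
  have ne: False if c: "\<pi> n \<noteq> 1" "\<pi> n \<noteq> n" and e: "?s ?l = y" "?s ?r = y"
  proof -
    have "(subword \<zeta> ?l n @ subword \<zeta> ?r n) @- y = (subword \<zeta> ?r n @ subword \<zeta> ?l n) @- y"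
      using e unfolding tail_seq_def by simp
    then show False using stake_shift_same[of "subword \<zeta> ?l n @ subword \<zeta> ?r n"] nc[OF c] by fastforce
  qed
  show ?thesis
  proof (cases "even (n - m_pos n \<pi>)")
    case True
    then have c: "\<pi> n \<noteq> 1" "q_pos = ?l" using q unfolding q_pos_def by auto
    have "?s j \<noteq> y" if j: "j \<in> {1..<n}" "\<pi> n < \<pi> j" for j
    proof
      assume *: "?s j = y"
      have c': "\<pi> n \<noteq> n" using j perm_range[OF \<pi>, of j] by auto
      have "alt_le (?s n) (?s ?r)" "alt_le (?s ?r) (?s j)"
        using le[of n ?r] le[of ?r j] j r_pos[OF c'] n by auto
      then have "?s ?r = y" using * alt_le_antisym by simp
      then show False using ne[OF c(1) c'] sq c by blast
    qed
    then show ?thesis by blast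
  next
    case False
    then have c: "\<pi> n \<noteq> n" "q_pos = ?r" using odd_imp_not_last unfolding q_pos_def by auto
    have "?s j \<noteq> y" if j: "j \<in> {1..<n}" "\<pi> j < \<pi> n" for j
    proof
      assume *: "?s j = y"
      have c': "\<pi> n \<noteq> 1" using j perm_range[OF \<pi>, of j] by auto
      have "alt_le (?s ?l) (?s n)" "alt_le (?s j) (?s ?l)"
        using le[of ?l n] le[of j ?l] j l_pos[OF c'] n by auto
      then have "?s ?l = y" using * alt_le_antisym by simp
      then show False using ne[OF c' c(1)] sq c by blast
    qed
    then show ?thesis by blast
  qed
qed

lemma eventually_periodic_cycle: "q \<noteq> [] \<Longrightarrow> eventually_periodic (p @- cycle q)"
  unfolding eventually_periodic_def by blast

lemma a_seq_realizable:
  obtains \<zeta> y where "consistent n \<pi> \<zeta>" "compatible n \<pi> (tail_seq n \<zeta> y)"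
    "a_seq n \<pi> = tail_seq n \<zeta> y (m_pos n \<pi>)" "eventually_periodic (a_seq n \<pi>)"
    "(\<forall>j\<in>{1..<n}. \<pi> n < \<pi> j \<longrightarrow> tail_seq n \<zeta> y j \<noteq> y) \<or>
      (\<forall>j\<in>{1..<n}. \<pi> j < \<pi> n \<longrightarrow> tail_seq n \<zeta> y j \<noteq> y)"
proof -
  note goal = that
  have cand: thesis if \<zeta>: "consistent n \<pi> \<zeta>" and q: "\<pi> n \<noteq> 1 \<or> odd (n - m_pos n \<pi>)"
    and nc: "\<pi> n \<noteq> 1 \<Longrightarrow> \<pi> n \<noteq> n \<Longrightarrow> subword \<zeta> (l_pos n \<pi>) n @ subword \<zeta> (r_pos n \<pi>) n \<noteq>
      subword \<zeta> (r_pos n \<pi>) n @ subword \<zeta> (l_pos n \<pi>) n"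
    and a: "a_seq n \<pi> = candidate \<zeta>" for \<zeta>
  proof (rule goal[OF \<zeta>, of "cycle (subword \<zeta> q_pos n)"])
    show "compatible n \<pi> (tail_seq n \<zeta> (cycle (subword \<zeta> q_pos n)))"
      by (rule compatible_cycle[OF \<pi> \<zeta> q_pos[OF q]])
    have "subword \<zeta> q_pos n \<noteq> []" using q_pos(1)[OF q] by (simp add: subword_Cons)
    then show "eventually_periodic (a_seq n \<pi>)"
      unfolding a candidate_def by (rule eventually_periodic_cycle)
  next
    show "a_seq n \<pi> = tail_seq n \<zeta> (cycle (subword \<zeta> q_pos n)) (m_pos n \<pi>)"
      using a tail_seq_candidate by simp
  qed (rule strict_of_not_commuting[OF \<zeta> q nc])
  show thesis
  proof (rule a_seq_cases)
    assume *: "\<pi> n = 1" "a_seq n \<pi> = cycle (subword (z_digit n \<pi>) (m_pos n \<pi>) n @ [0])"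
    let ?y = "0 ## cycle (subword (z_digit n \<pi>) (m_pos n \<pi>) n @ [0])"
    show thesis
    proof (rule that[OF consistent_z_digit[OF \<pi>], of ?y])
      show "compatible n \<pi> (tail_seq n (z_digit n \<pi>) ?y)"
        "a_seq n \<pi> = tail_seq n (z_digit n \<pi>) ?y (m_pos n \<pi>)"
        using compatible_zero[OF \<pi> consistent_z_digit[OF \<pi>] m_pos *(1)] *(2) by auto
      show "eventually_periodic (a_seq n \<pi>)"
        unfolding *(2) using eventually_periodic_cycle[of "subword (z_digit n \<pi>) (m_pos n \<pi>) n @ [0]" "[]"] by simp
      have "\<not> \<pi> j < \<pi> n" if "j \<in> {1..<n}" for j
        using perm_range[OF \<pi>, of j] that *(1) by auto
      then show "(\<forall>j\<in>{1..<n}. \<pi> n < \<pi> j \<longrightarrow> tail_seq n (z_digit n \<pi>) ?y j \<noteq> ?y) \<or>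
          (\<forall>j\<in>{1..<n}. \<pi> j < \<pi> n \<longrightarrow> tail_seq n (z_digit n \<pi>) ?y j \<noteq> ?y)" by blast
    qed
  next
    assume *: "\<pi> n \<noteq> 1 \<or> odd (n - m_pos n \<pi>)" "\<not> collapsed n \<pi>" "a_seq n \<pi> = candidate (z_digit n \<pi>)"
    show thesis
    proof (rule cand[OF consistent_z_digit[OF \<pi>] *(1) _ *(3)])
      assume c: "\<pi> n \<noteq> 1" "\<pi> n \<noteq> n"
      show "subword (z_digit n \<pi>) (l_pos n \<pi>) n @ subword (z_digit n \<pi>) (r_pos n \<pi>) n \<noteq>
        subword (z_digit n \<pi>) (r_pos n \<pi>) n @ subword (z_digit n \<pi>) (l_pos n \<pi>) n"
        using commuting_subwords[OF \<pi> consistent_z_digit[OF \<pi>] l_pos[OF c(1)] r_pos[OF c(2)]] *(2) c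
        unfolding collapsed_def Let_def by blast
    qed
  next
    assume col: "collapsed n \<pi>"
    obtain i where i: "int i < \<bar>int (r_pos n \<pi>) - int (l_pos n \<pi>)\<bar>" "a_seq n \<pi> = candidate (z_shift n \<pi> i)"
      using a_seq_collapsed(1)[OF col] by blast
    let ?x = "subword (z_shift n \<pi> i) (l_pos n \<pi>) n" and ?y = "subword (z_shift n \<pi> i) (r_pos n \<pi>) n"
    show thesis
    proof (rule cand[OF consistent_z_shift _ _ i(2)])
      show "\<pi> n \<noteq> 1 \<or> odd (n - m_pos n \<pi>)" using col unfolding collapsed_def by auto
      show "?x @ ?y \<noteq> ?y @ ?x"
      proof (rule collapsed_cases[OF col])
        fix D
        assume D: "{i. int i < \<bar>int (r_pos n \<pi>) - int (l_pos n \<pi>)\<bar>} = {..<D}"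
          "r_pos n \<pi> = l_pos n \<pi> + D \<and> n = r_pos n \<pi> + D \<or> l_pos n \<pi> = r_pos n \<pi> + D \<and> n = l_pos n \<pi> + D"
        have "i < D" using i(1) D(1) by blast
        then have l: "i < n - l_pos n \<pi>" "i < n - r_pos n \<pi>" using D(2) by auto
        \<comment> \<open>Index \<open>i\<close> falls into the first factor on both sides, where
          the shifted digits were made different.\<close>
        then have "(?x @ ?y) ! i \<noteq> (?y @ ?x) ! i"
          using z_shift_separates[OF col i(1)] by (simp add: nth_append nth_subword)
        then show ?thesis by metis
      qed
    qed
  qed
qed

section \<open>Digit sequences of realizing points\<close>

lemma consistent_of_stream:
  assumes ord: "\<And>i j. i \<in> {1..n} \<Longrightarrow> j \<in> {1..n} \<Longrightarrow> \<pi> i < \<pi> j \<longleftrightarrow> alt_less (sdrop (i - 1) w) (sdrop (j - 1) w)"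
  shows "consistent n \<pi> (\<lambda>j. w !! (j - 1))"
  unfolding consistent_def
proof (intro ballI impI)
  fix j k assume jk: "j \<in> {1..<n}" "k \<in> {1..<n}" "\<pi> j < \<pi> k"
  have s: "sdrop (i - 1) w = w !! (i - 1) ## sdrop i w" if "i \<in> {1..<n}" for i
  proof -
    have "i = Suc (i - 1)" using that by simp
    then show ?thesis by (metis sdrop_simps stream.collapse)
  qed
  have "alt_less (w !! (j - 1) ## sdrop j w) (w !! (k - 1) ## sdrop k w)"
    using ord[of j k] jk s[OF jk(1)] s[OF jk(2)] by simp
  moreover have "\<pi> (k + 1) < \<pi> (j + 1) \<longleftrightarrow> alt_less (sdrop k w) (sdrop j w)"
    using ord[of "k + 1" "j + 1"] jk by simp
  ultimately show "w !! (j - 1) < w !! (k - 1) \<or> w !! (j - 1) = w !! (k - 1) \<and> \<pi> (k + 1) < \<pi> (j + 1)"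
    by (simp add: alt_less_Stream)
qed

lemma tail_seq_stream:
  assumes "j \<in> {1..n}"
  shows "tail_seq n (\<lambda>j. w !! (j - 1)) (sdrop (n - 1) w) j = sdrop (j - 1) w"
proof -
  have "subword (\<lambda>j. w !! (j - 1)) j n = stake (n - j) (sdrop (j - 1) w)"
    by (rule nth_equalityI) (use assms in \<open>auto simp: nth_subword sdrop_snth\<close>)
  moreover have "sdrop (n - 1) w = sdrop (n - j) (sdrop (j - 1) w)" using assms by (simp add: sdrop_add)
  ultimately show ?thesis unfolding tail_seq_def by (simp only: stake_sdrop)
qed

text \<open>For \<open>\<pi> n = 1\<close> the sequence \<open>a\<close> need not be below the largest of the first \<open>n\<close> shifts,
  but then it is below the next one.\<close>

lemma a_seq_lower_bound:
  assumes ord: "\<And>i j. i \<in> {1..n} \<Longrightarrow> j \<in> {1..n} \<Longrightarrow> \<pi> i < \<pi> j \<longleftrightarrow> alt_less (sdrop (i - 1) w) (sdrop (j - 1) w)"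
  shows "alt_le (a_seq n \<pi>) (sdrop (m_pos n \<pi> - 1) w) \<or>
    w !! (n - 1) = 0 \<and> alt_le (a_seq n \<pi>) (sdrop n w)"
proof -
  define \<omega> where "\<omega> j = w !! (j - 1)" for j
  define s where "s = sdrop (n - 1) w"
  let ?z = "z_digit n \<pi>" and ?m = "m_pos n \<pi>" and ?l = "l_pos n \<pi>" and ?r = "r_pos n \<pi>"
  have \<omega>: "consistent n \<pi> \<omega>" unfolding \<omega>_def[abs_def] using ord by (rule consistent_of_stream)
  have tail: "tail_seq n \<omega> s j = sdrop (j - 1) w" if "j \<in> {1..n}" for j
    unfolding \<omega>_def[abs_def] s_def using that by (rule tail_seq_stream)
  have tl: "alt_less (tail_seq n \<omega> s i) (tail_seq n \<omega> s j)" if "i \<in> {1..n}" "j \<in> {1..n}" "\<pi> i < \<pi> j" for i j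
    using ord[of i j] that tail by simp
  have n1: "n \<in> {1..n}" using n by simp
  have sl: "alt_less (subword \<omega> ?l n @- s) s" "?l \<in> {1..<n}" if "\<pi> n \<noteq> 1"
    using tl[of ?l n] l_pos[OF that] n1 unfolding tail_seq_def by auto
  have sr: "alt_less s (subword \<omega> ?r n @- s)" "?r \<in> {1..<n}" if "\<pi> n \<noteq> n"
    using tl[of n ?r] r_pos[OF that] n1 unfolding tail_seq_def by auto
  have nonempty: "subword \<omega> j n \<noteq> []" if "j \<in> {1..<n}" for j using that by (simp add: subword_Cons)
  have wm: "sdrop (?m - 1) w = subword \<omega> ?m n @- s"
    using tail[OF m_pos(1)] unfolding tail_seq_def by simp
  \<comment> \<open>The tail \<open>s\<close> lies between the sequences of the neighbours of
    \<open>n\<close>, so the comparison lemmas put it between the two periodic sequences. The parity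
    of \<open>n - ?m\<close> selects the bound that becomes a lower one after prepending.\<close>
  have key: "alt_le (candidate \<zeta>) (sdrop (?m - 1) w)"
    if q: "\<pi> n \<noteq> 1 \<or> odd (n - ?m)" and eq: "\<And>j. j \<in> {1..<n} \<Longrightarrow> \<omega> j = \<zeta> j" for \<zeta>
  proof -
    have sw: "subword \<zeta> j n = subword \<omega> j n" if "1 \<le> j" for j
      unfolding subword_def using eq that by auto
    have c: "candidate \<zeta> = subword \<omega> ?m n @- cycle (subword \<omega> q_pos n)"
      unfolding candidate_def using sw[of ?m] sw[of q_pos] m_pos(1) q_pos(1)[OF q] by simp
    have ne: "odd (n - ?m) \<Longrightarrow> \<pi> n \<noteq> n" by (rule odd_imp_not_last)
    show ?thesis
      unfolding c wm alt_le_shift length_subword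
      using cycle_le_of_shift_le[OF nonempty[OF sl(2)] alt_less_imp_le[OF sl(1)]]
        le_cycle_of_le_shift[OF nonempty[OF sr(2)] alt_less_imp_le[OF sr(1)]] q ne
      unfolding q_pos_def by (auto split: if_splits)
  qed
  have big: "alt_le (subword \<zeta> ?m n @- y) (sdrop (?m - 1) w)" if "?m < n" "\<zeta> ?m < \<omega> ?m" for \<zeta> y
    unfolding wm using that by (simp add: subword_Cons alt_le_Stream)
  \<comment> \<open>The excess over \<open>?z\<close> is largest at the maximal position, so any
    deviation from \<open>?z\<close> already shows in the first letter there.\<close>
  have excess_m: "\<omega> j + ?z ?m \<le> \<omega> ?m + ?z j" if "j \<in> {1..<n}" "?m < n" for j
    by (rule consistent_excess(1)[OF \<pi> \<omega>]) (use that m_pos perm_le_m in auto)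
  have ge: "?z j \<le> \<omega> j" if "j \<in> {1..<n}" for j
    using consistent_excess(2)[OF \<pi> \<omega> that that] by simp
  show ?thesis
  proof (rule a_seq_cases)
    assume *: "even (n - ?m)" "\<pi> n = 1" "a_seq n \<pi> = cycle (subword ?z ?m n @ [0])"
    show ?thesis
    proof (cases "\<forall>j\<in>{1..<n}. \<omega> j = ?z j")
      case True
      have sw: "subword ?z ?m n = subword \<omega> ?m n"
        unfolding subword_def using True m_pos(1) by auto
      have a: "a_seq n \<pi> = subword \<omega> ?m n @- (0 ## a_seq n \<pi>)"
        using cycle_eq_shift[of "subword ?z ?m n @ [0]"] unfolding *(3) sw by simp
      show ?thesis
      proof (cases "alt_le (0 ## a_seq n \<pi>) s")
        case True
        then have "alt_le (a_seq n \<pi>) (sdrop (?m - 1) w)"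
          unfolding wm using *(1) by (subst a) (simp add: alt_le_shift)
        then show ?thesis by blast
      next
        case False
        then have "alt_less s (0 ## a_seq n \<pi>)" by (simp add: not_alt_le)
        moreover have "s = w !! (n - 1) ## sdrop n w"
          unfolding s_def using n by (metis Suc_diff_1 sdrop_simps stream.collapse less_le_trans zero_less_one)
        ultimately have "w !! (n - 1) = 0 \<and> alt_le (a_seq n \<pi>) (sdrop n w)"
          by (simp add: alt_less_Stream alt_less_imp_le)
        then show ?thesis by blast
      qed
    next
      case False
      then obtain j where j: "j \<in> {1..<n}" "\<omega> j \<noteq> ?z j" by blast
      have "?m \<noteq> n" using j *(2) m_pos(2) by auto
      then have mn: "?m < n" using m_pos(1) by auto
      then have "?z ?m < \<omega> ?m" using excess_m[OF j(1) mn] ge[OF j(1)] j(2) by simp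
      from big[where \<zeta> = ?z, OF mn this] show ?thesis
        using cycle_eq_shift[of "subword ?z ?m n @ [0]"] unfolding *(3)
        by (metis append_is_Nil_conv not_Cons_self2 shift_append)
    qed
  next
    assume *: "\<pi> n \<noteq> 1 \<or> odd (n - ?m)" "a_seq n \<pi> = candidate ?z"
    show ?thesis
    proof (cases "\<forall>j\<in>{1..<n}. \<omega> j = ?z j")
      case True
      then show ?thesis using key[OF *(1), of ?z] *(2) by simp
    next
      case False
      then obtain j where j: "j \<in> {1..<n}" "\<omega> j \<noteq> ?z j" by blast
      show ?thesis
      proof (cases "?m < n")
        case True
        then have "?z ?m < \<omega> ?m" using excess_m[OF j(1) True] ge[OF j(1)] j(2) by simp
        from big[where \<zeta> = ?z, OF True this] show ?thesis unfolding *(2) candidate_def by blast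
      next
        case False
        \<comment> \<open>Now the maximal position is \<open>n\<close>, which has no digit to
          compare. The excess is largest at \<open>?l\<close>, of rank \<open>n - 1\<close>, and the
          first letter of \<open>s\<close> is at least that digit.\<close>
        then have mn: "?m = n" using m_pos(1) by auto
        then have c: "\<pi> n = n" "\<pi> n \<noteq> 1" "q_pos = ?l" using m_pos(2) *(1) unfolding q_pos_def by auto
        have "\<pi> j \<noteq> \<pi> n" "\<pi> j \<le> n" using j perm_eq[OF \<pi>] perm_range[OF \<pi>, of j] by auto
        then have "\<pi> j \<le> \<pi> ?l" using l_pos(2)[OF c(2)] c(1) by linarith
        then have "?z ?l < \<omega> ?l"
          using consistent_excess(1)[OF \<pi> \<omega> j(1) sl(2)[OF c(2)]] ge[OF j(1)] j(2) by simp
        moreover have "\<omega> ?l \<le> shd s"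
          using alt_le_shd[OF alt_less_imp_le[OF sl(1)[OF c(2)]]] sl(2)[OF c(2)] by (simp add: subword_Cons)
        moreover have "shd (cycle (subword ?z ?l n)) = ?z ?l"
          using sl(2)[OF c(2)] by (simp add: subword_Cons)
        ultimately have "shd (candidate ?z) < shd s"
          unfolding candidate_def c(3) mn by simp
        then have "alt_le (candidate ?z) s"
          using not_alt_le alt_le_shd[OF alt_less_imp_le] by (metis not_le)
        then show ?thesis using *(2) wm mn by simp
      qed
    qed
  next
    assume col: "collapsed n \<pi>"
    then have c: "\<pi> n \<noteq> 1" "\<pi> n \<noteq> n" unfolding collapsed_def by auto
    then have mn: "?m < n" using m_pos by (metis atLeastAtMost_iff order_le_less)
    note sl = sl[OF c(1)] and sr = sr[OF c(2)]
    \<comment> \<open>With no separation, one of the neighbour words of \<open>\<omega>\<close> is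
      the square of the other. Both then have the same periodic sequence, which bounds
      \<open>s\<close> from below and above, so \<open>s\<close> would equal the sequence of its
      left neighbour.\<close>
    have sep: "\<exists>i. int i < \<bar>int ?r - int ?l\<bar> \<and> \<omega> (?l + i) \<noteq> \<omega> (?r + i)"
    proof (rule ccontr)
      assume "\<not> ?thesis"
      then have same: "\<omega> (?l + i) = \<omega> (?r + i)" if "int i < \<bar>int ?r - int ?l\<bar>" for i using that by blast
      have no: False if v: "v \<noteq> []" "cycle v = cycle (subword \<omega> ?l n)" "cycle v = cycle (subword \<omega> ?r n)" for v
      proof -
        have "alt_le (cycle v) s" unfolding v(2)
          by (rule cycle_le_of_shift_le[OF nonempty[OF sl(2)] alt_less_imp_le[OF sl(1)]])
        moreover have "alt_le s (cycle v)" unfolding v(3)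
          by (rule le_cycle_of_le_shift[OF nonempty[OF sr(2)] alt_less_imp_le[OF sr(1)]])
        ultimately have "s = cycle (subword \<omega> ?l n)" using v alt_le_antisym by metis
        then have "subword \<omega> ?l n @- s = s" using cycle_eq_shift[OF nonempty[OF sl(2)]] by simp
        then show False using sl(1) by simp
      qed
      have dbl: "cycle (v @ v) = cycle v" if "v \<noteq> []" for v :: "nat list"
        using shift_eq_imp_cycle[of "v @ v" "cycle v"] cycle_eq_shift[OF that] that by simp
      show False
      proof (rule collapsed_cases[OF col])
        fix D
        assume D: "{i. int i < \<bar>int ?r - int ?l\<bar>} = {..<D}"
          "?r = ?l + D \<and> n = ?r + D \<or> ?l = ?r + D \<and> n = ?l + D"
        have same': "\<omega> (?l + i) = \<omega> (?r + i)" if "i < D" for i using same that D(1) by blast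
        from D(2) show False
        proof
          assume e: "?r = ?l + D \<and> n = ?r + D"
          have len: "n - ?r = D" "n - ?l = D + D" using e by linarith+
          have "subword \<omega> ?l n = subword \<omega> ?r n @ subword \<omega> ?r n"
          proof (rule nth_equalityI)
            fix i assume "i < length (subword \<omega> ?l n)"
            then have i: "i < D + D" using len by simp
            show "subword \<omega> ?l n ! i = (subword \<omega> ?r n @ subword \<omega> ?r n) ! i"
            proof (cases "i < D")
              case True
              then show ?thesis using len i same'[of i] by (simp add: nth_append nth_subword)
            next
              case False
              have "?l + i = ?r + (i - D)" using False e by linarith
              then show ?thesis using len i False by (simp add: nth_append nth_subword)
            qed
          qed (use len in simp)
          then have "cycle (subword \<omega> ?r n) = cycle (subword \<omega> ?l n)"
            using dbl[OF nonempty[OF sr(2)]] by (simp only:)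
          then show False using no[OF nonempty[OF sr(2)] _ refl] by blast
        next
          assume e: "?l = ?r + D \<and> n = ?l + D"
          have len: "n - ?l = D" "n - ?r = D + D" using e by linarith+
          have "subword \<omega> ?r n = subword \<omega> ?l n @ subword \<omega> ?l n"
          proof (rule nth_equalityI)
            fix i assume "i < length (subword \<omega> ?r n)"
            then have i: "i < D + D" using len by simp
            show "subword \<omega> ?r n ! i = (subword \<omega> ?l n @ subword \<omega> ?l n) ! i"
            proof (cases "i < D")
              case True
              then show ?thesis using len i same'[of i] by (simp add: nth_append nth_subword)
            next
              case False
              have "?r + i = ?l + (i - D)" using False e by linarith
              then show ?thesis using len i False by (simp add: nth_append nth_subword)
            qed
          qed (use len in simp)
          then have "cycle (subword \<omega> ?l n) = cycle (subword \<omega> ?r n)"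
            using dbl[OF nonempty[OF sl(2)]] by (simp only:)
          then show False by (rule no[OF nonempty[OF sl(2)] refl])
        qed
      qed
    qed
    then obtain i where i: "int i < \<bar>int ?r - int ?l\<bar>" "\<omega> (?l + i) \<noteq> \<omega> (?r + i)" by blast
    have "alt_le (candidate (z_shift n \<pi> i)) (sdrop (?m - 1) w)"
    \<comment> \<open>An excess of at most 1 at the maximum bounds it everywhere and determines the
      digits. A larger excess already beats \<open>z_shift\<close>, whose excess there is exactly
      1.\<close>
    proof (cases "\<omega> ?m \<le> ?z ?m + 1")
      case True
      have "\<omega> j \<le> ?z j + 1" if "j \<in> {1..<n}" for j using excess_m[OF that mn] True by simp
      from eq_z_shift[OF col i(1) \<omega> this i(2)] show ?thesis using c(1) by (intro key) auto
    next
      case False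
      then have "z_shift n \<pi> i ?m < \<omega> ?m" using z_shift_m[OF col i(1)] by simp
      from big[where \<zeta> = "z_shift n \<pi> i", OF mn this] show ?thesis unfolding candidate_def .
    qed
    then show ?thesis using a_seq_collapsed(2)[OF col i(1)] alt_le_trans by blast
  qed
qed

text \<open>The pattern consists of finitely many strict inequalities and survives a small
  displacement. Only the point at 1 is constrained, and it can be moved down. The strict bound is
  what later yields \<open>val \<beta> a < 1\<close>.\<close>

lemma pattern_avoiding_1:
  assumes \<beta>: "\<beta> > 1" and "(n, \<pi>) \<in> patterns {0<..1} (T_neg \<beta>)"
  shows "\<exists>x. 0 < x \<and> x \<le> 1 \<and> is_Pat x (T_neg \<beta>) n \<pi> \<and> (T_neg \<beta> ^^ (m_pos n \<pi> - 1)) x < 1"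
proof -
  let ?m = "m_pos n \<pi>"
  obtain x where x: "0 < x" "x \<le> 1" "is_Pat x (T_neg \<beta>) n \<pi>" using assms(2) unfolding patterns_def by auto
  define X where "X j = (T_neg \<beta> ^^ (j - 1)) x" for j
  have X: "0 < X j" "X j \<le> 1" for j using T_neg_power_range[OF x(1,2)] unfolding X_def by auto
  have iff: "\<pi> i < \<pi> j \<longleftrightarrow> X i < X j" if "i \<in> {1..n}" "j \<in> {1..n}" for i j
    using x(3) that unfolding is_Pat_def X_def by blast
  show ?thesis
  proof (cases "X ?m < 1")
    case True
    then show ?thesis using x unfolding X_def by blast
  next
    case False
    then have Xm: "X ?m = 1" using X[of ?m] by simp
    define \<zeta> where "\<zeta> j = nat \<lfloor>\<beta> * X j\<rfloor>" for j
    have \<zeta>: "consistent n \<pi> \<zeta>"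
    proof -
      have "consistent n \<pi> (\<lambda>j. expansion \<beta> x !! (j - 1))"
      proof (rule consistent_of_stream)
        fix i j assume ij: "i \<in> {1..n}" "j \<in> {1..n}"
        show "\<pi> i < \<pi> j \<longleftrightarrow> alt_less (sdrop (i - 1) (expansion \<beta> x)) (sdrop (j - 1) (expansion \<beta> x))"
          unfolding sdrop_expansion iff[OF ij] X_def[symmetric] using expansion_less_iff[OF \<beta> X X] by simp
      qed
      then show ?thesis unfolding \<zeta>_def[abs_def] X_def by simp
    qed
    \<comment> \<open>This sign cancels that of \<open>(- 1 / \<beta>) ^ (n - ?m)\<close>, so that
      the maximal point moves down.\<close>
    define \<sigma> :: real where "\<sigma> = - ((- 1) ^ (n - ?m))"
    define x' where "x' e j = X j + (- 1 / \<beta>) ^ (n - j) * (\<sigma> * e)" for e :: real and j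
    have lim: "((\<lambda>e. x' e j) \<longlongrightarrow> X j) (at_right 0)" for j
    proof -
      have "((\<lambda>e. x' e j) \<longlongrightarrow> X j + (- 1 / \<beta>) ^ (n - j) * (\<sigma> * 0)) (at_right 0)"
        unfolding x'_def by (intro tendsto_intros)
      then show ?thesis by simp
    qed
    have evlt: "\<forall>\<^sub>F e in at_right 0. x' e j < x' e k" if "X j < X k" for j k
    proof -
      have "((\<lambda>e. x' e k - x' e j) \<longlongrightarrow> X k - X j) (at_right 0)" by (intro tendsto_diff lim)
      from order_tendstoD(1)[OF this, of 0] that show ?thesis by simp
    qed
    have xm: "x' e ?m = 1 - (1 / \<beta>) ^ (n - ?m) * e" for e
    proof -
      have "(- 1 / \<beta>) ^ (n - ?m) * \<sigma> = - ((1 / \<beta>) ^ (n - ?m))"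
        unfolding \<sigma>_def by (cases "even (n - ?m)") (simp_all add: power_divide)
      then show ?thesis unfolding x'_def Xm mult.assoc[symmetric] by simp
    qed
    have pos: "\<forall>\<^sub>F e in at_right 0. (0::real) < e" by (simp add: eventually_at_filter)
    have "\<forall>\<^sub>F e in at_right 0. \<forall>j\<in>{1..n}. 0 < x' e j \<and> x' e j < 1"
    proof (intro eventually_ball_finite ballI eventually_conj)
      fix j assume j: "j \<in> {1..n}"
      show "\<forall>\<^sub>F e in at_right 0. 0 < x' e j" using X(1)[of j] by (rule order_tendstoD[OF lim])
      show "\<forall>\<^sub>F e in at_right 0. x' e j < 1"
      proof (cases "j = ?m")
        case True
        from pos show ?thesis unfolding True xm by eventually_elim (use \<beta> in simp)
      next
        case False
        then have "\<pi> j < \<pi> ?m" using perm_le_m[OF j] perm_eq[OF \<pi>, of j ?m] by simp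
        then have "X j < 1" using iff[OF j m_pos(1)] Xm by simp
        then show ?thesis by (rule order_tendstoD[OF lim])
      qed
    qed simp
    moreover have "\<forall>\<^sub>F e in at_right 0. \<forall>j\<in>{1..n}. \<forall>k\<in>{1..n}. \<pi> j < \<pi> k \<longrightarrow> x' e j < x' e k"
      using evlt iff by (intro eventually_ball_finite ballI) auto
    ultimately have "\<forall>\<^sub>F e in at_right 0. (\<forall>j\<in>{1..n}. 0 < x' e j \<and> x' e j < 1) \<and>
        (\<forall>j\<in>{1..n}. \<forall>k\<in>{1..n}. \<pi> j < \<pi> k \<longrightarrow> x' e j < x' e k)"
      by (rule eventually_conj)
    from eventually_happens'[OF trivial_limit_at_right_real this]
    obtain e where e: "\<forall>j\<in>{1..n}. 0 < x' e j \<and> x' e j < 1"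
        "\<forall>j\<in>{1..n}. \<forall>k\<in>{1..n}. \<pi> j < \<pi> k \<longrightarrow> x' e j < x' e k"
      by blast
    have rec: "x' e j = (real (\<zeta> j) + 1 - x' e (Suc j)) / \<beta>" if j: "j \<in> {1..<n}" for j
    proof -
      have s: "n - j = Suc (n - Suc j)" "j = Suc (j - 1)" using j by auto
      have "X (Suc j) = T_neg \<beta> (X j)" unfolding X_def by (subst s(2)) simp
      then have "\<beta> * X j = real (\<zeta> j) + 1 - X (Suc j)"
        using digit_eq[OF \<beta> X(1)[of j]] unfolding \<zeta>_def by simp
      then have "X j = (real (\<zeta> j) + 1 - X (Suc j)) / \<beta>" using \<beta> by (simp add: field_simps)
      then show ?thesis using \<beta> unfolding x'_def s(1) by (simp add: field_simps)
    qed
    have n1: "n \<in> {1..n}" "1 \<in> {1..n}" using n by auto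
    have "0 < x' e j \<and> x' e j \<le> 1" if "j \<in> {1..n}" for j using e(1) that less_imp_le by blast
    moreover have "x' e j < x' e n" if "j \<in> {1..<n}" "\<pi> j < \<pi> n" for j using e(2) that n1 by simp
    moreover have "x' e n < x' e j" if "j \<in> {1..<n}" "\<pi> n < \<pi> j" for j using e(2) that n1 by simp
    ultimately have R: "is_Pat (x' e 1) (T_neg \<beta>) n \<pi>"
        "\<And>i. i < n \<Longrightarrow> (T_neg \<beta> ^^ i) (x' e 1) = x' e (Suc i)"
      using realize_real[OF \<beta> n \<pi> \<zeta>, of "x' e"] rec by blast+
    have "(T_neg \<beta> ^^ (?m - 1)) (x' e 1) < 1" using R(2)[of "?m - 1"] e(1) m_pos(1) by auto
    moreover have "0 < x' e 1" "x' e 1 \<le> 1" using bspec[OF e(1) n1(2)] by linarith+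
    ultimately show ?thesis using R(1) by blast
  qed
qed

lemma adm_a_seq: "adm (a_seq n \<pi>) (a_seq n \<pi>)"
  by (rule a_seq_realizable) (use compatible_adm[OF \<pi> _ m_pos m_pos(1)] in metis)

lemma pattern_iff:
  assumes \<beta>: "\<beta> > 1"
  shows "(n, \<pi>) \<in> patterns {0<..1} (T_neg \<beta>) \<longleftrightarrow> b_num (a_seq n \<pi>) < \<beta>"
proof
  assume "(n, \<pi>) \<in> patterns {0<..1} (T_neg \<beta>)"
  then obtain x where x: "0 < x" "x \<le> 1" "is_Pat x (T_neg \<beta>) n \<pi>" "(T_neg \<beta> ^^ (m_pos n \<pi> - 1)) x < 1"
    using pattern_avoiding_1[OF \<beta>] by blast
  let ?X = "\<lambda>k. (T_neg \<beta> ^^ k) x"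
  note X = T_neg_power_range[OF x(1,2), of _ \<beta>]
  have "alt_le (a_seq n \<pi>) (sdrop (m_pos n \<pi> - 1) (expansion \<beta> x)) \<or>
    expansion \<beta> x !! (n - 1) = 0 \<and> alt_le (a_seq n \<pi>) (sdrop n (expansion \<beta> x))"
  proof (rule a_seq_lower_bound)
    fix i j assume ij: "i \<in> {1..n}" "j \<in> {1..n}"
    have "\<pi> i < \<pi> j \<longleftrightarrow> ?X (i - 1) < ?X (j - 1)" using x(3) ij unfolding is_Pat_def by blast
    then show "\<pi> i < \<pi> j \<longleftrightarrow> alt_less (sdrop (i - 1) (expansion \<beta> x)) (sdrop (j - 1) (expansion \<beta> x))"
      unfolding sdrop_expansion using expansion_less_iff[OF \<beta>] X by simp
  qed
  then have "\<exists>k. alt_le (a_seq n \<pi>) (expansion \<beta> (?X k)) \<and> ?X k < 1"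
  proof
    assume "alt_le (a_seq n \<pi>) (sdrop (m_pos n \<pi> - 1) (expansion \<beta> x))"
    then show ?thesis using x(4) unfolding sdrop_expansion by blast
  next
    \<comment> \<open>A digit 0 puts the next orbit point at
      \<open>1 - \<beta> * ?X (n - 1)\<close>, strictly below 1, so it can serve as the upper bound
      although it is not one of the first \<open>n\<close> points.\<close>
    assume *: "expansion \<beta> x !! (n - 1) = 0 \<and> alt_le (a_seq n \<pi>) (sdrop n (expansion \<beta> x))"
    have "n = Suc (n - 1)" using n by simp
    then have "?X n = T_neg \<beta> (?X (n - 1))" by (metis funpow.simps(2) o_apply)
    moreover have "real (nat \<lfloor>\<beta> * ?X (n - 1)\<rfloor>) = 0" using * by simp
    ultimately have "?X n = 1 - \<beta> * ?X (n - 1)" using digit_eq[OF \<beta>, of "?X (n - 1)"] X by simp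
    moreover have "\<beta> * ?X (n - 1) > 0" using \<beta> X[of "n - 1"] by simp
    ultimately show ?thesis using * unfolding sdrop_expansion by (intro exI[of _ n]) auto
  qed
  then obtain k where k: "alt_le (a_seq n \<pi>) (expansion \<beta> (?X k))" "?X k < 1" by blast
  have "alt_less (expansion \<beta> (?X k)) (kneading \<beta>)" using expansion_less_iff[OF \<beta>] X k(2) by simp
  then have a: "alt_less (a_seq n \<pi>) (kneading \<beta>)" using alt_le_less_trans[OF k(1)] by blast
  have "val \<beta> (a_seq n \<pi>) \<le> val \<beta> (expansion \<beta> (?X k))"
    using X by (intro val_mono \<beta> adm_expansion adm_mono[OF alt_less_imp_le[OF a]] adm_a_seq k(1)) auto
  then have "val \<beta> (a_seq n \<pi>) < 1" using val_expansion[OF \<beta>] X k(2) by simp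
  then show "b_num (a_seq n \<pi>) < \<beta>" using b_num_less_iff[OF adm_a_seq \<beta>] a by blast
next
  assume "b_num (a_seq n \<pi>) < \<beta>"
  then have a: "alt_less (a_seq n \<pi>) (kneading \<beta>)" "val \<beta> (a_seq n \<pi>) < 1"
    using b_num_less_iff[OF adm_a_seq \<beta>] by auto
  show "(n, \<pi>) \<in> patterns {0<..1} (T_neg \<beta>)"
  proof (rule a_seq_realizable)
    fix \<zeta> y
    assume *: "consistent n \<pi> \<zeta>" "compatible n \<pi> (tail_seq n \<zeta> y)" "a_seq n \<pi> = tail_seq n \<zeta> y (m_pos n \<pi>)"
      "(\<forall>j\<in>{1..<n}. \<pi> n < \<pi> j \<longrightarrow> tail_seq n \<zeta> y j \<noteq> y) \<or>
       (\<forall>j\<in>{1..<n}. \<pi> j < \<pi> n \<longrightarrow> tail_seq n \<zeta> y j \<noteq> y)"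
    show ?thesis using realize[OF \<beta> n \<pi> *(1,2) m_pos _ _ *(4)] a unfolding *(3) by blast
  qed
qed

end

theorem theorem1:
  fixes n :: nat and \<pi> :: "nat \<Rightarrow> nat" and \<beta> :: real
  assumes "n \<ge> 1" and "\<pi> permutes {1..n}" and "\<beta> > 1"
  shows "((n, \<pi>) \<in> patterns {0<..1} (T_neg \<beta>) \<longleftrightarrow> \<beta> > b_num (a_seq n \<pi>)) \<and>
         B_minus n \<pi> = b_num (a_seq n \<pi>) \<and>
         (B_minus n \<pi> = 1 \<or> yrrap (B_minus n \<pi>))"
proof -
  let ?a = "a_seq n \<pi>"
  note pat = pattern_iff[OF assms(1,2)] and adm = adm_a_seq[OF assms(1,2)]
  have "{\<beta>. \<beta> > 1 \<and> (n, \<pi>) \<in> patterns {0<..1} (T_neg \<beta>)} = {b_num ?a<..}"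
    using pat b_num_ge_1[OF adm] by force
  then have B: "B_minus n \<pi> = b_num ?a" unfolding B_minus_def by simp
  have "eventually_periodic ?a" by (rule a_seq_realizable[OF assms(1,2)])
  then show ?thesis using pat[OF assms(3)] B yrrap_b_num[OF adm] by metis
qed

end
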